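(* Let $\delta>\delta_{\mathrm{AMP}}:=\frac{64}{\pi^2}-4$, let $\alpha_0\in\mathbb{C}$ with $0<|\alpha_0|\le1$ and let $\sigma_0^2\in[0,1)$. For $\sigma_w^2>0$ let $(\alpha_t,\sigma_t^2)$ be the SE sequences with noise level $\sigma_w^2$, and set $$\mathrm{AMSE}(\sigma_w^2,\delta):=\lim_{t\to\infty}\Big[(1-|\alpha_t|)^2+\sigma_t^2\Big].$$ Then this limit exists for all sufficiently small $\sigma_w^2>0$, and $$\lim_{\sigma_w^2\to0}\frac{\mathrm{AMSE}(\sigma_w^2,\delta)}{\sigma_w^2}=\frac{4}{1-\frac2\delta}.$$
   Context: Complex state evolution (SE). Fix $\delta>0$ and $\sigma_w^2\ge0$. For $\alpha\in\mathbb{C}$ and $\sigma^2\ge0$ with $(\alpha,\sigma^2)\neq(0,0)$, let $\theta_\alpha$ be the argument of $\alpha$ ($\theta_0:=0$) and define $$\psi_1(\alpha,\sigma^2)=e^{\mathrm{i}\theta_\alpha}\int_0^{\pi/2}\frac{|\alpha|\sin^2\theta}{(|\alpha|^2\sin^2\theta+\sigma^2)^{1/2}}\,d\theta,$$ $$\psi_2(\alpha,\sigma^2;\delta,\sigma_w^2)=\frac4\delta\Big(|\alpha|^2+\sigma^2+1-\int_0^{\pi/2}\frac{2|\alpha|^2\sin^2\theta+\sigma^2}{(|\alpha|^2\sin^2\theta+\sigma^2)^{1/2}}\,d\theta\Big)+4\sigma_w^2 .$$ Given $(\alpha_0,\sigma_0^2)$, the SE sequences are defined by $\alpha_{t+1}=\psi_1(\alpha_t,\sigma_t^2)$,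 $\sigma_{t+1}^2=\psi_2(\alpha_t,\sigma_t^2;\delta,\sigma_w^2)$ for $t\ge0$. *)

theory Defs
  imports "HOL-Analysis.Analysis"
begin

definition se_arg :: "complex \<Rightarrow> real" where
  "se_arg a = (if a = 0 then 0 else Arg a)"

definition psi1 :: "complex \<Rightarrow> real \<Rightarrow> complex" where
  "psi1 a s2 = cis (se_arg a) *
     complex_of_real (integral {0..pi/2}
       (\<lambda>\<theta>. cmod a * (sin \<theta>)\<^sup>2 / sqrt ((cmod a)\<^sup>2 * (sin \<theta>)\<^sup>2 + s2)))"

definition psi2 :: "complex \<Rightarrow> real \<Rightarrow> real \<Rightarrow> real \<Rightarrow> real" where
  "psi2 a s2 \<delta> sw2 = 4 / \<delta> * ((cmod a)\<^sup>2 + s2 + 1 -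
       integral {0..pi/2}
       (\<lambda>\<theta>. (2 * (cmod a)\<^sup>2 * (sin \<theta>)\<^sup>2 + s2) / sqrt ((cmod a)\<^sup>2 * (sin \<theta>)\<^sup>2 + s2)))
     + 4 * sw2"

fun se :: "real \<Rightarrow> real \<Rightarrow> complex \<Rightarrow> real \<Rightarrow> nat \<Rightarrow> complex \<times> real" where
  "se \<delta> sw2 a0 s0 0 = (a0, s0)"
| "se \<delta> sw2 a0 s0 (Suc t) =
     (let (a, s2) = se \<delta> sw2 a0 s0 t in (psi1 a s2, psi2 a s2 \<delta> sw2))"

definition amse_seq :: "real \<Rightarrow> real \<Rightarrow> complex \<Rightarrow> real \<Rightarrow> nat \<Rightarrow> real" where
  "amse_seq \<delta> sw2 a0 s0 t =
     (1 - cmod (fst (se \<delta> sw2 a0 s0 t)))\<^sup>2 + snd (se \<delta> sw2 a0 s0 t)"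

definition AMSE :: "real \<Rightarrow> real \<Rightarrow> complex \<Rightarrow> real \<Rightarrow> real" where
  "AMSE sw2 \<delta> a0 s0 = lim (amse_seq \<delta> sw2 a0 s0)"

end

theory Submission
  imports Defs
begin

text \<open>
  In the polar coordinates \<open>A = sqrt (a\<^sup>2 + s)\<close>, \<open>m = a\<^sup>2 / A\<^sup>2\<close> of \<open>a = \<bar>\<alpha>\<bar>\<close> and \<open>s = \<sigma>\<^sup>2\<close>, the recursion reads
  \<open>a' = sqrt m * X m\<close> and \<open>s' = 4/\<delta> * (A\<^sup>2 + 1 - 2 * A * M m) + 4 * \<sigma>\<^sub>w\<^sup>2\<close> with two elliptic integrals
  \<open>X = se_X\<close> and \<open>M = se_M\<close> satisfying
  \<open>M' = X / 4\<close> and \<open>m * (1 - m) * X' = M - X\<close>, \<open>X 1 = M 1 = 1\<close>.  Barrier arguments for this system give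
  \<open>lam_crit * (1 - M\<^sup>2) / X\<^sup>2 \<le> 1 - m - 2.65 * (M / X - 1)\<^sup>2\<close>, with equality at \<open>m = 0\<close>, where
  \<open>lam_crit = 4 / (64 / pi\<^sup>2 - 4)\<close>.  This inequality makes the region \<open>A \<le> X m\<close>, in which \<open>m\<close> increases, invariant
  from the second step on, and makes \<open>A\<close> decrease at a definite rate outside it, so without noise \<open>(a, s)\<close> tends to \<open>(1, 0)\<close>.
  For small noise the orbit therefore enters a neighbourhood of \<open>(1, 0)\<close>, where the function
  \<open>V = s + 4 * (1 - a)\<^sup>2\<close> satisfies \<open>V' \<le> k * V + 4 * \<sigma>\<^sub>w\<^sup>2\<close> and where \<open>s' \<ge> k' * s + 4 * \<sigma>\<^sub>w\<^sup>2\<close>, with \<open>k\<close> and \<open>k'\<close> as close to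
  \<open>2/\<delta>\<close> as desired; on the scale \<open>s \<approx> \<sigma>\<^sub>w\<^sup>2\<close>, \<open>1 - a = O(\<sigma>\<^sub>w\<^sup>3\<^sup>/\<^sup>2)\<close> reached in this way the recursion is a contraction.
\<close>

section \<open>Two elliptic integrals and their differential equations\<close>

text \<open>Put \<open>lam = 4/\<delta>\<close> and \<open>y = M / X - 1\<close>. A noiseless fixed
  point has \<open>A = X m\<close> and
  \<open>1 - m = lam * (y\<^sup>2 + (1 - M\<^sup>2) / X\<^sup>2)\<close>. As m tends to 0 this
  equation forces lam towards \<open>lam_crit\<close>; that is the origin of the threshold and the
  reason why m = 0 is the tight end of the inequality. Excluding fixed points with m < 1 needs only
  the coefficient \<open>lam_crit\<close> in front of \<open>y\<^sup>2\<close>; the larger 2.65 is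
  what the invariance of the region \<open>A \<le> X m\<close> requires. The obstacle near (1, 0) is
  that X behaves like 1 plus a multiple of (1 - m) log (1 - m) at m = 1, so its slope is unbounded
  and the recursion cannot be linearised there. The barrier \<open>m * (1 - m) powr (3/4)\<close>
  for y replaces the logarithm. It makes the square of 1 - a of smaller order than s, and it bounds
  the slope of X by the power -1/4 of 1 - m. Existence of the limit is proved only after the noise
  has pushed s above a multiple of w, where this slope is finite and a weight on the increments of a
  compensates it.\<close>

definition wgt :: "real \<Rightarrow> real \<Rightarrow> real" where
  "wgt m \<theta> = 1 - m * (cos \<theta>)\<^sup>2"

text \<open>After the reflection of \<theta> in pi/4 this is, for 0 < m < 1, Legendre's combination
  (E(m) - (1 - m) K(m)) / m of complete elliptic integrals with parameter m.\<close>

definition se_X :: "real \<Rightarrow> real" where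
  "se_X m = integral {0..pi/2} (\<lambda>\<theta>. (sin \<theta>)\<^sup>2 / sqrt (wgt m \<theta>))"

text \<open>The numerator equals \<open>wgt m \<theta> - (1 - m) / 2\<close>, so this is E(m) - (1 -
  m) K(m) / 2.\<close>

definition se_M :: "real \<Rightarrow> real" where
  "se_M m = integral {0..pi/2} (\<lambda>\<theta>. (m * (sin \<theta>)\<^sup>2 + (1 - m) / 2) / sqrt (wgt m \<theta>))"

lemma wgt_pos: "m < 1 \<Longrightarrow> 0 < wgt m \<theta>"
proof -
  assume "m < 1"
  then have "m * (cos \<theta>)\<^sup>2 < 1"
    using mult_left_le[of "(cos \<theta>)\<^sup>2" m] mult_nonpos_nonneg[of m "(cos \<theta>)\<^sup>2"]
    by (cases "0 \<le> m") (auto simp: abs_square_le_1)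
  then show ?thesis by (simp add: wgt_def)
qed

lemma wgt_alt: "wgt m \<theta> = m * (sin \<theta>)\<^sup>2 + (1 - m)"
  by (simp add: wgt_def cos_squared_eq algebra_simps)

lemma integrable_wgt:
  fixes f :: "real \<Rightarrow> real"
  assumes "m < 1" "continuous_on {a..b} f"
  shows "(\<lambda>\<theta>. f \<theta> / sqrt (wgt m \<theta>)) integrable_on {a..b}"
    "(\<lambda>\<theta>. f \<theta> / (wgt m \<theta> * sqrt (wgt m \<theta>))) integrable_on {a..b}"
proof -
  have "wgt m \<theta> \<noteq> 0" for \<theta> using wgt_pos[OF assms(1), of \<theta>] by simp
  moreover have "continuous_on {a..b} (wgt m)" unfolding wgt_def by (intro continuous_intros)
  ultimately show "(\<lambda>\<theta>. f \<theta> / sqrt (wgt m \<theta>)) integrable_on {a..b}"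
    "(\<lambda>\<theta>. f \<theta> / (wgt m \<theta> * sqrt (wgt m \<theta>))) integrable_on {a..b}"
    using assms by (auto intro!: integrable_continuous_real continuous_intros)
qed

lemma wgt_deriv: "((\<lambda>m. wgt m \<theta>) has_real_derivative - (cos \<theta>)\<^sup>2) (at m within U)"
  unfolding wgt_def by (auto intro!: derivative_eq_intros)

lemma sqrt_wgt_deriv:
  assumes "m < 1"
  shows "((\<lambda>m. inverse (sqrt (wgt m \<theta>))) has_real_derivative
     (cos \<theta>)\<^sup>2 / (2 * (wgt m \<theta> * sqrt (wgt m \<theta>)))) (at m within U)"
proof -
  have w: "wgt m \<theta> > 0" by (rule wgt_pos[OF assms])
  have d: "((\<lambda>m. sqrt (wgt m \<theta>)) has_real_derivative inverse (sqrt (wgt m \<theta>)) / 2 * - (cos \<theta>)\<^sup>2) (at m within U)"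
    by (rule DERIV_chain2[OF DERIV_real_sqrt[OF w] wgt_deriv])
  have "- (inverse q * (inverse q / 2 * - c) * inverse q) = c / (2 * (q * q * q))" for q c :: real
    by (cases "q = 0") (simp_all add: field_simps)
  from this[of "sqrt (wgt m \<theta>)" "(cos \<theta>)\<^sup>2"]
  have e: "- (inverse (sqrt (wgt m \<theta>)) * (inverse (sqrt (wgt m \<theta>)) / 2 * - (cos \<theta>)\<^sup>2) * inverse (sqrt (wgt m \<theta>)))
     = (cos \<theta>)\<^sup>2 / (2 * (wgt m \<theta> * sqrt (wgt m \<theta>)))"
    using w by simp
  show ?thesis
    using DERIV_inverse'[OF d] w unfolding e by simp
qed

lemma se_X_Leibniz:
  assumes "m < 1"
  shows "(se_X has_real_derivative
    integral {0..pi/2} (\<lambda>\<theta>. ((sin \<theta>)\<^sup>2 * (cos \<theta>)\<^sup>2 / 2) / (wgt m \<theta> * sqrt (wgt m \<theta>)))) (at m)"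
proof -
  have "((\<lambda>m. integral (cbox 0 (pi/2)) (\<lambda>\<theta>. (sin \<theta>)\<^sup>2 / sqrt (wgt m \<theta>))) has_real_derivative
    integral (cbox 0 (pi/2)) (\<lambda>\<theta>. ((sin \<theta>)\<^sup>2 * (cos \<theta>)\<^sup>2 / 2) / (wgt m \<theta> * sqrt (wgt m \<theta>)))) (at m within {..<1})"
  proof (rule leibniz_rule_field_derivative)
    fix x t :: real assume "x \<in> {..<1}"
    then have "x < 1" by simp
    show "((\<lambda>x. (sin t)\<^sup>2 / sqrt (wgt x t)) has_real_derivative (sin t)\<^sup>2 * (cos t)\<^sup>2 / 2 / (wgt x t * sqrt (wgt x t)))
        (at x within {..<1})"
      unfolding divide_inverse[of "(sin t)\<^sup>2" "sqrt _"]
      by (rule DERIV_cong, rule DERIV_cmult[OF sqrt_wgt_deriv[OF \<open>x < 1\<close>]]) simp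
  next
    fix x :: real assume "x \<in> {..<1}"
    then show "(\<lambda>\<theta>. (sin \<theta>)\<^sup>2 / sqrt (wgt x \<theta>)) integrable_on cbox 0 (pi / 2)"
      by (auto intro!: integrable_wgt continuous_intros)
  next
    have "wgt x t \<noteq> 0" if "x < 1" for x t using wgt_pos[OF that, of t] by simp
    then show "continuous_on ({..<1} \<times> cbox 0 (pi / 2))
     (\<lambda>(x, t). (sin t)\<^sup>2 * (cos t)\<^sup>2 / 2 / (wgt x t * sqrt (wgt x t)))"
      unfolding split_beta by (auto intro!: continuous_intros simp: wgt_def)
  qed (use assms in auto)
  then show ?thesis
    using assms unfolding se_X_def[abs_def] by (simp add: at_within_open[of m "{..<1}"])
qed

lemma se_M_Leibniz:
  assumes "m < 1"
  shows "(se_M has_real_derivative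
    integral {0..pi/2} (\<lambda>\<theta>. ((sin \<theta>)\<^sup>2 - 1/2) / sqrt (wgt m \<theta>) +
      ((m * (sin \<theta>)\<^sup>2 + (1 - m) / 2) * (cos \<theta>)\<^sup>2 / 2) / (wgt m \<theta> * sqrt (wgt m \<theta>)))) (at m)"
proof -
  have "((\<lambda>m. integral (cbox 0 (pi/2)) (\<lambda>\<theta>. (m * (sin \<theta>)\<^sup>2 + (1 - m) / 2) / sqrt (wgt m \<theta>))) has_real_derivative
    integral (cbox 0 (pi/2)) (\<lambda>\<theta>. ((sin \<theta>)\<^sup>2 - 1/2) / sqrt (wgt m \<theta>) +
      ((m * (sin \<theta>)\<^sup>2 + (1 - m) / 2) * (cos \<theta>)\<^sup>2 / 2) / (wgt m \<theta> * sqrt (wgt m \<theta>)))) (at m within {..<1})"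
  proof (rule leibniz_rule_field_derivative)
    fix x t :: real assume "x \<in> {..<1}"
    then have "x < 1" by simp
    have d: "((\<lambda>x. x * (sin t)\<^sup>2 + (1 - x) / 2) has_real_derivative ((sin t)\<^sup>2 - 1/2)) (at x within {..<1})"
      by (auto intro!: derivative_eq_intros)
    show "((\<lambda>x. (x * (sin t)\<^sup>2 + (1 - x) / 2) / sqrt (wgt x t)) has_real_derivative
        ((sin t)\<^sup>2 - 1/2) / sqrt (wgt x t) +
      ((x * (sin t)\<^sup>2 + (1 - x) / 2) * (cos t)\<^sup>2 / 2) / (wgt x t * sqrt (wgt x t)))
        (at x within {..<1})"
      unfolding divide_inverse[of _ "sqrt _"]
      by (rule DERIV_cong, rule DERIV_mult[OF d sqrt_wgt_deriv[OF \<open>x < 1\<close>]]) simp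
  next
    fix x :: real assume "x \<in> {..<1}"
    then show "(\<lambda>\<theta>. (x * (sin \<theta>)\<^sup>2 + (1 - x) / 2) / sqrt (wgt x \<theta>)) integrable_on cbox 0 (pi / 2)"
      by (auto intro!: integrable_wgt continuous_intros)
  next
    have "wgt x t \<noteq> 0" if "x < 1" for x t using wgt_pos[OF that, of t] by simp
    then show "continuous_on ({..<1} \<times> cbox 0 (pi / 2))
     (\<lambda>(x, t). ((sin t)\<^sup>2 - 1/2) / sqrt (wgt x t) +
      ((x * (sin t)\<^sup>2 + (1 - x) / 2) * (cos t)\<^sup>2 / 2) / (wgt x t * sqrt (wgt x t)))"
      unfolding split_beta by (auto intro!: continuous_intros simp: wgt_def)
  qed (use assms in auto)
  then show ?thesis
    using assms unfolding se_M_def[abs_def] by (simp add: at_within_open[of m "{..<1}"])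
qed

lemma combine_sqrt_fractions:
  fixes w :: real
  assumes "0 < w"
  shows "a / sqrt w + c * (p / (w * sqrt w)) = (a * w + c * p) / (w * sqrt w)"
  using assms by (simp add: add_divide_distrib)

text \<open>The integrand is the \<theta>-derivative of
  \<open>sin \<theta> * cos \<theta> / sqrt (wgt m \<theta>)\<close>, which vanishes at both ends.
  Multiples of this null integral trade the exponent 3/2, created by differentiating under the
  integral, for the exponent 1/2.\<close>

lemma total_derivative_integral:
  assumes "m < 1"
  shows "((\<lambda>\<theta>. ((1 - m) * (cos \<theta>)\<^sup>2 - (sin \<theta>)\<^sup>2 * wgt m \<theta>) / (wgt m \<theta> * sqrt (wgt m \<theta>)))
     has_integral 0) {0..pi/2}"
proof -
  have *: "((\<lambda>\<theta>. sin \<theta> * cos \<theta> / sqrt (wgt m \<theta>)) has_real_derivative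
     ((1 - m) * (cos \<theta>)\<^sup>2 - (sin \<theta>)\<^sup>2 * wgt m \<theta>) / (wgt m \<theta> * sqrt (wgt m \<theta>))) (at \<theta> within S)" for \<theta> S
  proof -
    have w: "wgt m \<theta> > 0" by (rule wgt_pos[OF assms])
    have d: "((\<lambda>\<theta>. wgt m \<theta>) has_real_derivative 2 * m * sin \<theta> * cos \<theta>) (at \<theta> within S)"
      unfolding wgt_def by (auto intro!: derivative_eq_intros)
    have d2: "((\<lambda>\<theta>. sqrt (wgt m \<theta>)) has_real_derivative m * sin \<theta> * cos \<theta> / sqrt (wgt m \<theta>)) (at \<theta> within S)"
      by (rule DERIV_cong, rule DERIV_chain2[OF DERIV_real_sqrt[OF w] d]) (simp add: field_simps)
    have sq: "sqrt (wgt m \<theta>) * sqrt (wgt m \<theta>) = wgt m \<theta>" using w by simp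
    have e: "((cos \<theta>)\<^sup>2 - (sin \<theta>)\<^sup>2) * wgt m \<theta> - m * (sin \<theta>)\<^sup>2 * (cos \<theta>)\<^sup>2
       = (1 - m) * (cos \<theta>)\<^sup>2 - (sin \<theta>)\<^sup>2 * wgt m \<theta>"
      unfolding wgt_def sin_squared_eq by (simp add: field_simps power2_eq_square)
    have n: "(cos \<theta> * cos \<theta> + - sin \<theta> * sin \<theta>) * q - sin \<theta> * cos \<theta> * (m * sin \<theta> * cos \<theta> / q)
        = ((((cos \<theta>)\<^sup>2 - (sin \<theta>)\<^sup>2) * (q * q) - m * (sin \<theta>)\<^sup>2 * (cos \<theta>)\<^sup>2)) / q" if "q \<noteq> 0" for q
      using that by (simp add: power2_eq_square field_simps)
    have sc: "((\<lambda>\<theta>. sin \<theta> * cos \<theta>) has_real_derivative (cos \<theta> * cos \<theta> + - sin \<theta> * sin \<theta>)) (at \<theta> within S)"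
      by (auto intro!: derivative_eq_intros)
    have "((\<lambda>\<theta>. sin \<theta> * cos \<theta> / sqrt (wgt m \<theta>)) has_real_derivative
       ((cos \<theta> * cos \<theta> + - sin \<theta> * sin \<theta>) * sqrt (wgt m \<theta>) - sin \<theta> * cos \<theta> * (m * sin \<theta> * cos \<theta> / sqrt (wgt m \<theta>)))
         / (sqrt (wgt m \<theta>) * sqrt (wgt m \<theta>))) (at \<theta> within S)"
      by (rule DERIV_divide[OF sc d2]) (use w in simp)
    then show ?thesis
      by (rule DERIV_cong) (subst n, use w in simp, simp only: e sq, simp add: mult.commute)
  qed
  have "((\<lambda>\<theta>. ((1 - m) * (cos \<theta>)\<^sup>2 - (sin \<theta>)\<^sup>2 * wgt m \<theta>) / (wgt m \<theta> * sqrt (wgt m \<theta>)))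
     has_integral (sin (pi/2) * cos (pi/2) / sqrt (wgt m (pi/2)) - sin 0 * cos 0 / sqrt (wgt m 0))) {0..pi/2}"
    by (rule fundamental_theorem_of_calculus)
      (use * in \<open>auto simp: has_real_derivative_iff_has_vector_derivative[symmetric]\<close>)
  then show ?thesis by simp
qed

lemma se_M_deriv:
  assumes "m < 1"
  shows "(se_M has_real_derivative se_X m / 4) (at m)"
proof -
  let ?p = "\<lambda>\<theta>. ((1 - m) * (cos \<theta>)\<^sup>2 - (sin \<theta>)\<^sup>2 * wgt m \<theta>) / (wgt m \<theta> * sqrt (wgt m \<theta>))"
  let ?f = "\<lambda>\<theta>. ((sin \<theta>)\<^sup>2 - 1/2) / sqrt (wgt m \<theta>) +
      ((m * (sin \<theta>)\<^sup>2 + (1 - m) / 2) * (cos \<theta>)\<^sup>2 / 2) / (wgt m \<theta> * sqrt (wgt m \<theta>))"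
  have "((\<lambda>\<theta>. (sin \<theta>)\<^sup>2 / sqrt (wgt m \<theta>)) has_integral se_X m) {0..pi/2}"
    unfolding se_X_def by (intro integrable_integral integrable_wgt assms continuous_intros)
  \<comment> \<open>The multiple -1/4 is the one for which the two integrands agree
    pointwise.\<close>
  from has_integral_add[OF has_integral_mult_right[OF this, of "1/4"]
      has_integral_mult_right[OF total_derivative_integral[OF assms], of "-1/4"]]
  have i: "((\<lambda>\<theta>. 1/4 * ((sin \<theta>)\<^sup>2 / sqrt (wgt m \<theta>)) + - 1/4 * ?p \<theta>) has_integral se_X m / 4) {0..pi/2}"
    by simp
  have "1/4 * ((sin \<theta>)\<^sup>2 / sqrt (wgt m \<theta>)) + - 1/4 * ?p \<theta> = ?f \<theta>" for \<theta>
  proof -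
    have w: "wgt m \<theta> > 0" by (rule wgt_pos[OF assms])
    have e: "(sin \<theta>)\<^sup>2 * wgt m \<theta> / 4 - ((1 - m) * (cos \<theta>)\<^sup>2 - (sin \<theta>)\<^sup>2 * wgt m \<theta>) / 4
      = ((sin \<theta>)\<^sup>2 - 1/2) * wgt m \<theta> + (m * (sin \<theta>)\<^sup>2 + (1 - m) / 2) * (cos \<theta>)\<^sup>2 / 2"
      unfolding wgt_def sin_squared_eq by (simp add: field_simps power2_eq_square)
    have "1/4 * ((sin \<theta>)\<^sup>2 / sqrt (wgt m \<theta>)) + - 1/4 * ?p \<theta> =
      ((sin \<theta>)\<^sup>2 * wgt m \<theta> / 4 - ((1 - m) * (cos \<theta>)\<^sup>2 - (sin \<theta>)\<^sup>2 * wgt m \<theta>) / 4) / (wgt m \<theta> * sqrt (wgt m \<theta>))"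
      using combine_sqrt_fractions[OF w, of "(sin \<theta>)\<^sup>2 / 4" "-1/4"] by simp
    also have "\<dots> = ?f \<theta>" unfolding e using combine_sqrt_fractions[OF w, of "(sin \<theta>)\<^sup>2 - 1/2" 1
      "(m * (sin \<theta>)\<^sup>2 + (1 - m) / 2) * (cos \<theta>)\<^sup>2 / 2"] by simp
    finally show ?thesis .
  qed
  with i have "(?f has_integral se_X m / 4) {0..pi/2}" by (simp only:)
  with se_M_Leibniz[OF assms] show ?thesis by (simp add: integral_unique)
qed

text \<open>The equation is kept free of division because it degenerates at m = 0; the sign of D
  comes from the integrand instead and so is available there too.\<close>

lemma se_X_deriv:
  assumes "m < 1"
  shows "\<exists>D. (se_X has_real_derivative D) (at m) \<and> m * (1 - m) * D = se_M m - se_X m \<and> 0 \<le> D"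
proof -
  let ?p = "\<lambda>\<theta>. ((1 - m) * (cos \<theta>)\<^sup>2 - (sin \<theta>)\<^sup>2 * wgt m \<theta>) / (wgt m \<theta> * sqrt (wgt m \<theta>))"
  let ?f = "\<lambda>\<theta>. ((sin \<theta>)\<^sup>2 * (cos \<theta>)\<^sup>2 / 2) / (wgt m \<theta> * sqrt (wgt m \<theta>))"
  have x: "((\<lambda>\<theta>. (sin \<theta>)\<^sup>2 / sqrt (wgt m \<theta>)) has_integral se_X m) {0..pi/2}"
    unfolding se_X_def by (intro integrable_integral integrable_wgt assms continuous_intros)
  have mm: "((\<lambda>\<theta>. (m * (sin \<theta>)\<^sup>2 + (1 - m) / 2) / sqrt (wgt m \<theta>)) has_integral se_M m) {0..pi/2}"
    unfolding se_M_def by (intro integrable_integral integrable_wgt assms continuous_intros) auto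
  have i: "((\<lambda>\<theta>. ((m * (sin \<theta>)\<^sup>2 + (1 - m) / 2) / sqrt (wgt m \<theta>) - (sin \<theta>)\<^sup>2 / sqrt (wgt m \<theta>))
       + - (1 - m) / 2 * ?p \<theta>) has_integral se_M m - se_X m) {0..pi/2}"
    using has_integral_add[OF has_integral_diff[OF mm x]
        has_integral_mult_right[OF total_derivative_integral[OF assms], of "-(1 - m) / 2"]] by simp
  have "((m * (sin \<theta>)\<^sup>2 + (1 - m) / 2) / sqrt (wgt m \<theta>) - (sin \<theta>)\<^sup>2 / sqrt (wgt m \<theta>))
       + - (1 - m) / 2 * ?p \<theta> = m * (1 - m) * ?f \<theta>" for \<theta>
  proof -
    have w: "wgt m \<theta> > 0" by (rule wgt_pos[OF assms])
    have e: "((m * (sin \<theta>)\<^sup>2 + (1 - m) / 2) - (sin \<theta>)\<^sup>2) * wgt m \<theta>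
        + - (1 - m) / 2 * ((1 - m) * (cos \<theta>)\<^sup>2 - (sin \<theta>)\<^sup>2 * wgt m \<theta>)
      = m * (1 - m) * ((sin \<theta>)\<^sup>2 * (cos \<theta>)\<^sup>2 / 2)"
      unfolding wgt_def sin_squared_eq by (simp add: field_simps power2_eq_square)
    have "((m * (sin \<theta>)\<^sup>2 + (1 - m) / 2) / sqrt (wgt m \<theta>) - (sin \<theta>)\<^sup>2 / sqrt (wgt m \<theta>))
       + - (1 - m) / 2 * ?p \<theta> = (((m * (sin \<theta>)\<^sup>2 + (1 - m) / 2) - (sin \<theta>)\<^sup>2) * wgt m \<theta>
        + - (1 - m) / 2 * ((1 - m) * (cos \<theta>)\<^sup>2 - (sin \<theta>)\<^sup>2 * wgt m \<theta>)) / (wgt m \<theta> * sqrt (wgt m \<theta>))"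
      by (simp only: combine_sqrt_fractions[OF w] diff_divide_distrib[symmetric])
    also have "\<dots> = m * (1 - m) * ?f \<theta>" unfolding e by (simp only: times_divide_eq_right)
    finally show ?thesis .
  qed
  with i have "((\<lambda>\<theta>. m * (1 - m) * ?f \<theta>) has_integral se_M m - se_X m) {0..pi/2}" by (simp only:)
  moreover have "((\<lambda>\<theta>. m * (1 - m) * ?f \<theta>) has_integral (m * (1 - m) * integral {0..pi/2} ?f)) {0..pi/2}"
    by (intro has_integral_mult_right integrable_integral integrable_wgt assms continuous_intros) auto
  ultimately have "m * (1 - m) * integral {0..pi/2} ?f = se_M m - se_X m"
    using has_integral_unique by blast
  moreover have "0 \<le> integral {0..pi/2} ?f"
    using wgt_pos[OF assms] by (intro integral_nonneg integrable_wgt assms continuous_intros)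
      (auto intro!: divide_nonneg_nonneg mult_nonneg_nonneg simp: less_imp_le)
  ultimately show ?thesis using se_X_Leibniz[OF assms] by blast
qed

text \<open>Comparison principle: the sign of the derivative is demanded only where h is already
  positive, so that this positivity can be fed into a differential equation. If h x > 0, the mean
  value theorem between the last earlier point with h \<le> 0 and x gives a contradiction.\<close>

lemma nonpos_of_deriv_nonpos_above:
  fixes h :: "real \<Rightarrow> real"
  assumes cont: "continuous_on {a..b} h" and a: "h a \<le> 0"
    and d: "\<And>x. a < x \<Longrightarrow> x < b \<Longrightarrow> 0 < h x \<Longrightarrow> \<exists>D. (h has_real_derivative D) (at x) \<and> D \<le> 0"
    and x: "x \<in> {a..b}"
  shows "h x \<le> 0"
proof (rule ccontr)
  assume "\<not> h x \<le> 0"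
  then have hx: "0 < h x" by simp
  define S where "S = {a..x} \<inter> h -` {..0}"
  have cx: "continuous_on {a..x} h" by (rule continuous_on_subset[OF cont]) (use x in auto)
  have "closed S" unfolding S_def
    by (rule continuous_closed_preimage[OF cx]) auto
  moreover have "S \<noteq> {}" "bdd_above S" using a x by (auto simp: S_def)
  ultimately have c: "Sup S \<in> S" by (rule closed_contains_Sup[rotated -1])
  define c where "c = Sup S"
  have c': "a \<le> c" "c \<le> x" "h c \<le> 0" using c by (auto simp: S_def c_def)
  have pos: "0 < h t" if "c < t" "t \<le> x" for t
  proof (rule ccontr)
    assume "\<not> 0 < h t"
    then have "t \<in> S" using that c' by (auto simp: S_def)
    then have "t \<le> c" unfolding c_def using \<open>bdd_above S\<close> by (rule cSup_upper)
    then show False using that by simp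
  qed
  have "c < x" using c' hx by (metis less_eq_real_def not_less)
  have "\<exists>l z. c < z \<and> z < x \<and> (h has_real_derivative l) (at z) \<and> h x - h c = (x - c) * l"
  proof (rule MVT[OF \<open>c < x\<close>])
    show "continuous_on {c..x} h" by (rule continuous_on_subset[OF cont]) (use x c' in auto)
    show "h differentiable (at z)" if "c < z" "z < x" for z
      using d[of z] pos[of z] that c' x by (auto simp: real_differentiable_def)
  qed
  then obtain l z where z: "c < z" "z < x" "(h has_real_derivative l) (at z)" "h x - h c = (x - c) * l" by blast
  obtain D where "(h has_real_derivative D) (at z)" "D \<le> 0" using d[of z] pos[of z] z c' x by auto
  then have "l \<le> 0" using z(3) DERIV_unique by blast
  then have "(x - c) * l \<le> 0" using \<open>c < x\<close> by (simp add: mult_nonneg_nonpos)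
  then show False using z(4) hx c' by linarith
qed

section \<open>Boundary values, behaviour at m = 1 and monotonicity\<close>

lemma sin_integral: "(sin has_integral 1) {0..pi/2}"
proof -
  have "(sin has_integral (- cos (pi/2) - (- cos 0))) {0..pi/2}"
    by (rule fundamental_theorem_of_calculus)
      (auto intro!: derivative_eq_intros simp: has_real_derivative_iff_has_vector_derivative[symmetric])
  then show ?thesis by simp
qed

lemma se_X_1: "se_X 1 = 1" and se_M_1: "se_M 1 = 1"
proof -
  have e: "(sin \<theta>)\<^sup>2 / sqrt (wgt 1 \<theta>) = sin \<theta>" if "\<theta> \<in> {0..pi/2}" for \<theta>
  proof -
    have "0 \<le> sin \<theta>" using that by (intro sin_ge_zero) auto
    moreover have "wgt 1 \<theta> = (sin \<theta>)\<^sup>2" by (simp add: wgt_alt)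
    ultimately show ?thesis by (simp add: power2_eq_square)
  qed
  have "((\<lambda>\<theta>. (sin \<theta>)\<^sup>2 / sqrt (wgt 1 \<theta>)) has_integral 1) {0..pi/2}"
    using sin_integral by (subst has_integral_cong[OF e]) auto
  then show "se_X 1 = 1" "se_M 1 = 1" unfolding se_X_def se_M_def by (auto dest: integral_unique)
qed

lemma se_X_0: "se_X 0 = pi/4" and se_M_0: "se_M 0 = pi/4"
proof -
  have "((\<lambda>\<theta>. (sin \<theta>)\<^sup>2) has_integral ((pi/2 - sin (pi/2) * cos (pi/2))/2 - (0 - sin 0 * cos 0)/2)) {0..pi/2}"
    by (rule fundamental_theorem_of_calculus)
      (auto intro!: derivative_eq_intros simp: has_real_derivative_iff_has_vector_derivative[symmetric]
         power2_eq_square[symmetric] cos_squared_eq)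
  then show "se_X 0 = pi/4" unfolding se_X_def by (auto dest: integral_unique simp: wgt_def)
  show "se_M 0 = pi/4" unfolding se_M_def by (auto simp: wgt_def)
qed

lemma sqrt_wgt_bounds:
  assumes "0 \<le> m" "m < 1" "\<theta> \<in> {0..pi/2}"
  shows "0 \<le> sin \<theta>" "sin \<theta> \<le> sqrt (wgt m \<theta>)" "sqrt (wgt m \<theta>) \<le> sin \<theta> + sqrt (1 - m)"
    "sqrt (1 - m) \<le> sqrt (wgt m \<theta>)" "sqrt (wgt m \<theta>) \<le> 1" "0 < sqrt (wgt m \<theta>)"
proof -
  show s: "0 \<le> sin \<theta>" using assms by (intro sin_ge_zero) auto
  have c: "0 \<le> (cos \<theta>)\<^sup>2" "(cos \<theta>)\<^sup>2 \<le> 1" by (auto simp: abs_square_le_1)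
  have w: "wgt m \<theta> = (sin \<theta>)\<^sup>2 + (1 - m) * (cos \<theta>)\<^sup>2" by (simp add: wgt_def sin_squared_eq algebra_simps)
  have le: "(1 - m) * (cos \<theta>)\<^sup>2 \<le> 1 - m" using assms c by (intro mult_left_le) auto
  have ge: "0 \<le> (1 - m) * (cos \<theta>)\<^sup>2" using assms by simp
  show "sin \<theta> \<le> sqrt (wgt m \<theta>)" using ge by (intro real_le_rsqrt) (simp add: w)
  have "sqrt (wgt m \<theta>) \<le> sqrt ((sin \<theta>)\<^sup>2 + (1 - m))" using le by (simp add: w)
  also have "\<dots> \<le> sqrt ((sin \<theta>)\<^sup>2) + sqrt (1 - m)" using assms by (intro sqrt_add_le_add_sqrt) auto
  finally show "sqrt (wgt m \<theta>) \<le> sin \<theta> + sqrt (1 - m)" using s by simp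
  have "m * (cos \<theta>)\<^sup>2 \<le> m" using assms c by (intro mult_left_le) auto
  then show "sqrt (1 - m) \<le> sqrt (wgt m \<theta>)" by (simp add: wgt_def)
  show "sqrt (wgt m \<theta>) \<le> 1" using assms by (simp add: wgt_def)
  show "0 < sqrt (wgt m \<theta>)" using wgt_pos[of m \<theta>] assms by simp
qed

lemma se_X_integral:
  "m < 1 \<Longrightarrow> ((\<lambda>\<theta>. (sin \<theta>)\<^sup>2 / sqrt (wgt m \<theta>)) has_integral se_X m) {0..pi/2}"
  unfolding se_X_def by (intro integrable_integral integrable_wgt continuous_intros)

lemma se_M_integral:
  "m < 1 \<Longrightarrow> ((\<lambda>\<theta>. (m * (sin \<theta>)\<^sup>2 + (1 - m) / 2) / sqrt (wgt m \<theta>)) has_integral se_M m) {0..pi/2}"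
  unfolding se_M_def by (intro integrable_integral integrable_wgt continuous_intros) auto

lemma se_X_M_near_1:
  assumes "0 \<le> m" "m < 1"
  shows "\<bar>se_X m - 1\<bar> \<le> pi/2 * sqrt (1 - m)" "\<bar>se_M m - 1\<bar> \<le> 3/2 * sqrt (1 - m) * (pi/2)"
proof -
  have b: "\<bar>(sin \<theta>)\<^sup>2 / sqrt (wgt m \<theta>) - sin \<theta>\<bar> \<le> sqrt (1 - m)"
    "\<bar>(m * (sin \<theta>)\<^sup>2 + (1 - m) / 2) / sqrt (wgt m \<theta>) - sin \<theta>\<bar> \<le> 3/2 * sqrt (1 - m)"
    if "\<theta> \<in> {0..pi/2}" for \<theta>
  proof -
    define r where "r = sqrt (wgt m \<theta>)"
    define e where "e = sqrt (1 - m)"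
    note q = sqrt_wgt_bounds[OF assms that, folded r_def e_def]
    have r2: "m * (sin \<theta>)\<^sup>2 + (1 - m) = r * r" using q(6) unfolding r_def by (simp add: wgt_alt)
    have e2: "1 - m = e * e" using assms unfolding e_def by simp
    have "sin \<theta> - (sin \<theta>)\<^sup>2 / r = (sin \<theta> / r) * (r - sin \<theta>)" using q(6) by (simp add: field_simps power2_eq_square)
    moreover have "0 \<le> sin \<theta> / r" "sin \<theta> / r \<le> 1" using q by auto
    then have "(sin \<theta> / r) * (r - sin \<theta>) \<le> r - sin \<theta>" "0 \<le> (sin \<theta> / r) * (r - sin \<theta>)"
      using q(2) mult_left_le_one_le[of "r - sin \<theta>" "sin \<theta> / r"] mult_nonneg_nonneg[of "sin \<theta> / r" "r - sin \<theta>"] by linarith+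
    ultimately have "\<bar>(sin \<theta>)\<^sup>2 / r - sin \<theta>\<bar> \<le> e" using q by linarith
    then show "\<bar>(sin \<theta>)\<^sup>2 / sqrt (wgt m \<theta>) - sin \<theta>\<bar> \<le> sqrt (1 - m)" by (simp add: r_def e_def)
    have "m * (sin \<theta>)\<^sup>2 + (1 - m) / 2 = r * r - e * e / 2" using r2 e2 by (simp add: field_simps)
    then have eq: "(m * (sin \<theta>)\<^sup>2 + (1 - m) / 2) / r = r - e * (e / r) / 2" using q(6) by (simp add: field_simps)
    have e0: "0 \<le> e" using assms by (simp add: e_def)
    define k where "k = e * (e / r)"
    have "0 \<le> e / r" "e / r \<le> 1" using q e0 by auto
    then have "0 \<le> k" "k \<le> e" unfolding k_def using e0 by (rule_tac mult_nonneg_nonneg mult_left_le; simp)+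
    then have "\<bar>r - k / 2 - sin \<theta>\<bar> \<le> 3/2 * e" using q e0 by (intro abs_leI) linarith+
    then have "\<bar>(m * (sin \<theta>)\<^sup>2 + (1 - m) / 2) / r - sin \<theta>\<bar> \<le> 3/2 * e"
      unfolding k_def using eq by simp
    then show "\<bar>(m * (sin \<theta>)\<^sup>2 + (1 - m) / 2) / sqrt (wgt m \<theta>) - sin \<theta>\<bar> \<le> 3/2 * sqrt (1 - m)" by (simp add: r_def e_def)
  qed
  have "norm (se_X m - 1) \<le> sqrt (1 - m) * Henstock_Kurzweil_Integration.content (cbox 0 (pi/2))"
    by (rule has_integral_bound[OF _ has_integral_diff[OF se_X_integral[OF assms(2)] sin_integral, folded cbox_interval]])
      (use b assms in auto)
  then show "\<bar>se_X m - 1\<bar> \<le> pi/2 * sqrt (1 - m)" by (simp add: mult.commute)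
  have "norm (se_M m - 1) \<le> 3/2 * sqrt (1 - m) * Henstock_Kurzweil_Integration.content (cbox 0 (pi/2))"
    by (rule has_integral_bound[OF _ has_integral_diff[OF se_M_integral[OF assms(2)] sin_integral, folded cbox_interval]])
      (use b assms in auto)
  then show "\<bar>se_M m - 1\<bar> \<le> 3/2 * sqrt (1 - m) * (pi/2)" by simp
qed

lemma continuous_on_0_1_if:
  fixes f :: "real \<Rightarrow> real"
  assumes "\<And>m. 0 \<le> m \<Longrightarrow> m < 1 \<Longrightarrow> isCont f m"
    and "\<And>m. 0 \<le> m \<Longrightarrow> m < 1 \<Longrightarrow> \<bar>f m - f 1\<bar> \<le> K * sqrt (1 - m)"
  shows "continuous_on {0..1} f"
  unfolding continuous_on_eq_continuous_within
proof
  fix m :: real assume m: "m \<in> {0..1}"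
  show "continuous (at m within {0..1}) f"
  proof (cases "m < 1")
    case True
    then show ?thesis using assms(1)[of m] m continuous_at_imp_continuous_within by auto
  next
    case False
    then have m1: "m = 1" using m by simp
    have "((\<lambda>x. K * sqrt (1 - x)) \<longlongrightarrow> K * sqrt (1 - 1)) (at 1 within {0..1})"
      by (intro tendsto_intros)
    then have l: "((\<lambda>x. K * sqrt (1 - x)) \<longlongrightarrow> 0) (at 1 within {0..1})" by simp
    have "((\<lambda>x. f x - f 1) \<longlongrightarrow> 0) (at 1 within {0..1})"
    proof (rule Lim_null_comparison[OF _ l])
      show "\<forall>\<^sub>F x in at 1 within {0..1}. norm (f x - f 1) \<le> K * sqrt (1 - x)"
        unfolding eventually_at_filter by (rule always_eventually) (use assms(2) in auto)
    qed
    then show ?thesis unfolding m1 continuous_within by (simp add: LIM_zero_iff)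
  qed
qed

lemma continuous_se_X: "continuous_on {0..1} se_X"
proof (rule continuous_on_0_1_if)
  show "isCont se_X m" if "m < 1" for m using se_X_Leibniz[OF that] DERIV_isCont by blast
  show "\<bar>se_X m - se_X 1\<bar> \<le> pi/2 * sqrt (1 - m)" if "0 \<le> m" "m < 1" for m
    using se_X_M_near_1[OF that] by (simp add: se_X_1)
qed

lemma continuous_se_M: "continuous_on {0..1} se_M"
proof (rule continuous_on_0_1_if)
  show "isCont se_M m" if "m < 1" for m using se_M_Leibniz[OF that] DERIV_isCont by blast
  show "\<bar>se_M m - se_M 1\<bar> \<le> 3/2 * (pi/2) * sqrt (1 - m)" if "0 \<le> m" "m < 1" for m
    using se_X_M_near_1(2)[OF that] by (simp add: se_M_1 mult_ac)
qed

lemma se_X_mono: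
  assumes "0 \<le> m" "m \<le> m'" "m' \<le> 1"
  shows "se_X m \<le> se_X m'"
proof (cases "m = m'")
  case False
  have "\<exists>y. ((se_X has_real_derivative y) (at x) \<and> 0 \<le> y)" if "m < x" "x < m'" for x
    using se_X_deriv[of x] that assms by auto
  then show ?thesis
    by (intro DERIV_nonneg_imp_increasing_open[OF assms(2)] continuous_on_subset[OF continuous_se_X])
      (use assms in auto)
qed simp

lemma se_X_ge: "0 \<le> m \<Longrightarrow> m \<le> 1 \<Longrightarrow> pi/4 \<le> se_X m"
  using se_X_mono[of 0 m] by (simp add: se_X_0)

lemma se_X_pos: "0 \<le> m \<Longrightarrow> m \<le> 1 \<Longrightarrow> 0 < se_X m"
  using se_X_ge[of m] pi_gt_zero by linarith

lemma se_X_le_1: "0 \<le> m \<Longrightarrow> m \<le> 1 \<Longrightarrow> se_X m \<le> 1"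
  using se_X_mono[of m 1] by (simp add: se_X_1)

text \<open>The mean value theorem for M' = X / 4, with X increasing.\<close>

lemma se_M_increment:
  assumes "0 \<le> m" "m \<le> m'" "m' \<le> 1"
  shows "se_X m * (m' - m) / 4 \<le> se_M m' - se_M m" "se_M m' - se_M m \<le> se_X m' * (m' - m) / 4"
proof -
  have "se_X m * (m' - m) / 4 \<le> se_M m' - se_M m \<and> se_M m' - se_M m \<le> se_X m' * (m' - m) / 4"
  proof (cases "m = m'")
    case False
    then have "m < m'" using assms by simp
    have "\<exists>l z. m < z \<and> z < m' \<and> (se_M has_real_derivative l) (at z) \<and> se_M m' - se_M m = (m' - m) * l"
      by (rule MVT[OF \<open>m < m'\<close>])
        (use assms se_M_deriv in \<open>auto intro!: continuous_on_subset[OF continuous_se_M] simp: real_differentiable_def\<close>,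
         metis less_le_trans)
    then obtain l z where z: "m < z" "z < m'" "(se_M has_real_derivative l) (at z)" "se_M m' - se_M m = (m' - m) * l"
      by blast
    have "l = se_X z / 4" using z se_M_deriv[of z] assms DERIV_unique by fastforce
    moreover have "se_X m \<le> se_X z" "se_X z \<le> se_X m'" using se_X_mono z assms by auto
    ultimately show ?thesis using z \<open>m < m'\<close>
      by (simp add: mult.commute)
  qed simp
  then show "se_X m * (m' - m) / 4 \<le> se_M m' - se_M m" "se_M m' - se_M m \<le> se_X m' * (m' - m) / 4" by auto
qed

lemma se_M_mono:
  assumes "0 \<le> m" "m \<le> m'" "m' \<le> 1"
  shows "se_M m \<le> se_M m'"
proof -
  have "0 \<le> se_X m * (m' - m) / 4" using assms se_X_pos[of m] by simp
  then show ?thesis using se_M_increment[OF assms] by linarith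
qed

lemma se_M_ge: "0 \<le> m \<Longrightarrow> m \<le> 1 \<Longrightarrow> 1 - se_M m \<le> (1 - m) / 4"
  using se_M_increment(2)[of m 1] by (simp add: se_M_1 se_X_1)

lemma se_M_ge_pi: "0 \<le> m \<Longrightarrow> m \<le> 1 \<Longrightarrow> pi/4 \<le> se_M m"
  using se_M_mono[of 0 m] by (simp add: se_M_0)

lemma se_M_le: "0 \<le> m \<Longrightarrow> m \<le> 1 \<Longrightarrow> se_M m \<le> 1 - se_X m * (1 - m) / 4"
  using se_M_increment[of m 1] by (simp add: se_M_1)

lemma se_M_le_1: "0 \<le> m \<Longrightarrow> m \<le> 1 \<Longrightarrow> se_M m \<le> 1"
  using se_M_mono[of m 1] by (simp add: se_M_1)

lemma se_X_le_M:
  assumes "0 \<le> m" "m \<le> 1" shows "se_X m \<le> se_M m"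
proof (cases "m = 1")
  case False
  then obtain D where "m * (1 - m) * D = se_M m - se_X m" "0 \<le> D" using se_X_deriv[of m] assms by auto
  moreover have "0 \<le> m * (1 - m) * D" using assms \<open>0 \<le> D\<close> by simp
  ultimately show ?thesis by linarith
qed (simp add: se_X_1 se_M_1)

text \<open>Product of 1 - M \<ge> X (1 - m) / 4 and 1 + M \<ge> 2 X.\<close>

lemma one_minus_M_sq_ge:
  assumes "0 \<le> m" "m \<le> 1" shows "(1 - m) / 2 * (se_X m)\<^sup>2 \<le> 1 - (se_M m)\<^sup>2"
proof -
  have "se_X m * (1 - m) / 4 \<le> 1 - se_M m" using se_M_le[OF assms] by simp
  moreover have "2 * se_X m \<le> 1 + se_M m" using se_X_le_M[OF assms] se_X_le_1[OF assms] by simp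
  ultimately have "(se_X m * (1 - m) / 4) * (2 * se_X m) \<le> (1 - se_M m) * (1 + se_M m)"
    using assms se_X_pos[OF assms] se_M_le_1[OF assms] by (intro mult_mono) auto
  moreover have "(se_X m * (1 - m) / 4) * (2 * se_X m) = (1 - m) / 2 * (se_X m)\<^sup>2"
    by (simp add: power2_eq_square)
  moreover have "(1 - se_M m) * (1 + se_M m) = 1 - (se_M m)\<^sup>2"
    by (simp add: power2_eq_square algebra_simps)
  ultimately show ?thesis by linarith
qed

section \<open>The inequality behind the threshold\<close>

text \<open>These polynomials are \<open>1 - m\<close> times, respectively a lower bound for, the slack in the differential inequalities for
  the barriers of \<open>se_y_ge_poly\<close> and \<open>se_gap_ge_poly\<close> below, whose coefficients were found numerically.  Their
  positivity is read off the Bernstein expansions on \<open>[0, 2/5]\<close> and \<open>[2/5, 4/5]\<close>.\<close>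

lemma lower_barrier_poly:
  fixes m :: real
  assumes "0 \<le> m" "m \<le> 4/5"
  shows "0 \<le> (1 - m) / 4 - (1 - m) * ((249/2000 - 7/125 * m - 49/1000 * m ^ 4) + m * (- 7/125 - 49/250 * m ^ 3)) - (249/2000 - 7/125 * m - 49/1000 * m ^ 4) - m * (249/2000 - 7/125 * m - 49/1000 * m ^ 4)\<^sup>2"
proof (cases "m \<le> 2/5")
  case True
  have "2000000000000000 * ((1 - m) / 4 - (1 - m) * ((249/2000 - 7/125 * m - 49/1000 * m ^ 4) + m * (- 7/125 - 49/250 * m ^ 3)) - (249/2000 - 7/125 * m - 49/1000 * m ^ 4) - m * (249/2000 - 7/125 * m - 49/1000 * m ^ 4)\<^sup>2)
      = 3906250000 * (2 - 5 * m) ^ 9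
        + 77343359375 * (5 * m) * (2 - 5 * m) ^ 8
        + 416836875000 * (5 * m) ^ 2 * (2 - 5 * m) ^ 7
        + 1079585062500 * (5 * m) ^ 3 * (2 - 5 * m) ^ 6
        + 1592376625000 * (5 * m) ^ 4 * (2 - 5 * m) ^ 5
        + 1426238196250 * (5 * m) ^ 5 * (2 - 5 * m) ^ 4
        + 786612477000 * (5 * m) ^ 6 * (2 - 5 * m) ^ 3
        + 260983878500 * (5 * m) ^ 7 * (2 - 5 * m) ^ 2
        + 48442861000 * (5 * m) ^ 8 * (2 - 5 * m)
        + 4022132751 * (5 * m) ^ 9"
    by (simp add: algebra_simps add_divide_distrib diff_divide_distrib power_numeral_reduce power2_eq_square)
  also have "0 \<le> \<dots>"
    using assms True by (intro add_nonneg_nonneg mult_nonneg_nonneg zero_le_power) auto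
  finally show ?thesis unfolding zero_le_mult_iff by simp
next
  case False
  have "2000000000000000 * ((1 - m) / 4 - (1 - m) * ((249/2000 - 7/125 * m - 49/1000 * m ^ 4) + m * (- 7/125 - 49/250 * m ^ 3)) - (249/2000 - 7/125 * m - 49/1000 * m ^ 4) - m * (249/2000 - 7/125 * m - 49/1000 * m ^ 4)\<^sup>2)
      = 4022132751 * (4 - 5 * m) ^ 9
        + 23955528518 * (5 * m - 2) * (4 - 5 * m) ^ 8
        + 65085218644 * (5 * m - 2) ^ 2 * (4 - 5 * m) ^ 7
        + 144434598672 * (5 * m - 2) ^ 3 * (4 - 5 * m) ^ 6
        + 315752164266 * (5 * m - 2) ^ 4 * (4 - 5 * m) ^ 5
        + 509977629532 * (5 * m - 2) ^ 5 * (4 - 5 * m) ^ 4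
        + 496454309876 * (5 * m - 2) ^ 6 * (4 - 5 * m) ^ 3
        + 261242876608 * (5 * m - 2) ^ 7 * (4 - 5 * m) ^ 2
        + 60706487679 * (5 * m - 2) ^ 8 * (4 - 5 * m)
        + 2407221262 * (5 * m - 2) ^ 9"
    by (simp add: algebra_simps add_divide_distrib diff_divide_distrib power_numeral_reduce power2_eq_square)
  also have "0 \<le> \<dots>"
    using assms False by (intro add_nonneg_nonneg mult_nonneg_nonneg zero_le_power) auto
  finally show ?thesis unfolding zero_le_mult_iff by simp
qed

lemma gap_barrier_poly:
  fixes m :: real
  assumes "0 \<le> m" "m \<le> 4/5"
  shows "0 \<le> (249/2000 - 7/125 * m - 49/1000 * m ^ 4) * (2 * (1 - (51/1000 * m + 52/1000 * m\<^sup>2)) + 80495/100000 * m) - 19505/100000 - ((1 - m) * (51/1000 + 104/1000 * m) - (51/1000 * m + 52/1000 * m\<^sup>2))"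
proof (cases "m \<le> 2/5")
  case True
  have "4000000000000 * ((249/2000 - 7/125 * m - 49/1000 * m ^ 4) * (2 * (1 - (51/1000 * m + 52/1000 * m\<^sup>2)) + 80495/100000 * m) - 19505/100000 - ((1 - m) * (51/1000 + 104/1000 * m) - (51/1000 * m + 52/1000 * m\<^sup>2)))
      = 184375000 * (2 - 5 * m) ^ 6
        + 444181875 * (5 * m) * (2 - 5 * m) ^ 5
        + 492152375 * (5 * m) ^ 2 * (2 - 5 * m) ^ 4
        + 1237586750 * (5 * m) ^ 3 * (2 - 5 * m) ^ 3
        + 2279239750 * (5 * m) ^ 4 * (2 - 5 * m) ^ 2
        + 1677624863 * (5 * m) ^ 5 * (2 - 5 * m)
        + 404930939 * (5 * m) ^ 6"
    by (simp add: algebra_simps add_divide_distrib diff_divide_distrib power_numeral_reduce power2_eq_square)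
  also have "0 \<le> \<dots>"
    using assms True by (intro add_nonneg_nonneg mult_nonneg_nonneg zero_le_power) auto
  finally show ?thesis unfolding zero_le_mult_iff by simp
next
  case False
  have "4000000000000 * ((249/2000 - 7/125 * m - 49/1000 * m ^ 4) * (2 * (1 - (51/1000 * m + 52/1000 * m\<^sup>2)) + 80495/100000 * m) - 19505/100000 - ((1 - m) * (51/1000 + 104/1000 * m) - (51/1000 * m + 52/1000 * m\<^sup>2)))
      = 404930939 * (4 - 5 * m) ^ 6
        + 3181546405 * (5 * m - 2) * (4 - 5 * m) ^ 5
        + 9798847460 * (5 * m - 2) ^ 2 * (4 - 5 * m) ^ 4
        + 14680286970 * (5 * m - 2) ^ 3 * (4 - 5 * m) ^ 3
        + 10741822195 * (5 * m - 2) ^ 4 * (4 - 5 * m) ^ 2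
        + 3145809873 * (5 * m - 2) ^ 5 * (4 - 5 * m)
        + 63347230 * (5 * m - 2) ^ 6"
    by (simp add: algebra_simps add_divide_distrib diff_divide_distrib power_numeral_reduce power2_eq_square)
  also have "0 \<le> \<dots>"
    using assms False by (intro add_nonneg_nonneg mult_nonneg_nonneg zero_le_power) auto
  finally show ?thesis unfolding zero_le_mult_iff by simp
qed


section \<open>Barriers for the ratio and for the gap\<close>

definition se_y :: "real \<Rightarrow> real" where
  "se_y m = se_M m / se_X m - 1"

definition lam_crit :: real where
  "lam_crit = pi\<^sup>2 / (16 - pi\<^sup>2)"

text \<open>On the curve \<open>A = se_X m\<close>, stationarity of s without noise and with
  coefficient \<open>lam_crit\<close> reads
  \<open>se_gap m = lam_crit * (se_y m)\<^sup>2\<close>.\<close>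

definition se_gap :: "real \<Rightarrow> real" where
  "se_gap m = 1 - m - lam_crit * (1 - (se_M m)\<^sup>2) / (se_X m)\<^sup>2"

lemma pi_sq_bounds: "98696/10000 < pi\<^sup>2" "pi\<^sup>2 < 98697/10000"
proof -
  have "(31415926/10000000)\<^sup>2 < pi\<^sup>2" "pi\<^sup>2 < (31415927/10000000)\<^sup>2"
    using pi_approx by (intro power_strict_mono; simp)+
  then show "98696/10000 < pi\<^sup>2" "pi\<^sup>2 < 98697/10000" by (simp_all add: power2_eq_square)
qed

lemma lam_crit_bounds: "16099/10000 < lam_crit" "lam_crit < 161/100"
  using pi_sq_bounds unfolding lam_crit_def by (simp_all add: field_simps)

lemma se_M_eq: "0 \<le> m \<Longrightarrow> m \<le> 1 \<Longrightarrow> se_M m = (1 + se_y m) * se_X m"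
  using se_X_pos[of m] by (simp add: se_y_def)

lemma se_y_nonneg: "0 \<le> m \<Longrightarrow> m \<le> 1 \<Longrightarrow> 0 \<le> se_y m"
  using se_X_pos[of m] se_X_le_M[of m] by (simp add: se_y_def)

lemma continuous_se_y: "continuous_on {0..1} se_y"
  unfolding se_y_def by (intro continuous_intros continuous_se_X continuous_se_M) (use se_X_pos in force)

lemma continuous_se_gap: "continuous_on {0..1} se_gap"
  unfolding se_gap_def by (intro continuous_intros continuous_se_X continuous_se_M) (use se_X_pos in force)

lemma se_y_0: "se_y 0 = 0" by (simp add: se_y_def se_X_0 se_M_0)

lemma se_gap_0: "se_gap 0 = 0"
proof -
  have "1 - P / (16 - P) * (1 - P / 16) / (P / 16) = 0" if "P \<noteq> 0" "16 - P \<noteq> 0" for P :: real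
  proof -
    have "P / (16 - P) * (1 - P / 16) / (P / 16) = (P / P) * ((16 - P) / (16 - P))" by simp
    then show ?thesis using that by simp
  qed
  from this[of "pi\<^sup>2"] show ?thesis
    using pi_sq_bounds by (simp add: se_gap_def se_X_0 se_M_0 lam_crit_def power_divide)
qed

text \<open>The system for M and X is linear, so their ratio obeys a closed Riccati equation and
  scalar barriers suffice.\<close>

lemma se_y_deriv:
  assumes "0 < m" "m < 1"
  shows "(se_y has_real_derivative (1/4 - (se_y m + (se_y m)\<^sup>2) / (m * (1 - m)))) (at m)"
proof -
  obtain D where D: "(se_X has_real_derivative D) (at m)" "m * (1 - m) * D = se_M m - se_X m"
    using se_X_deriv assms by blast
  have x: "0 < se_X m" using se_X_pos assms by simp
  have Deq: "D = se_y m * se_X m / (m * (1 - m))"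
  proof -
    have "se_y m * se_X m = m * (1 - m) * D" unfolding D(2) using x by (simp add: se_y_def left_diff_distrib)
    then show ?thesis using assms by simp
  qed
  have "((\<lambda>m. se_M m / se_X m - 1) has_real_derivative
      ((se_X m / 4 * se_X m - se_M m * D) / (se_X m * se_X m) - 0)) (at m)"
    using x by (intro DERIV_diff DERIV_divide se_M_deriv D DERIV_const) (use assms in auto)
  moreover have "(se_X m / 4 * se_X m - se_M m * D) / (se_X m * se_X m) - 0
      = 1/4 - (se_y m + (se_y m)\<^sup>2) / (m * (1 - m))"
    unfolding Deq using x assms by (subst se_M_eq) (auto simp: field_simps power2_eq_square)
  ultimately show ?thesis unfolding se_y_def[abs_def] by simp
qed

text \<open>Given y, this is a linear equation for the gap. Its source grows with y, so bounding the
  gap from below requires a lower barrier for y.\<close>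

lemma se_gap_deriv:
  assumes "0 < m" "m < 1"
  shows "(se_gap has_real_derivative
     (- 2 * se_y m * se_gap m / (m * (1 - m)) + 2 * se_y m / m + lam_crit * se_y m / 2 - (1 - lam_crit / 2))) (at m)"
proof -
  obtain D where D: "(se_X has_real_derivative D) (at m)" "m * (1 - m) * D = se_M m - se_X m"
    using se_X_deriv assms by blast
  have x: "0 < se_X m" using se_X_pos assms by simp
  have Deq: "D = se_y m * se_X m / (m * (1 - m))"
  proof -
    have "se_y m * se_X m = m * (1 - m) * D" unfolding D(2) using x by (simp add: se_y_def left_diff_distrib)
    then show ?thesis using assms by simp
  qed
  define g where "g = (1 - (se_M m)\<^sup>2) / (se_X m)\<^sup>2"
  have m1: "((\<lambda>m. (se_M m)\<^sup>2) has_real_derivative 2 * se_M m * (se_X m / 4)) (at m)"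
    by (rule DERIV_cong, rule DERIV_power, rule se_M_deriv) (use assms in auto)
  have x1: "((\<lambda>m. (se_X m)\<^sup>2) has_real_derivative 2 * se_X m * D) (at m)"
    by (rule DERIV_cong, rule DERIV_power, rule D) auto
  have n1: "((\<lambda>m. lam_crit * (1 - (se_M m)\<^sup>2)) has_real_derivative lam_crit * (0 - 2 * se_M m * (se_X m / 4))) (at m)"
    by (intro DERIV_cmult DERIV_diff DERIV_const m1)
  have "(se_gap has_real_derivative (0 - 1 -
      ((lam_crit * (0 - 2 * se_M m * (se_X m / 4))) * (se_X m)\<^sup>2 - lam_crit * (1 - (se_M m)\<^sup>2) * (2 * se_X m * D))
       / ((se_X m)\<^sup>2 * (se_X m)\<^sup>2))) (at m)"
    unfolding se_gap_def[abs_def]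
    by (intro DERIV_diff DERIV_divide n1 x1 DERIV_const DERIV_ident) (use x in auto)
  moreover have "0 - 1 -
      ((lam_crit * (0 - 2 * se_M m * (se_X m / 4))) * (se_X m)\<^sup>2 - lam_crit * (1 - (se_M m)\<^sup>2) * (2 * se_X m * D))
       / ((se_X m)\<^sup>2 * (se_X m)\<^sup>2) = - 1 + lam_crit * (se_M m / se_X m) / 2 + 2 * lam_crit * g * (D / se_X m)"
    unfolding g_def using x by (simp add: field_simps power2_eq_square)
  moreover have "se_M m / se_X m = 1 + se_y m" by (simp add: se_y_def)
  moreover have "lam_crit * g = 1 - m - se_gap m" by (simp add: se_gap_def g_def)
  moreover have "D / se_X m = se_y m / (m * (1 - m))" unfolding Deq using x by simp
  ultimately have d: "(se_gap has_real_derivative (- 1 + lam_crit * (1 + se_y m) / 2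
       + 2 * (1 - m - se_gap m) * (se_y m / (m * (1 - m))))) (at m)"
    by (simp only: mult.assoc)
  have "2 * (1 - m - se_gap m) * (se_y m / (m * (1 - m)))
    = - 2 * se_y m * se_gap m / (m * (1 - m)) + 2 * se_y m / m"
    using assms by (simp add: field_simps)
  with d show ?thesis by (simp add: algebra_simps add_divide_distrib)
qed

lemma barrier_term_le:
  assumes "0 < m" "m < 1" "0 \<le> b" "b \<le> y"
  shows "(b + b\<^sup>2) / (m * (1 - m)) \<le> (y + y\<^sup>2) / (m * (1 - m :: real))"
  using assms by (intro divide_right_mono add_mono power_mono) auto

text \<open>The slope of y at 0 is 1/8, slightly below 14/100. With \<open>r = sqrt (1 - x)\<close>
  the slack of the barrier becomes a cubic polynomial in r divided by r.\<close>

lemma se_y_le_sqrt: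
  assumes "m \<in> {0..1}"
  shows "se_y m \<le> 14/100 * m * sqrt (1 - m)"
proof -
  have "se_y m - 14/100 * m * sqrt (1 - m) \<le> 0"
  proof (rule nonpos_of_deriv_nonpos_above[OF _ _ _ assms])
    show "continuous_on {0..1} (\<lambda>m. se_y m - 14/100 * m * sqrt (1 - m))"
      by (intro continuous_intros continuous_se_y)
    show "se_y 0 - 14 / 100 * 0 * sqrt (1 - 0) \<le> 0" by (simp add: se_y_0)
    fix x :: real assume x: "0 < x" "x < 1" "0 < se_y x - 14 / 100 * x * sqrt (1 - x)"
    define r where "r = sqrt (1 - x)"
    have r: "0 < r" "r \<le> 1" "x = 1 - r\<^sup>2" using x by (auto simp: r_def)
    have s: "((\<lambda>x. sqrt (1 - x)) has_real_derivative inverse (sqrt (1 - x)) / 2 * (0 - 1)) (at x)"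
      by (rule DERIV_chain2[OF DERIV_real_sqrt DERIV_diff[OF DERIV_const DERIV_ident]]) (use x in simp)
    have d: "((\<lambda>m. se_y m - 14/100 * m * sqrt (1 - m)) has_real_derivative
      ((1/4 - (se_y x + (se_y x)\<^sup>2) / (x * (1 - x))) - (14/100 * 1 * sqrt (1 - x) + inverse (sqrt (1 - x)) / 2 * (0 - 1) * (14/100 * x)))) (at x)"
      by (intro DERIV_diff se_y_deriv x DERIV_mult s DERIV_cmult DERIV_ident)
    have "(14/100 * x * r + (14/100 * x * r)\<^sup>2) / (x * (1 - x)) \<le> (se_y x + (se_y x)\<^sup>2) / (x * (1 - x))"
      by (rule barrier_term_le) (use x r(1) in \<open>simp_all add: r_def\<close>)
    moreover have "(14/100 * x * r + (14/100 * x * r)\<^sup>2) / (x * (1 - x)) = 14/100 / r + (14/100)\<^sup>2 * x"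
    proof -
      have "1 - x = r * r" using r(3) by (simp add: power2_eq_square)
      show ?thesis unfolding \<open>1 - x = r * r\<close> using x(1) r(1) by (simp add: field_simps power2_eq_square)
    qed
    moreover have "1/4 - (14/100 / r + (14/100)\<^sup>2 * x) - (14/100 * 1 * r + inverse r / 2 * (0 - 1) * (14/100 * x)) \<le> 0"
    proof -
      have e1: "1/4 - (14/100 / r + (14/100)\<^sup>2 * x) - (14/100 * 1 * r + inverse r / 2 * (0 - 1) * (14/100 * x))
        = (r / 4 - 14/100 - 196/10000 * x * r - 14/100 * r\<^sup>2 + 7/100 * x) / r"
        using r(1) by (simp add: field_simps power2_eq_square)
      \<comment> \<open>The square is centred where the cubic nearly touches zero, close to r =
        0.605; there the constant 14/100 leaves a margin of only a few ten-thousandths from the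
        constant term.\<close>
      have e2: "r / 4 - 14/100 - 196/10000 * x * r - 14/100 * r\<^sup>2 + 7/100 * x
         = - (1904/10000 * (r - 121/200)\<^sup>2 + 196/10000 * r\<^sup>2 * (1 - r) + (30884/100000000 - 16/1000000 * r))"
        unfolding r(3) by (simp add: field_simps power2_eq_square)
      have e3: "0 \<le> 1904/10000 * (r - 121/200)\<^sup>2 + 196/10000 * r\<^sup>2 * (1 - r) + (30884/100000000 - 16/1000000 * r)"
        using r by (intro add_nonneg_nonneg mult_nonneg_nonneg) auto
      show ?thesis unfolding e1 e2 using e3 r(1) by (intro divide_nonpos_pos) linarith+
    qed
    ultimately have "(1/4 - (se_y x + (se_y x)\<^sup>2) / (x * (1 - x))) - (14/100 * 1 * sqrt (1 - x) + inverse (sqrt (1 - x)) / 2 * (0 - 1) * (14/100 * x)) \<le> 0"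
      unfolding r_def[symmetric] by linarith
    with d show "\<exists>D. ((\<lambda>m. se_y m - 14/100 * m * sqrt (1 - m)) has_real_derivative D) (at x) \<and> D \<le> 0" by blast
  qed
  then show ?thesis by simp
qed

text \<open>Crude for small m, but it decays faster at m = 1 than the square-root barrier, which is
  what the analysis near the fixed point needs.\<close>

lemma se_y_le_powr:
  assumes "m \<in> {0..1}"
  shows "se_y m \<le> m * (1 - m) powr (3/4)"
proof -
  have "se_y m - m * (1 - m) powr (3/4) \<le> 0"
  proof (rule nonpos_of_deriv_nonpos_above[OF _ _ _ assms])
    show "continuous_on {0..1} (\<lambda>m. se_y m - m * (1 - m) powr (3/4))"
      by (intro continuous_intros continuous_se_y continuous_on_powr') auto
    show "se_y 0 - 0 * (1 - 0) powr (3/4) \<le> 0" by (simp add: se_y_0)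
    fix x :: real assume x: "0 < x" "x < 1" "0 < se_y x - x * (1 - x) powr (3/4)"
    define q where "q = (1 - x) powr (-1/4)"
    have q1: "1 \<le> q" unfolding q_def using x powr_mono'[of "-1/4" 0 "1 - x"] by simp
    have pq: "(1 - x) powr (3/4) = q * (1 - x)"
      unfolding q_def using x powr_mult_base[of "1 - x" "-1/4"] by (simp add: mult.commute)
    have s: "((\<lambda>x. (1 - x) powr (3/4)) has_real_derivative - 3/4 * q) (at x)"
      unfolding q_def using x by (auto intro!: derivative_eq_intros)
    have d: "((\<lambda>m. se_y m - m * (1 - m) powr (3/4)) has_real_derivative
      ((1/4 - (se_y x + (se_y x)\<^sup>2) / (x * (1 - x))) - (1 * (1 - x) powr (3/4) + (- 3/4 * q) * x))) (at x)"
      by (intro DERIV_diff se_y_deriv x DERIV_mult s DERIV_ident)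
    define b where "b = x * (q * (1 - x))"
    have b: "0 \<le> b" "b \<le> se_y x" using x q1 unfolding b_def pq[symmetric] by auto
    have "q = b / (x * (1 - x))" unfolding b_def using x by simp
    also have "\<dots> \<le> (b + b\<^sup>2) / (x * (1 - x))" using x by (intro divide_right_mono) auto
    also have "\<dots> \<le> (se_y x + (se_y x)\<^sup>2) / (x * (1 - x))"
      by (rule barrier_term_le) (use x b in auto)
    finally have "q \<le> (se_y x + (se_y x)\<^sup>2) / (x * (1 - x))" .
    moreover have "q * x \<le> q" "0 \<le> q * (1 - x)" using q1 x by (simp_all add: mult_left_le)
    \<comment> \<open>Dropping q (1 - x) and using q x \<le> q leaves 1/4 - q + 3/4 q = (1 - q) / 4,
      which is at most 0 because 1 \<le> q.\<close>
    ultimately have "(1/4 - (se_y x + (se_y x)\<^sup>2) / (x * (1 - x))) - (1 * (1 - x) powr (3/4) + (- 3/4 * q) * x) \<le> 0"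
      unfolding pq using q1 by (simp only: algebra_simps)
    with d show "\<exists>D. ((\<lambda>m. se_y m - m * (1 - m) powr (3/4)) has_real_derivative D) (at x) \<and> D \<le> 0" by blast
  qed
  then show ?thesis by simp
qed

text \<open>The leading coefficient 249/2000 lies just below the slope 1/8 of y at 0. The bound
  serves only to feed the source of the gap equation.\<close>

lemma se_y_ge_poly:
  assumes "m \<in> {0..4/5}"
  shows "m * (249/2000 - 7/125 * m - 49/1000 * m ^ 4) \<le> se_y m"
proof -
  define z where "z m = 249/2000 - 7/125 * m - 49/1000 * m ^ 4" for m :: real
  have "m * z m - se_y m \<le> 0"
  proof (rule nonpos_of_deriv_nonpos_above[OF _ _ _ assms])
    show "continuous_on {0..4/5} (\<lambda>m. m * z m - se_y m)"
      unfolding z_def by (intro continuous_intros continuous_on_subset[OF continuous_se_y]) auto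
    show "0 * z 0 - se_y 0 \<le> 0" by (simp add: se_y_0)
    fix x :: real assume x: "0 < x" "x < 4/5" "0 < x * z x - se_y x"
    have zd: "(z has_real_derivative (- 7/125 - 49/250 * x ^ 3)) (at x)"
      unfolding z_def[abs_def] by (auto intro!: derivative_eq_intros simp: power_numeral_reduce)
    have d: "((\<lambda>m. m * z m - se_y m) has_real_derivative
       (1 * z x + (- 7/125 - 49/250 * x ^ 3) * x) - (1/4 - (se_y x + (se_y x)\<^sup>2) / (x * (1 - x)))) (at x)"
      by (intro DERIV_diff se_y_deriv DERIV_mult zd DERIV_ident) (use x in auto)
    have "(se_y x + (se_y x)\<^sup>2) / (x * (1 - x)) \<le> (x * z x + (x * z x)\<^sup>2) / (x * (1 - x))"
      by (rule barrier_term_le) (use x se_y_nonneg in auto)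
    also have "\<dots> = (z x + x * (z x)\<^sup>2) / (1 - x)" using x by (simp add: field_simps power2_eq_square)
    finally have "(1 * z x + (- 7/125 - 49/250 * x ^ 3) * x) - (1/4 - (se_y x + (se_y x)\<^sup>2) / (x * (1 - x)))
      \<le> (1 * z x + (- 7/125 - 49/250 * x ^ 3) * x) - (1/4 - (z x + x * (z x)\<^sup>2) / (1 - x))" by simp
    also have "\<dots> = - ((1 - x) / 4 - (1 - x) * (z x + x * (- 7/125 - 49/250 * x ^ 3)) - z x - x * (z x)\<^sup>2) / (1 - x)"
      using x by (simp add: field_simps)
    also have "\<dots> \<le> 0" using lower_barrier_poly[of x] x unfolding z_def by (intro divide_nonpos_nonneg) auto
    finally show "\<exists>D. ((\<lambda>m. m * z m - se_y m) has_real_derivative D) (at x) \<and> D \<le> 0" using d by blast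
  qed
  then show ?thesis by (simp add: z_def)
qed

text \<open>The factor 1 - m is split off because the gap vanishes at m = 1 as well. The coefficient
  52/1000 just exceeds 2.65 * 0.0196, which is what the square of the bound
  \<open>se_y_le_sqrt\<close> will demand.\<close>

lemma se_gap_ge_poly:
  assumes "m \<in> {0..4/5}"
  shows "(1 - m) * (51/1000 * m + 52/1000 * m\<^sup>2) \<le> se_gap m"
proof -
  define v where "v m = 51/1000 * m + 52/1000 * m\<^sup>2" for m :: real
  have "(1 - m) * v m - se_gap m \<le> 0"
  proof (rule nonpos_of_deriv_nonpos_above[OF _ _ _ assms])
    show "continuous_on {0..4/5} (\<lambda>m. (1 - m) * v m - se_gap m)"
      unfolding v_def by (intro continuous_intros continuous_on_subset[OF continuous_se_gap]) auto
    show "(1 - 0) * v 0 - se_gap 0 \<le> 0" by (simp add: se_gap_0 v_def)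
    fix x :: real assume x: "0 < x" "x < 4/5" "0 < (1 - x) * v x - se_gap x"
    have vd: "(v has_real_derivative (51/1000 + 104/1000 * x)) (at x)"
      unfolding v_def[abs_def] by (auto intro!: derivative_eq_intros)
    have d: "((\<lambda>m. (1 - m) * v m - se_gap m) has_real_derivative
       ((0 - 1) * v x + (51/1000 + 104/1000 * x) * (1 - x)) -
       (- 2 * se_y x * se_gap x / (x * (1 - x)) + 2 * se_y x / x + lam_crit * se_y x / 2 - (1 - lam_crit / 2))) (at x)"
      by (intro DERIV_diff se_gap_deriv DERIV_mult vd DERIV_ident DERIV_const) (use x in auto)
    define z where "z = 249/2000 - 7/125 * x - 49/1000 * x ^ 4"
    have yz: "x * z \<le> se_y x" unfolding z_def using se_y_ge_poly[of x] x by simp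
    have z0: "0 \<le> se_y x" using se_y_nonneg x by simp
    have "x ^ 4 \<le> x" using x power_decreasing[of 1 4 x] by simp
    then have zp: "0 \<le> z" using x unfolding z_def by simp
    have v1: "v x \<le> 1" unfolding v_def using x power_decreasing[of 1 2 x] by simp
    \<comment> \<open>In this form the gap enters only through \<open>se_gap x / (1 - x)\<close>,
      which is at most \<open>v x\<close> at the points where the barrier is violated.\<close>
    have e: "- 2 * se_y x * se_gap x / (x * (1 - x)) + 2 * se_y x / x = se_y x * ((2 / x) * (1 - se_gap x / (1 - x)))"
      using x by (simp add: field_simps)
    have vg: "se_gap x / (1 - x) \<le> v x" using x by (simp add: field_simps)
    have g: "2 / x * (1 - v x) \<le> (2 / x) * (1 - se_gap x / (1 - x))" using x vg by (intro mult_left_mono) auto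
    have "z * (2 * (1 - v x)) = x * z * (2 / x * (1 - v x))" using x by simp
    also have "\<dots> \<le> se_y x * ((2 / x) * (1 - se_gap x / (1 - x)))"
      using yz g z0 v1 x zp vg by (intro mult_mono mult_nonneg_nonneg) auto
    finally have a1: "z * (2 * (1 - v x)) \<le> - 2 * se_y x * se_gap x / (x * (1 - x)) + 2 * se_y x / x" unfolding e .
    have "80495/100000 * (x * z) \<le> (lam_crit / 2) * se_y x"
      using lam_crit_bounds yz x zp by (intro mult_mono) auto
    then have a2: "80495/100000 * (x * z) \<le> lam_crit * se_y x / 2" by simp
    have a3: "1 - lam_crit / 2 \<le> 19505/100000" using lam_crit_bounds by simp
    have "0 \<le> z * (2 * (1 - v x) + 80495/100000 * x) - 19505/100000 - ((1 - x) * (51/1000 + 104/1000 * x) - v x)"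
      using gap_barrier_poly[of x] x unfolding z_def v_def by simp
    then have "((0 - 1) * v x + (51/1000 + 104/1000 * x) * (1 - x)) -
       (- 2 * se_y x * se_gap x / (x * (1 - x)) + 2 * se_y x / x + lam_crit * se_y x / 2 - (1 - lam_crit / 2)) \<le> 0"
      using a1 a2 a3 by (simp add: algebra_simps)
    with d show "\<exists>D. ((\<lambda>m. (1 - m) * v m - se_gap m) has_real_derivative D) (at x) \<and> D \<le> 0" by blast
  qed
  then show ?thesis by (simp add: v_def)
qed

lemma se_y_sq_le:
  assumes "m \<in> {0..1}"
  shows "(se_y m)\<^sup>2 \<le> 196/10000 * m\<^sup>2 * (1 - m)"
proof -
  have "(se_y m)\<^sup>2 \<le> (14/100 * m * sqrt (1 - m))\<^sup>2"
    using assms se_y_nonneg by (intro power_mono se_y_le_sqrt) auto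
  also have "\<dots> = 196/10000 * m\<^sup>2 * (1 - m)" using assms by (simp add: power_mult_distrib power_divide)
  finally show ?thesis .
qed

lemma sq_times_compl_antimono:
  fixes a m :: real
  assumes "2/3 \<le> a" "a \<le> m" "m \<le> 1"
  shows "m\<^sup>2 * (1 - m) \<le> a\<^sup>2 * (1 - a)"
proof -
  have "a\<^sup>2 * (1 - a) - m\<^sup>2 * (1 - m) = (m - a) * (m * (m + a - 1) + a * (a - 1))"
    by (simp add: algebra_simps power2_eq_square)
  moreover have "a * (m + a - 1) \<le> m * (m + a - 1)" using assms by (intro mult_right_mono) auto
  moreover have "0 \<le> a * (m + 2 * a - 2)" using assms by (intro mult_nonneg_nonneg) auto
  then have "0 \<le> a * (m + a - 1) + a * (a - 1)" by (simp add: algebra_simps)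
  ultimately show ?thesis using assms by (smt (verit) mult_nonneg_nonneg)
qed

text \<open>Close to m = 1 the crude bound 1 - M \<le> (1 - m) / 4 suffices:
  \<open>lam_crit * (1 - M\<^sup>2) / X\<^sup>2\<close> is about (1 - m) \<open>lam_crit\<close> /
  2, and \<open>lam_crit\<close> / 2 is well below 1. Here c is a lower bound for M and \<eta> an
  upper bound for y on the interval; 161/400 is the bound 1.61 on \<open>lam_crit\<close> divided by
  4, and 5194/100000 is 2.65 * 0.0196.\<close>

lemma se_gap_near_1:
  assumes m: "a \<le> m" "m \<le> b" "m \<le> 1" "2/3 \<le> a"
    and eta: "196/10000 * (a\<^sup>2 * (1 - a)) \<le> \<eta>\<^sup>2" "0 \<le> \<eta>"
    and c: "c = 1 - (1 - a) / 4"
    and le: "161/400 * ((1 + c) * (1 + \<eta>)\<^sup>2 / c\<^sup>2) + 5194/100000 * b\<^sup>2 \<le> 1"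
  shows "265/100 * (se_y m)\<^sup>2 \<le> se_gap m"
proof -
  have m01: "0 \<le> m" "m \<le> 1" using m by auto
  define y Mm Xm where "y = se_y m" and "Mm = se_M m" and "Xm = se_X m"
  have y0: "0 \<le> y" using se_y_nonneg m01 by (simp add: y_def)
  have "y\<^sup>2 \<le> 196/10000 * (m\<^sup>2 * (1 - m))" using se_y_sq_le[of m] m01 by (simp add: y_def)
  also have "\<dots> \<le> 196/10000 * (a\<^sup>2 * (1 - a))" by (intro mult_left_mono sq_times_compl_antimono) (use m in auto)
  also have "\<dots> \<le> \<eta>\<^sup>2" by (rule eta)
  finally have y1: "y \<le> \<eta>" using eta by (rule_tac power2_le_imp_le) auto
  have c0: "0 < c" using c m by simp
  have "(1 - m) / 4 \<le> (1 - a) / 4" using m by simp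
  moreover have "1 - c = (1 - a) / 4" using c by simp
  ultimately have cM: "c \<le> Mm" using se_M_ge[OF m01] unfolding Mm_def by linarith
  have M1: "Mm \<le> 1" using se_M_le_1[OF m01] unfolding Mm_def .
  have Xp: "0 < Xm" using se_X_pos[OF m01] by (simp add: Xm_def)
  have MX: "Mm = (1 + y) * Xm" using se_M_eq[OF m01] by (simp add: Mm_def y_def Xm_def)
  have "0 \<le> (Mm - c) * ((1 + c) * Mm + c)" using cM c0 by (intro mult_nonneg_nonneg) auto
  then have "(1 + Mm) * c\<^sup>2 \<le> (1 + c) * Mm\<^sup>2" by (simp add: algebra_simps power2_eq_square)
  then have "(1 + Mm) / Mm\<^sup>2 \<le> (1 + c) / c\<^sup>2" using cM c0 by (simp add: field_simps)
  moreover have "(1 + y)\<^sup>2 \<le> (1 + \<eta>)\<^sup>2" using y0 y1 by (intro power_mono) auto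
  ultimately have K: "(1 + Mm) / Mm\<^sup>2 * (1 + y)\<^sup>2 \<le> (1 + c) / c\<^sup>2 * (1 + \<eta>)\<^sup>2"
    using c0 by (intro mult_mono) auto
  have iX: "1 / Xm\<^sup>2 = (1 + y)\<^sup>2 / Mm\<^sup>2" using Xp y0 unfolding MX by (simp add: power_mult_distrib)
  have "lam_crit * (1 - Mm\<^sup>2) / Xm\<^sup>2 = lam_crit * (1 - Mm) * ((1 + Mm) * (1 / Xm\<^sup>2))"
    by (simp add: algebra_simps power2_eq_square)
  also have "\<dots> = lam_crit * (1 - Mm) * ((1 + Mm) / Mm\<^sup>2 * (1 + y)\<^sup>2)" unfolding iX by simp
  also have "\<dots> \<le> (161/100 * ((1 - m) / 4)) * ((1 + c) / c\<^sup>2 * (1 + \<eta>)\<^sup>2)"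
  proof (rule mult_mono[OF mult_mono K])
    show "1 - Mm \<le> (1 - m) / 4" using se_M_ge[OF m01] by (simp add: Mm_def)
  qed (use lam_crit_bounds M1 m01 cM c0 in auto)
  also have "\<dots> = (1 - m) * (161/400 * ((1 + c) * (1 + \<eta>)\<^sup>2 / c\<^sup>2))" by simp
  also have "\<dots> \<le> (1 - m) * (1 - 5194/100000 * b\<^sup>2)" using le m01 by (intro mult_left_mono) auto
  also have "\<dots> \<le> (1 - m) * (1 - 5194/100000 * m\<^sup>2)" using m01 m by (intro mult_left_mono) (auto intro: power_mono)
  finally have "(1 - m) * (5194/100000 * m\<^sup>2) \<le> se_gap m"
    by (simp add: se_gap_def Mm_def Xm_def algebra_simps)
  moreover have "265/100 * (se_y m)\<^sup>2 \<le> 265/100 * (196/10000 * m\<^sup>2 * (1 - m))"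
    by (intro mult_left_mono se_y_sq_le) (use m01 in auto)
  moreover have "265/100 * (196/10000 * m\<^sup>2 * (1 - m)) = (1 - m) * (5194/100000 * m\<^sup>2)" by simp
  ultimately show ?thesis by linarith
qed

lemma se_gap_ge_y_sq:
  assumes "0 \<le> m" "m \<le> 1"
  shows "265/100 * (se_y m)\<^sup>2 \<le> se_gap m"
proof -
  consider "m \<le> 4/5" | "4/5 \<le> m" "m \<le> 17/20" | "17/20 \<le> m" by linarith
  then show ?thesis
  proof cases
    case 1
    have "265/100 * (se_y m)\<^sup>2 \<le> 265/100 * (196/10000 * m\<^sup>2 * (1 - m))"
      by (intro mult_left_mono se_y_sq_le) (use assms in auto)
    also have "\<dots> = (1 - m) * (5194/100000 * m\<^sup>2)" by simp
    also have "\<dots> \<le> (1 - m) * (51/1000 * m + 52/1000 * m\<^sup>2)"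
      using assms by (intro mult_left_mono) (auto intro!: add_increasing mult_right_mono)
    also have "\<dots> \<le> se_gap m" using se_gap_ge_poly[of m] 1 assms by simp
    finally show ?thesis .
  next
    \<comment> \<open>Two intervals are needed: with a = 4/5 and b = 1 the numerical condition of
      \<open>se_gap_near_1\<close> just fails. Each \<eta> rounds up the square root of
      \<open>196/10000 * (a\<^sup>2 * (1 - a))\<close>.\<close>
    case 2
    then show ?thesis
      by (intro se_gap_near_1[where a = "4/5" and b = "17/20" and c = "19/20" and \<eta> = "501/10000"])
        (simp_all add: power2_eq_square)
  next
    case 3
    then show ?thesis using assms
      by (intro se_gap_near_1[where a = "17/20" and b = 1 and c = "77/80" and \<eta> = "461/10000"])
        (simp_all add: power2_eq_square)
  qed
qed

lemma se_y_le: "0 \<le> m \<Longrightarrow> m \<le> 1 \<Longrightarrow> se_y m \<le> 6/100"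
proof -
  assume m: "0 \<le> m" "m \<le> 1"
  have "0 \<le> (m - 2/3)\<^sup>2 * (m + 1/3)" using m by simp
  moreover have "(m - 2/3)\<^sup>2 * (m + 1/3) = 4/27 - m\<^sup>2 * (1 - m)"
    by (simp add: algebra_simps power2_eq_square add_divide_distrib)
  ultimately have "m\<^sup>2 * (1 - m) \<le> 4/27" by linarith
  then have "(se_y m)\<^sup>2 \<le> 196/10000 * (4/27)" using se_y_sq_le[of m] m by simp
  also have "\<dots> \<le> (6/100)\<^sup>2" by (simp add: power2_eq_square)
  finally show ?thesis by (rule power2_le_imp_le) simp
qed

section \<open>The variance update and its one-step bound\<close>

definition se_N :: "real \<Rightarrow> real \<Rightarrow> real" where
  "se_N A m = A\<^sup>2 + 1 - 2 * A * se_M m"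

text \<open>Hence the update is minimal at A = M, with minimum \<open>1 - M\<^sup>2\<close>, and
  decreases in A up to that point.\<close>

lemma se_N_alt: "se_N A m = (A - se_M m)\<^sup>2 + (1 - (se_M m)\<^sup>2)"
  by (simp add: se_N_def power2_eq_square algebra_simps)

text \<open>Here \<open>j\<close> and \<open>m\<close> stand for two consecutive values of \<open>a\<^sup>2 / (a\<^sup>2 + s)\<close>, so that the radius \<open>A\<close> at \<open>m\<close> is
  \<open>se_F j / sqrt m = t * se_X j\<close>.\<close>

lemma se_N_le_of_step:
  assumes "0 < j" "j \<le> m" "m \<le> 1"
    and t: "t = sqrt (j / m)" "se_gap j \<le> 1 - t\<^sup>2"
  shows "se_N (t * se_X j) m \<le> (1 - (se_M j)\<^sup>2) / t\<^sup>2"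
proof -
  have j01: "0 \<le> j" "j \<le> 1" using assms by auto
  define y x Mj where "y = se_y j" and "x = se_X j" and "Mj = se_M j"
  have x: "0 < x" using se_X_pos j01 by (simp add: x_def)
  have y: "0 \<le> y" "y \<le> 6/100" using se_y_nonneg se_y_le j01 by (auto simp: y_def)
  have MX: "Mj = (1 + y) * x" using se_M_eq[OF j01] by (simp add: Mj_def y_def x_def)
  have t01: "0 < t" "t \<le> 1" using assms by auto
  have tm: "j = t\<^sup>2 * m" using assms by simp
  define d where "d = 1 - t"
  have d: "0 \<le> d" "d < 1" "t = 1 - d" using t01 by (auto simp: d_def)
  have td: "1 - t\<^sup>2 = d * (2 - d)" by (simp add: d_def power2_eq_square algebra_simps)
  have "265/100 * y\<^sup>2 \<le> d * (2 - d)" using t(2) se_gap_ge_y_sq[OF j01] td by (simp add: y_def)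
  moreover have "d * (2 - d) \<le> d * 2" using d by (intro mult_left_mono) auto
  ultimately have y2: "y\<^sup>2 \<le> 76/100 * d" using d by simp
  have "y * d \<le> 6/100 * d" using y d by (intro mult_right_mono) auto
  then have "(y + d)\<^sup>2 \<le> 88/100 * d + d\<^sup>2" using y2 by (simp add: power2_sum)
  then have "2 * t * (y + d)\<^sup>2 \<le> 2 * t * (88/100 * d + d\<^sup>2)" using t01 by (intro mult_left_mono) auto
  \<comment> \<open>Completing the square shows that 2.65 leaves a positive remainder. The
    coefficient 88/100 is 76/100 from \<open>y\<^sup>2\<close> plus twice the bound 6/100 on
    y.\<close>
  also have "\<dots> = d * (2 - d) - d * (2 * (d - 31/100)\<^sup>2 + (478/10000))"
    unfolding d(3) by (simp add: power2_eq_square algebra_simps add_divide_distrib diff_divide_distrib)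
  also have "\<dots> \<le> d * (2 - d)" using d by simp
  finally have key: "2 * t * (y + d)\<^sup>2 \<le> 1 - t\<^sup>2" unfolding td .
  \<comment> \<open>Since \<open>Mj - t * x = (y + d) * x\<close>, \<open>key\<close> bounds the
    deviation from the minimum by a multiple of \<open>t * x\<^sup>2\<close>. This is split along j:
    the part with 1 - j will be paid by \<open>1 - Mj\<^sup>2\<close> (fact B), the part with t j by
    the growth of M from j to m (fact C).\<close>
  have "2 * (1 - t\<^sup>2) * (t * x\<^sup>2 - (1 - j) * x\<^sup>2 - t * j * x\<^sup>2) \<le> 0"
  proof -
    have "2 * (1 - t\<^sup>2) * (t * x\<^sup>2 - (1 - j) * x\<^sup>2 - t * j * x\<^sup>2)
      = - (2 * (1 - t\<^sup>2) * ((1 - j) * (1 - t) * x\<^sup>2))" by (simp add: algebra_simps)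
    moreover have "0 \<le> 2 * (1 - t\<^sup>2) * ((1 - j) * (1 - t) * x\<^sup>2)"
      using j01 t01 by (intro mult_nonneg_nonneg) (auto simp: abs_square_le_1)
    ultimately show ?thesis by linarith
  qed
  then have w: "(1 - t\<^sup>2) * (t * x\<^sup>2) \<le> (1 - t\<^sup>2) * ((1 - j) * x\<^sup>2 + t * j * x\<^sup>2)" by (simp add: algebra_simps)
  have "2 * t\<^sup>2 * (Mj - t * x)\<^sup>2 = (2 * t * (y + d)\<^sup>2) * (t * x\<^sup>2)"
    unfolding MX d_def by (simp add: power2_eq_square algebra_simps)
  also have "\<dots> \<le> (1 - t\<^sup>2) * (t * x\<^sup>2)" using key t01 by (intro mult_right_mono) auto
  also note w
  finally have A: "2 * t\<^sup>2 * (Mj - t * x)\<^sup>2 \<le> (1 - t\<^sup>2) * ((1 - j) * x\<^sup>2 + t * j * x\<^sup>2)" .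
  have "(1 - j) / 2 * x\<^sup>2 \<le> 1 - Mj\<^sup>2" using one_minus_M_sq_ge[OF j01] by (simp add: x_def Mj_def)
  then have B: "(1 - t\<^sup>2) * ((1 - j) / 2 * x\<^sup>2) \<le> (1 - t\<^sup>2) * (1 - Mj\<^sup>2)"
    using t01 by (intro mult_left_mono) (auto simp: abs_square_le_1)
  have "Mj + x * (m - j) / 4 \<le> se_M m" using se_M_increment(1)[of j m] assms by (simp add: x_def Mj_def)
  then have "2 * t ^ 3 * x * (Mj + x * (m - j) / 4) \<le> 2 * t ^ 3 * x * se_M m"
    using t01 x by (intro mult_left_mono) auto
  moreover have "2 * t ^ 3 * x * (x * (m - j) / 4) = (1 - t\<^sup>2) * (t * j * x\<^sup>2) / 2"
    unfolding tm by (simp add: power2_eq_square power3_eq_cube algebra_simps diff_divide_distrib)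
  ultimately have C: "2 * t ^ 3 * x * Mj + (1 - t\<^sup>2) * (t * j * x\<^sup>2) / 2 \<le> 2 * t ^ 3 * x * se_M m"
    by (simp add: distrib_left)
  have "t\<^sup>2 * se_N (t * x) m = t\<^sup>2 * (t\<^sup>2 * x\<^sup>2 + 1) - 2 * t ^ 3 * x * se_M m"
    by (simp add: se_N_def power2_eq_square power3_eq_cube algebra_simps)
  also have "\<dots> \<le> t\<^sup>2 * (t\<^sup>2 * x\<^sup>2 + 1) - 2 * t ^ 3 * x * Mj - (1 - t\<^sup>2) * (t * j * x\<^sup>2) / 2" using C by simp
  also have "\<dots> = t\<^sup>2 * (Mj - t * x)\<^sup>2 - (1 - t\<^sup>2) * (t * j * x\<^sup>2) / 2 + t\<^sup>2 * (1 - Mj\<^sup>2)"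
    by (simp add: power2_eq_square power3_eq_cube algebra_simps)
  also have "\<dots> \<le> (1 - t\<^sup>2) * ((1 - j) / 2 * x\<^sup>2) + t\<^sup>2 * (1 - Mj\<^sup>2)"
    using A by (simp add: distrib_left)
  also have "\<dots> \<le> 1 - Mj\<^sup>2" using B by (simp add: algebra_simps)
  finally show ?thesis using t01 by (simp add: x_def Mj_def field_simps)
qed

section \<open>Convergence of the noiseless recursion\<close>

definition se_F :: "real \<Rightarrow> real" where
  "se_F m = sqrt m * se_X m"

lemma se_F_sq: "0 \<le> m \<Longrightarrow> (se_F m)\<^sup>2 = m * (se_X m)\<^sup>2"
  by (simp add: se_F_def power_mult_distrib)

lemma se_F_strict_mono:
  assumes "0 \<le> m" "m < m'" "m' \<le> 1"
  shows "se_F m < se_F m'"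
  unfolding se_F_def using assms se_X_mono[of m m'] se_X_pos[of m]
  by (intro mult_less_le_imp_less) auto

lemma se_F_pos: "0 < m \<Longrightarrow> m \<le> 1 \<Longrightarrow> 0 < se_F m"
  using se_F_strict_mono[of 0 m] by (simp add: se_F_def)

lemma se_F_1: "se_F 1 = 1"
  by (simp add: se_F_def se_X_1)

lemma se_F_le_1: "0 \<le> m \<Longrightarrow> m \<le> 1 \<Longrightarrow> se_F m \<le> 1"
  using se_F_strict_mono[of m 1] by (cases "m = 1") (auto simp: se_F_1)

lemma continuous_se_F: "continuous_on {0..1} se_F"
  unfolding se_F_def by (intro continuous_intros continuous_se_X)

lemma se_N_ge: "1 - (se_M m)\<^sup>2 \<le> se_N A m"
  by (simp add: se_N_alt)

lemma one_minus_M_sq_nonneg: "0 \<le> m \<Longrightarrow> m \<le> 1 \<Longrightarrow> 0 \<le> 1 - (se_M m)\<^sup>2"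
proof -
  assume m: "0 \<le> m" "m \<le> 1"
  have "0 < se_M m" using se_M_ge_pi[OF m] pi_gt_zero by linarith
  then show ?thesis using se_M_le_1[OF m] by (simp add: abs_square_le_1)
qed

lemma one_minus_M_sq_pos:
  assumes "0 \<le> m" "m < 1" shows "0 < 1 - (se_M m)\<^sup>2"
proof -
  have "0 < (1 - m) / 2 * (se_X m)\<^sup>2" using assms se_X_pos[of m] by simp
  then show ?thesis using one_minus_M_sq_ge[of m] assms by linarith
qed

lemma se_N_nonneg: "0 \<le> m \<Longrightarrow> m \<le> 1 \<Longrightarrow> 0 \<le> se_N A m"
  using one_minus_M_sq_nonneg[of m] se_N_ge[of m A] by linarith

text \<open>On the curve A = X m the modulus a is stationary. The inequality says that s does not
  grow there without noise when lam \<le> \<open>lam_crit\<close>; its strict form excludes limit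
  points with m < 1.\<close>

lemma se_N_at_X_le:
  assumes "0 \<le> m" "m \<le> 1"
  shows "lam_crit * se_N (se_X m) m \<le> (1 - m) * (se_X m)\<^sup>2"
proof -
  define g where "g = (1 - (se_M m)\<^sup>2) / (se_X m)\<^sup>2"
  have X: "0 < (se_X m)\<^sup>2" using se_X_pos[OF assms] by simp
  have "se_N (se_X m) m = ((se_y m)\<^sup>2 + g) * (se_X m)\<^sup>2"
  proof -
    have "(se_X m - se_M m)\<^sup>2 = (se_y m)\<^sup>2 * (se_X m)\<^sup>2"
      unfolding se_M_eq[OF assms] by (simp add: power2_eq_square algebra_simps)
    moreover have "1 - (se_M m)\<^sup>2 = g * (se_X m)\<^sup>2" using X by (simp add: g_def)
    ultimately show ?thesis by (simp add: se_N_alt distrib_right)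
  qed
  moreover have "lam_crit * ((se_y m)\<^sup>2 + g) \<le> 1 - m"
  proof -
    have "lam_crit * (se_y m)\<^sup>2 \<le> 265/100 * (se_y m)\<^sup>2" using lam_crit_bounds by (intro mult_right_mono) auto
    then show ?thesis using se_gap_ge_y_sq[OF assms] by (simp add: se_gap_def g_def distrib_left)
  qed
  then have "lam_crit * ((se_y m)\<^sup>2 + g) * (se_X m)\<^sup>2 \<le> (1 - m) * (se_X m)\<^sup>2"
    using X by (intro mult_right_mono) auto
  ultimately show ?thesis by simp
qed

lemma se_N_at_X_less:
  assumes "0 \<le> m" "m < 1" "lam < lam_crit"
  shows "lam * se_N (se_X m) m < (1 - m) * (se_X m)\<^sup>2"
proof -
  have "0 < se_N (se_X m) m" using one_minus_M_sq_pos[of m] se_N_ge[of m "se_X m"] assms by linarith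
  then have "lam * se_N (se_X m) m < lam_crit * se_N (se_X m) m" using assms by simp
  then show ?thesis using se_N_at_X_le[of m] assms by linarith
qed

lemma se_N_antimono: "0 \<le> A \<Longrightarrow> A \<le> B \<Longrightarrow> B \<le> se_M m \<Longrightarrow> se_N B m \<le> se_N A m"
  unfolding se_N_alt by (simp add: abs_le_square_iff[symmetric])

text \<open>The lower bound \<open>lam * (1 - M(j)\<^sup>2)\<close> is what any step from a state with ratio \<open>j\<close> leaves in \<open>s\<close>; for fixed
  \<open>m\<close> the worst case is equality, which the intermediate value theorem attains at some \<open>i \<le> j\<close>.\<close>

lemma good_region_step:
  assumes lam: "0 < lam" "lam \<le> lam_crit"
    and j: "0 < j" "j \<le> 1" and m: "0 < m" "m \<le> 1" and A: "0 \<le> A" "A \<le> se_X m"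
    and a: "A * sqrt m = se_F j" and s: "lam * (1 - (se_M j)\<^sup>2) \<le> A\<^sup>2 * (1 - m)"
  shows "lam * se_N A m \<le> (1 - m) * (se_X m)\<^sup>2"
proof (cases "m = 1")
  case True
  then have "lam * (1 - (se_M j)\<^sup>2) \<le> 0" using s by simp
  then have "1 - (se_M j)\<^sup>2 \<le> 0" using lam by (simp add: mult_le_0_iff)
  then have "j = 1" using one_minus_M_sq_pos[of j] j by force
  then show ?thesis using a True by (simp add: se_F_1 se_N_def se_M_1)
next
  case False
  have "A * sqrt m \<le> se_X m * sqrt m" using A m by (intro mult_right_mono) auto
  then have "se_F j \<le> se_F m" unfolding a by (simp add: se_F_def mult.commute)
  then have jm: "j \<le> m" using se_F_strict_mono[of m j] m j by (meson less_eq_real_def not_less)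
  have a2: "A\<^sup>2 * m = (se_F j)\<^sup>2" using m by (simp add: a[symmetric] power_mult_distrib)
  \<comment> \<open>A modulus \<open>se_F i\<close> at ratio m comes with the variance given by the
    first term. A zero of phi is thus a predecessor ratio that leaves exactly the minimal
    variance.\<close>
  define phi where "phi i = i * (se_X i)\<^sup>2 * (1 - m) / m - lam * (1 - (se_M i)\<^sup>2)" for i
  have "\<exists>i. 0 \<le> i \<and> i \<le> j \<and> phi i = 0"
  proof (rule IVT')
    show "phi 0 \<le> 0" unfolding phi_def using lam one_minus_M_sq_pos[of 0] by simp
    have "j * (se_X j)\<^sup>2 = A\<^sup>2 * m" using a2 se_F_sq[of j] j by simp
    then have "j * (se_X j)\<^sup>2 * (1 - m) / m = A\<^sup>2 * (1 - m)" using m by simp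
    then show "0 \<le> phi j" using s by (simp add: phi_def)
    show "continuous_on {0..j} phi" unfolding phi_def
      by (intro continuous_intros continuous_on_subset[OF continuous_se_X] continuous_on_subset[OF continuous_se_M])
        (use j m in auto)
  qed (use j in auto)
  then obtain i where i: "0 \<le> i" "i \<le> j" "phi i = 0" by blast
  have eq: "i * (se_X i)\<^sup>2 * (1 - m) / m = lam * (1 - (se_M i)\<^sup>2)" using i(3) by (simp add: phi_def)
  have i0: "0 < i" using i eq lam one_minus_M_sq_pos[of 0] by (cases "i = 0") auto
  \<comment> \<open>The radius of the state with modulus \<open>se_F i\<close> and ratio m is
    \<open>t * se_X i\<close>.\<close>
  define t where "t = sqrt (i / m)"
  have t: "0 < t" "t\<^sup>2 = i / m" using i0 m by (auto simp: t_def)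
  have Xi: "0 < se_X i" using se_X_pos[of i] i j by simp
  have eqt: "t\<^sup>2 * (se_X i)\<^sup>2 * (1 - m) = lam * (1 - (se_M i)\<^sup>2)" using eq t(2) by simp
  have "lam * (1 - (se_M i)\<^sup>2) / (se_X i)\<^sup>2 = t\<^sup>2 * (1 - m)" unfolding eqt[symmetric] using Xi by simp
  also have "\<dots> = t\<^sup>2 - i" using t(2) m by (simp add: field_simps)
  finally have "t\<^sup>2 - i = lam * (1 - (se_M i)\<^sup>2) / (se_X i)\<^sup>2" by simp
  also have "\<dots> \<le> lam_crit * (1 - (se_M i)\<^sup>2) / (se_X i)\<^sup>2"
    using lam one_minus_M_sq_nonneg[of i] i j by (intro divide_right_mono mult_right_mono) auto
  finally have gap: "se_gap i \<le> 1 - t\<^sup>2" by (simp add: se_gap_def)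
  have N: "se_N (t * se_X i) m \<le> (1 - (se_M i)\<^sup>2) / t\<^sup>2"
    by (rule se_N_le_of_step) (use i0 i jm m t_def gap in auto)
  have "se_F i \<le> se_F j" using se_F_strict_mono[of i j] i j by (cases "i = j") auto
  then have "t * se_X i * sqrt m \<le> A * sqrt m"
    unfolding a using m by (simp add: t_def se_F_def real_sqrt_divide)
  then have "t * se_X i \<le> A" using m by simp
  \<comment> \<open>\<open>se_N\<close> decreases in A up to M, and A \<le> X \<le> M, so the
    smaller radius is the worse one.\<close>
  then have "se_N A m \<le> se_N (t * se_X i) m"
    using A se_X_le_M[of m] m t Xi by (intro se_N_antimono) auto
  then have "lam * se_N A m \<le> lam * ((1 - (se_M i)\<^sup>2) / t\<^sup>2)"
    using order_trans[OF _ N] lam by (intro mult_left_mono) auto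
  also have "\<dots> = (1 - m) * (se_X i)\<^sup>2" using eqt t(1) by (simp add: field_simps)
  also have "\<dots> \<le> (1 - m) * (se_X m)\<^sup>2"
    using se_X_mono[of i m] i jm m Xi by (intro mult_left_mono power_mono) auto
  finally show ?thesis .
qed

text \<open>Without noise the right-hand side is the drop of \<open>A\<^sup>2\<close> in one step.
  At \<open>lam_crit\<close> this drop is a quadratic in A with leading coefficient 1 -
  \<open>lam_crit\<close> < 0, hence concave, and it is nonnegative at A = X and at A = 2. The
  excess \<open>lam_crit - lam\<close> acts on an update of at least
  \<open>1 - M\<^sup>2\<close>.\<close>

lemma outer_region_step:
  assumes m: "0 \<le> m" "m \<le> 1" and A: "se_X m \<le> A" "A \<le> 2" and lam: "lam \<le> lam_crit"
  shows "(lam_crit - lam) * (1 - (se_M m)\<^sup>2) \<le> A\<^sup>2 - ((se_F m)\<^sup>2 + lam * se_N A m)"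
proof -
  define L x where "L = lam_crit" and "x = se_X m"
  define h where "h A = A\<^sup>2 - m * x\<^sup>2 - L * se_N A m" for A
  have x: "0 < x" "x \<le> 1" using se_X_pos se_X_le_1 m by (auto simp: x_def)
  have "h x = (1 - m) * x\<^sup>2 - L * se_N x m" by (simp add: h_def algebra_simps)
  then have hx: "0 \<le> h x" using se_N_at_X_le[OF m] by (simp add: L_def x_def)
  have "3.14 \<le> 4 * se_M m" using se_M_ge_pi[OF m] pi_approx by simp
  then have "se_N 2 m \<le> 186/100" by (simp add: se_N_def)
  then have "L * se_N 2 m \<le> 161/100 * (186/100)"
    using lam_crit_bounds se_N_nonneg[OF m] unfolding L_def by (intro mult_mono) auto
  moreover have "m * x\<^sup>2 \<le> 1 * 1" using m x by (intro mult_mono) (auto simp: abs_square_le_1)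
  ultimately have h2: "0 \<le> h 2" by (simp add: h_def)
  \<comment> \<open>The chord inequality of the concave quadratic h on [x, 2], with its exact
    remainder.\<close>
  have "h A * (2 - x) - (2 - A) * h x - (A - x) * h 2 = (L - 1) * ((A - x) * (2 - A) * (2 - x))"
    by (simp add: h_def se_N_def power2_eq_square algebra_simps)
  moreover have "0 \<le> (L - 1) * ((A - x) * (2 - A) * (2 - x))"
    using lam_crit_bounds A x by (intro mult_nonneg_nonneg) (auto simp: L_def x_def)
  moreover have "0 \<le> (2 - A) * h x" "0 \<le> (A - x) * h 2" using hx h2 A by (auto simp: x_def)
  ultimately have "0 \<le> h A * (2 - x)" by linarith
  then have hA: "0 \<le> h A" using x by (simp add: zero_le_mult_iff)
  have "(lam_crit - lam) * (1 - (se_M m)\<^sup>2) \<le> (lam_crit - lam) * se_N A m"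
    using lam by (intro mult_left_mono se_N_ge) auto
  then show ?thesis using hA m by (simp add: h_def L_def x_def se_F_sq algebra_simps)
qed

text \<open>A bound \<alpha> < 1 on the next modulus keeps m away from 1 quantitatively, because 1 -
  \<open>se_F m\<close> is at most 3 times the square root of 1 - m.\<close>

lemma one_minus_m_ge_of_F_le:
  assumes m: "0 \<le> m" "m \<le> 1" and F: "se_F m \<le> \<alpha>" and "\<alpha> \<le> 1"
  shows "((1 - \<alpha>) / 3)\<^sup>2 \<le> 1 - m"
proof -
  define r where "r = sqrt (1 - m)"
  have r: "0 \<le> r" "r \<le> 1" "1 - m = r * r" using m by (auto simp: r_def)
  have "1 - se_X m \<le> pi/2 * r"
  proof (cases "m = 1")
    case False
    then have "\<bar>se_X m - 1\<bar> \<le> pi/2 * r" using se_X_M_near_1(1)[of m] m by (simp add: r_def)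
    then show ?thesis by linarith
  qed (simp add: r_def se_X_1)
  moreover have "pi/2 * r \<le> 2 * r" using pi_less_4 r by (intro mult_right_mono) auto
  ultimately have x: "1 - se_X m \<le> 2 * r" by linarith
  have "m \<le> sqrt m" using m by (simp add: real_le_rsqrt power2_eq_square mult_left_le)
  then have "m * se_X m \<le> se_F m" unfolding se_F_def using m se_X_pos[of m] by (intro mult_right_mono) auto
  moreover have "(1 - m) * se_X m \<le> 1 - m" using m se_X_le_1[of m] by (intro mult_left_le) auto
  moreover have "r * r \<le> r" using r by (intro mult_left_le) auto
  moreover have "(1 - m) * se_X m = se_X m - m * se_X m" by (simp add: algebra_simps)
  ultimately have "1 - \<alpha> \<le> 3 * r" using x F r(3) by linarith
  then have "((1 - \<alpha>) / 3)\<^sup>2 \<le> r\<^sup>2" using assms by (intro power_mono) auto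
  then show ?thesis using r(3) by (simp add: power2_eq_square)
qed

text \<open>The modulus of \<open>\<alpha>\<close> and the variance \<open>\<sigma>\<^sup>2\<close> evolve autonomously; \<open>m\<close> and \<open>A\<close> are (squared cosine and radius)
  polar coordinates of the point \<open>(a, sqrt s)\<close>.\<close>

locale real_se =
  fixes lam w :: real and a s m A :: "nat \<Rightarrow> real"
  assumes lam: "0 < lam" and w: "0 \<le> w"
    and a0: "0 < a 0" and s0: "0 \<le> s 0"
    and m_def: "\<And>n. m n = (a n)\<^sup>2 / ((a n)\<^sup>2 + s n)"
    and A_def: "\<And>n. A n = sqrt ((a n)\<^sup>2 + s n)"
    and a_Suc: "\<And>n. a (Suc n) = se_F (m n)"
    and s_Suc: "\<And>n. s (Suc n) = lam * se_N (A n) (m n) + 4 * w"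
begin

lemma pos: "0 < a n \<and> 0 \<le> s n"
proof (induction n)
  case (Suc n)
  then have m: "0 < m n" "m n \<le> 1" unfolding m_def by (auto simp: add_pos_nonneg)
  show ?case unfolding a_Suc s_Suc using m lam w se_N_nonneg[of "m n" "A n"] by (auto intro: se_F_pos)
qed (use a0 s0 in auto)

lemma a_pos: "0 < a n" and s_nonneg: "0 \<le> s n" using pos by auto

lemma A_sq: "(A n)\<^sup>2 = (a n)\<^sup>2 + s n" and A_pos: "0 < A n"
  using a_pos[of n] s_nonneg[of n] by (auto simp: A_def add_pos_nonneg)

lemma m_pos: "0 < m n" and m_le_1: "m n \<le> 1"
  using a_pos[of n] s_nonneg[of n] by (auto simp: m_def add_pos_nonneg)

lemma a_sq: "(a n)\<^sup>2 = m n * (A n)\<^sup>2"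
  using A_pos[of n] by (simp add: m_def A_sq[symmetric])

lemma a_eq: "a n = A n * sqrt (m n)"
  using a_sq[of n] a_pos[of n] A_pos[of n] m_pos[of n]
  by (metis abs_of_pos mult.commute real_sqrt_abs real_sqrt_mult)

lemma s_eq: "s n = (A n)\<^sup>2 * (1 - m n)"
  using a_sq[of n] A_sq[of n] by (simp add: algebra_simps)

lemma a_Suc_le_1: "a (Suc n) \<le> 1"
  unfolding a_Suc using m_pos m_le_1 less_imp_le by (intro se_F_le_1) auto

end

section \<open>The orbit without noise\<close>

locale noiseless_se = real_se lam 0 a s m A for lam a s m A +
  assumes lam_less: "lam < lam_crit" and a0_le: "a 0 \<le> 1" and s0_less: "s 0 < 1"
begin

text \<open>The radius 2 barely reproduces itself: \<open>se_N\<close> is at most 1.86 for A \<le>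
  2, and 1.61 * 1.86 is just below 3, so the next \<open>A\<^sup>2\<close> stays below 1 +
  3.\<close>

lemma A_le_2: "A n \<le> 2"
proof (induction n)
  case 0
  have "(a 0)\<^sup>2 \<le> 1" using a0 a0_le by (simp add: abs_square_le_1)
  then have "(A 0)\<^sup>2 \<le> 2\<^sup>2" using s0_less by (simp add: A_sq)
  then show ?case by (rule power2_le_imp_le) simp
next
  case (Suc n)
  have m: "0 \<le> m n" "m n \<le> 1" using m_pos m_le_1 less_imp_le by auto
  have "314/100 \<le> pi" using pi_approx by simp
  then have "157/100 \<le> 2 * se_M (m n)" using se_M_ge_pi[OF m] by simp
  then have "A n * (157/100) \<le> A n * (2 * se_M (m n))" using A_pos[of n] by (intro mult_left_mono) auto
  moreover have "(A n)\<^sup>2 - A n * (157/100) \<le> 86/100"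
  proof -
    have "0 \<le> (2 - A n) * (A n + 43/100)" using Suc A_pos[of n] by (intro mult_nonneg_nonneg) auto
    moreover have "(2 - A n) * (A n + 43/100) = 86/100 - ((A n)\<^sup>2 - A n * (157/100))"
      by (simp add: algebra_simps power2_eq_square diff_divide_distrib)
    ultimately show ?thesis by linarith
  qed
  ultimately have "se_N (A n) (m n) \<le> 186/100" by (simp add: se_N_def algebra_simps)
  then have "lam * se_N (A n) (m n) \<le> 161/100 * (186/100)"
    using lam lam_less lam_crit_bounds se_N_nonneg[OF m] by (intro mult_mono) auto
  moreover have "(a (Suc n))\<^sup>2 \<le> 1" using a_Suc_le_1[of n] a_pos[of "Suc n"] by (simp add: abs_square_le_1)
  ultimately have "(A (Suc n))\<^sup>2 \<le> 2\<^sup>2" unfolding A_sq[of "Suc n"] s_Suc by simp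
  then show ?case by (rule power2_le_imp_le) simp
qed

text \<open>Outside the region A \<le> X the modulus decreases, so it stays below some \<alpha> < 1,
  m stays away from 1, and \<open>A\<^sup>2\<close> drops by a fixed c > 0 in every step, which is
  impossible forever. The index is at least 1 because invariance of the region needs a predecessor
  state.\<close>

lemma enters_good_region: "\<exists>n\<ge>1. A n \<le> se_X (m n)"
proof (rule ccontr)
  assume "\<not> ?thesis"
  then have out: "se_X (m n) < A n" if "1 \<le> n" for n using that by force
  have dec: "a (Suc n) < a n" if "1 \<le> n" for n
    unfolding a_Suc a_eq[of n] se_F_def using out[OF that] m_pos[of n] by (simp add: mult.commute)
  \<comment> \<open>\<open>a 1\<close> might equal 1; the next value is strictly smaller.\<close>
  define \<alpha> where "\<alpha> = a 2"
  have "\<alpha> < a 1" using dec[of 1] by (simp add: \<alpha>_def numeral_2_eq_2)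
  then have \<alpha>: "\<alpha> < 1" using a_Suc_le_1[of 0] by simp
  have le: "a (n + 2) \<le> \<alpha>" for n
  proof (induction n)
    case (Suc n)
    then show ?case using dec[of "n + 2"] by simp
  qed (simp add: \<alpha>_def numeral_2_eq_2)
  define c where "c = (lam_crit - lam) * (((1 - \<alpha>) / 3)\<^sup>2 / 2 * (pi/4)\<^sup>2)"
  have c: "0 < c" using \<alpha> lam_less by (simp add: c_def)
  have "(A (n + 2))\<^sup>2 \<le> (A 2)\<^sup>2 - real n * c" for n
  proof (induction n)
    case (Suc n)
    define k where "k = n + 2"
    have m: "0 \<le> m k" "m k \<le> 1" using m_pos m_le_1 less_imp_le by auto
    have "se_F (m k) \<le> \<alpha>" using le[of "Suc n"] a_Suc[of k] by (simp add: k_def)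
    then have "((1 - \<alpha>) / 3)\<^sup>2 \<le> 1 - m k" using one_minus_m_ge_of_F_le[OF m] \<alpha> by simp
    moreover have "(pi/4)\<^sup>2 \<le> (se_X (m k))\<^sup>2" using se_X_ge[OF m] by (intro power_mono) auto
    ultimately have "((1 - \<alpha>) / 3)\<^sup>2 / 2 * (pi/4)\<^sup>2 \<le> (1 - m k) / 2 * (se_X (m k))\<^sup>2"
      using m by (intro mult_mono) auto
    also have "\<dots> \<le> 1 - (se_M (m k))\<^sup>2" by (rule one_minus_M_sq_ge[OF m])
    finally have "c \<le> (lam_crit - lam) * (1 - (se_M (m k))\<^sup>2)"
      unfolding c_def using lam_less by (intro mult_left_mono) auto
    also have "\<dots> \<le> (A k)\<^sup>2 - (A (Suc k))\<^sup>2"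
      using outer_region_step[OF m _ A_le_2[of k], of lam] out[of k] lam_less
      unfolding A_sq[of "Suc k"] a_Suc s_Suc by (simp add: k_def)
    finally show ?case using Suc by (simp add: k_def algebra_simps)
  qed (simp add: numeral_2_eq_2)
  moreover obtain n where "(A 2)\<^sup>2 < real n * c" using reals_Archimedean3[OF c] by blast
  moreover have "0 \<le> (A (n + 2))\<^sup>2" by simp
  ultimately show False by (metis diff_less_eq add_0 leD order_trans)
qed

lemma good_region_invariant:
  assumes "A (Suc n) \<le> se_X (m (Suc n))"
  shows "A (Suc (Suc n)) \<le> se_X (m (Suc (Suc n))) \<and> m (Suc n) \<le> m (Suc (Suc n))"
proof -
  define k where "k = Suc n"
  define x where "x = se_X (m k)"
  have m: "0 < m k" "m k \<le> 1" using m_pos m_le_1 by auto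
  have x: "0 < x" using se_X_pos m by (simp add: x_def)
  have "lam * (1 - (se_M (m n))\<^sup>2) \<le> lam * se_N (A n) (m n)" using lam by (intro mult_left_mono se_N_ge) auto
  also have "\<dots> = (A k)\<^sup>2 * (1 - m k)" using s_Suc[of n] s_eq[of k] by (simp add: k_def)
  finally have "lam * se_N (A k) (m k) \<le> (1 - m k) * x\<^sup>2" unfolding x_def
    using assms A_pos[of k] a_eq[of k] a_Suc[of n] lam lam_less m m_pos[of n] m_le_1[of n]
    by (intro good_region_step[where j = "m n"]) (auto simp: k_def)
  then have "(A (Suc k))\<^sup>2 \<le> x\<^sup>2"
    unfolding A_sq[of "Suc k"] a_Suc s_Suc using m by (simp add: se_F_sq x_def algebra_simps)
  then have Ax: "A (Suc k) \<le> x" by (rule power2_le_imp_le) (use x in simp)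
  \<comment> \<open>The new modulus has square \<open>m k * x\<^sup>2\<close>, while the new radius
    is at most x; therefore the ratio cannot have decreased.\<close>
  have "(A (Suc k) * sqrt (m (Suc k)))\<^sup>2 = m k * x\<^sup>2"
    unfolding a_eq[symmetric] a_Suc using m by (simp add: se_F_sq x_def)
  then have e: "(A (Suc k))\<^sup>2 * m (Suc k) = m k * x\<^sup>2"
    using m_pos[of "Suc k"] by (simp add: power_mult_distrib)
  have "(A (Suc k))\<^sup>2 * m (Suc k) \<le> x\<^sup>2 * m (Suc k)"
    using Ax A_pos[of "Suc k"] m_pos[of "Suc k"] by (intro mult_right_mono power_mono) auto
  then have "m k \<le> m (Suc k)" unfolding e using x by (simp add: mult.commute)
  moreover have "x \<le> se_X (m (Suc k))"
    unfolding x_def using m_le_1 m calculation by (intro se_X_mono) auto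
  ultimately show ?thesis using Ax by (auto simp: k_def)
qed

text \<open>Once in the region, m is increasing and bounded. By continuity its limit \<mu> gives a
  fixed point on the curve A = X, and \<open>se_N_at_X_less\<close> leaves only \<mu> = 1.\<close>

theorem converges: "a \<longlonglongrightarrow> 1" "s \<longlonglongrightarrow> 0"
proof -
  obtain N where N: "A (Suc N) \<le> se_X (m (Suc N))"
    using enters_good_region by (metis Suc_le_D One_nat_def)
  define M where "M n = m (n + Suc N)" for n
  have good: "A (n + Suc N) \<le> se_X (m (n + Suc N))" for n
  proof (induction n)
    case (Suc n)
    then show ?case using good_region_invariant[of "n + N"] by simp
  qed (use N in simp)
  have "incseq M" unfolding M_def using good good_region_invariant[of "_ + N"]
    by (intro incseq_SucI) (metis add_Suc add_Suc_right)
  then obtain \<mu> where \<mu>: "M \<longlonglongrightarrow> \<mu>" "\<And>n. M n \<le> \<mu>"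
    using m_le_1 by (elim incseq_convergent[of M 1]) (auto simp: M_def)
  have \<mu>0: "0 < \<mu>" using \<mu>(2)[of 0] m_pos[of "Suc N"] by (simp add: M_def)
  have \<mu>1: "\<mu> \<le> 1" by (rule LIMSEQ_le_const2[OF \<mu>(1)]) (auto simp: M_def m_le_1)
  have in01: "M n \<in> {0..1}" for n using m_pos m_le_1 less_imp_le by (auto simp: M_def)
  note lim = continuous_on_tendsto_compose[OF _ \<mu>(1), of "{0..1}"]
  have F: "(\<lambda>n. se_F (M n)) \<longlonglongrightarrow> se_F \<mu>"
    using \<mu>0 \<mu>1 in01 by (intro lim continuous_se_F) auto
  have Mm: "(\<lambda>n. se_M (M n)) \<longlonglongrightarrow> se_M \<mu>"
    using \<mu>0 \<mu>1 in01 by (intro lim continuous_se_M) auto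
  have a': "(\<lambda>n. a (n + Suc (Suc N))) \<longlonglongrightarrow> se_F \<mu>" using F by (simp add: M_def a_Suc)
  have "(\<lambda>n. a (n + Suc (Suc N)) / sqrt (M (Suc n))) \<longlonglongrightarrow> se_F \<mu> / sqrt \<mu>"
    using a' LIMSEQ_Suc[OF \<mu>(1)] \<mu>0 by (intro tendsto_intros) auto
  moreover have "a (n + Suc (Suc N)) / sqrt (M (Suc n)) = A (n + Suc (Suc N))" for n
    using m_pos[of "n + Suc (Suc N)"] by (simp add: a_eq M_def)
  moreover have "se_F \<mu> / sqrt \<mu> = se_X \<mu>" using \<mu>0 by (simp add: se_F_def)
  ultimately have A: "(\<lambda>n. A (n + Suc (Suc N))) \<longlonglongrightarrow> se_X \<mu>" by simp
  have "(\<lambda>n. (A (n + Suc (Suc N)))\<^sup>2 * (1 - M (Suc n))) \<longlonglongrightarrow> (se_X \<mu>)\<^sup>2 * (1 - \<mu>)"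
    by (intro tendsto_intros A LIMSEQ_Suc \<mu>)
  then have s1: "(\<lambda>n. s (n + Suc (Suc N))) \<longlonglongrightarrow> (se_X \<mu>)\<^sup>2 * (1 - \<mu>)" by (simp add: s_eq M_def)
  have "(\<lambda>n. lam * se_N (A (n + Suc (Suc N))) (M (Suc n))) \<longlonglongrightarrow> lam * se_N (se_X \<mu>) \<mu>"
    unfolding se_N_def by (intro tendsto_intros A LIMSEQ_Suc[OF Mm])
  then have "(\<lambda>n. s (Suc n + Suc (Suc N))) \<longlonglongrightarrow> lam * se_N (se_X \<mu>) \<mu>" by (simp add: s_Suc M_def)
  then have eq: "lam * se_N (se_X \<mu>) \<mu> = (se_X \<mu>)\<^sup>2 * (1 - \<mu>)"
    using LIMSEQ_Suc[OF s1] LIMSEQ_unique by blast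
  have "\<mu> = 1"
  proof (rule ccontr)
    assume "\<mu> \<noteq> 1"
    then show False using se_N_at_X_less[of \<mu> lam] \<mu>0 \<mu>1 lam_less eq by (simp add: mult.commute)
  qed
  then have "(\<lambda>n. a (n + Suc (Suc N))) \<longlonglongrightarrow> 1" "(\<lambda>n. s (n + Suc (Suc N))) \<longlonglongrightarrow> 0"
    using a' s1 by (simp_all add: se_F_1)
  then show "a \<longlonglongrightarrow> 1" "s \<longlonglongrightarrow> 0" by (blast intro: LIMSEQ_offset)+
qed

end

section \<open>The recursion near its fixed point\<close>

text \<open>Split 1 - X into 1 - M, which is at most (1 - m) / 4, and M - X = y X, which the power
  barrier controls.\<close>

lemma one_minus_F_le:
  assumes "0 \<le> m" "m \<le> 1"
  shows "1 - se_F m \<le> 3 * (1 - m) powr (3/4)"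
proof -
  define p where "p = (1 - m) powr (3/4)"
  have p: "1 - m \<le> p" unfolding p_def using assms powr_mono'[of "3/4" 1 "1 - m"] by simp
  have X: "0 < se_X m" "se_X m \<le> 1" using se_X_pos[OF assms] se_X_le_1[OF assms] by auto
  have "se_M m - se_X m = se_y m * se_X m" using se_M_eq[OF assms] by (simp add: algebra_simps)
  also have "\<dots> \<le> se_y m" using se_y_nonneg[OF assms] X by (intro mult_left_le) auto
  also have "\<dots> \<le> m * p" using se_y_le_powr[of m] assms by (simp add: p_def)
  also have "\<dots> \<le> p" using assms by (intro mult_left_le_one_le) (auto simp: p_def)
  finally have "1 - se_X m \<le> (1 - m) / 4 + p" using se_M_ge[OF assms] by linarith
  moreover have "m \<le> sqrt m" using assms by (simp add: real_le_rsqrt power2_eq_square mult_left_le)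
  then have "m * se_X m \<le> se_F m" unfolding se_F_def using X by (intro mult_right_mono) auto
  moreover have "(1 - m) * se_X m \<le> 1 - m" using assms X by (intro mult_left_le) auto
  moreover have "(1 - m) * se_X m = se_X m - m * se_X m" by (simp add: algebra_simps)
  moreover have "(1 - m) / 4 \<le> p" using p assms by simp
  ultimately show ?thesis using p unfolding p_def[symmetric] by linarith
qed

text \<open>The exponent 3/2 exceeds 1: the squared error of the modulus is of smaller order than
  the variance that caused it.\<close>

lemma one_minus_F_sq_le:
  assumes "0 \<le> m" "m \<le> 1"
  shows "(1 - se_F m)\<^sup>2 \<le> 9 * ((1 - m) * sqrt (1 - m))"
proof (cases "m = 1")
  case False
  have "(1 - se_F m)\<^sup>2 \<le> (3 * (1 - m) powr (3/4))\<^sup>2"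
    using one_minus_F_le[OF assms] se_F_le_1[OF assms] by (intro power_mono) auto
  also have "\<dots> = 9 * ((1 - m) powr (1 + 1/2))"
    by (simp add: power_mult_distrib power2_eq_square flip: powr_add)
  also have "\<dots> = 9 * ((1 - m) * sqrt (1 - m))"
    using False assms by (simp only: powr_add powr_half_sqrt) (simp add: powr_half_sqrt)
  finally show ?thesis .
qed (simp add: se_F_1)

text \<open>By (1 - z) X' \<le> y / z and the power barrier, the slope is at most the power -1/4 of
  1 - z. Measuring the distance to 1 by a fourth power makes the constant 1 / r.\<close>

lemma se_X_lipschitz:
  assumes "0 < r" "0 < m" "m \<le> m'" "r ^ 4 \<le> 1 - m'"
  shows "se_X m' - se_X m \<le> (m' - m) / r"
proof (cases "m = m'")
  case False
  have "0 < r ^ 4" using assms by simp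
  then have "m' < 1" using assms(4) by linarith
  with False assms(3) have m': "m < m'" "m' < 1" by auto
  have "\<exists>l z. m < z \<and> z < m' \<and> (se_X has_real_derivative l) (at z) \<and> se_X m' - se_X m = (m' - m) * l"
  proof (rule MVT[OF m'(1)])
    show "continuous_on {m..m'} se_X"
      by (rule continuous_on_subset[OF continuous_se_X]) (use assms m' in auto)
    show "se_X differentiable (at z)" if "z < m'" for z
      using se_X_Leibniz[of z] that m' by (auto simp: real_differentiable_def)
  qed
  then obtain l z where z: "m < z" "z < m'" "(se_X has_real_derivative l) (at z)" "se_X m' - se_X m = (m' - m) * l"
    by blast
  have z01: "0 < z" "z < 1" using z assms m' by auto
  obtain D where "(se_X has_real_derivative D) (at z)" "z * (1 - z) * D = se_M z - se_X z"
    using se_X_deriv[of z] z01 by auto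
  then have l: "z * (1 - z) * l = se_M z - se_X z" using z(3) DERIV_unique by blast
  have X: "0 < se_X z" "se_X z \<le> 1" using se_X_pos[of z] se_X_le_1[of z] z01 by auto
  have "z * (1 - z) * l = se_y z * se_X z" unfolding l using se_M_eq[of z] z01 by (simp add: algebra_simps)
  also have "\<dots> \<le> se_y z" using se_y_nonneg[of z] z01 X by (intro mult_left_le) auto
  also have "\<dots> \<le> z * (1 - z) powr (3/4)" using se_y_le_powr[of z] z01 by simp
  finally have "(1 - z) * l \<le> (1 - z) powr (3/4)" using z01 by (simp add: mult.assoc)
  moreover have "r * (1 - z) powr (3/4) \<le> 1 - z"
  proof -
    have "r = (r powr 4) powr (1/4)" using assms by (subst powr_powr) simp
    also have "r powr 4 = r ^ 4" using assms by (simp add: powr_numeral)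
    also have "(r ^ 4) powr (1/4) \<le> (1 - z) powr (1/4)" using assms z by (intro powr_mono2) auto
    finally have "r * (1 - z) powr (3/4) \<le> (1 - z) powr (1/4) * (1 - z) powr (3/4)"
      by (intro mult_right_mono) auto
    also have "\<dots> = 1 - z" using z01 by (simp flip: powr_add)
    finally show ?thesis .
  qed
  ultimately have "r * ((1 - z) * l) \<le> 1 - z" using assms mult_left_mono[of "(1 - z) * l" "(1 - z) powr (3/4)" r] by linarith
  then have "(1 - z) * (r * l) \<le> (1 - z) * 1" by (simp add: mult_ac)
  then have "r * l \<le> 1" using z01 by simp
  then have "l \<le> 1 / r" using assms by (simp add: field_simps)
  then have "(m' - m) * l \<le> (m' - m) * (1 / r)" using m' by (intro mult_left_mono) auto
  then show ?thesis using z(4) by simp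
qed simp

lemma se_F_lipschitz:
  assumes r: "0 < r" and m: "1/4 \<le> m" "r ^ 4 \<le> 1 - m" and m': "1/4 \<le> m'" "r ^ 4 \<le> 1 - m'"
  shows "\<bar>se_F m' - se_F m\<bar> \<le> (1 + 1 / r) * \<bar>m' - m\<bar>"
proof -
  have *: "\<bar>se_F m' - se_F m\<bar> \<le> (1 + 1 / r) * \<bar>m' - m\<bar>"
    if mm: "m \<le> m'" and m: "1/4 \<le> m" and m': "r ^ 4 \<le> 1 - m'" for m m'
  proof -
    have m1: "m' \<le> 1" "0 \<le> m" using m' r m zero_le_power[of r 4] by linarith+
    have "1/2 \<le> sqrt m" by (rule real_le_rsqrt) (use m in \<open>simp add: power2_eq_square\<close>)
    then have q: "1/2 \<le> sqrt m" "sqrt m \<le> sqrt m'" using mm by auto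
    have "1 \<le> sqrt m' + sqrt m" using q by linarith
    then have "sqrt m' - sqrt m \<le> (sqrt m' - sqrt m) * (sqrt m' + sqrt m)"
      using q mult_left_mono[of 1 "sqrt m' + sqrt m" "sqrt m' - sqrt m"] by simp
    also have "\<dots> = m' - m" using m mm by (simp add: algebra_simps)
    finally have s: "sqrt m' - sqrt m \<le> m' - m" .
    have X: "0 < se_X m" "se_X m' \<le> 1" "se_X m \<le> se_X m'" using se_X_pos[of m] se_X_le_1[of m'] se_X_mono[of m m'] m1 mm by auto
    have "se_F m' - se_F m = (sqrt m' - sqrt m) * se_X m' + sqrt m * (se_X m' - se_X m)"
      by (simp add: se_F_def algebra_simps)
    also have "\<dots> \<le> (m' - m) * 1 + 1 * ((m' - m) / r)"
      using X q s m1 mm se_X_lipschitz[of r m m'] r m m' by (intro add_mono mult_mono) auto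
    also have "\<dots> = (1 + 1 / r) * (m' - m)" by (simp add: algebra_simps)
    finally have "se_F m' - se_F m \<le> (1 + 1 / r) * (m' - m)" .
    moreover have "se_F m \<le> se_F m'" using se_F_strict_mono[of m m'] m1 mm by (cases "m = m'") auto
    ultimately show ?thesis using mm by simp
  qed
  show ?thesis
    using *[of m m'] *[of m' m] m m' by (cases "m \<le> m'") (auto simp: abs_minus_commute)
qed

lemma se_M_lipschitz:
  assumes "0 \<le> m" "m \<le> 1" "0 \<le> m'" "m' \<le> 1"
  shows "\<bar>se_M m' - se_M m\<bar> \<le> \<bar>m' - m\<bar> / 4"
proof -
  have *: "\<bar>se_M m' - se_M m\<bar> \<le> \<bar>m' - m\<bar> / 4" if "m \<le> m'" "0 \<le> m" "m' \<le> 1" for m m'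
  proof -
    have "se_X m' * (m' - m) / 4 \<le> (m' - m) / 4"
      using mult_left_le_one_le[of "m' - m" "se_X m'"] se_X_le_1[of m'] se_X_pos[of m'] that by simp
    then have "se_M m' - se_M m \<le> (m' - m) / 4" using se_M_increment(2)[of m m'] that by linarith
    then show ?thesis using se_M_mono[of m m'] that by simp
  qed
  show ?thesis using *[of m m'] *[of m' m] assms by (cases "m \<le> m'") (auto simp: abs_minus_commute)
qed

section \<open>Lyapunov function and one-step differences near (1, 0)\<close>

context real_se
begin

lemma one_minus_m: "1 - m n = s n / (A n)\<^sup>2"
  using A_pos[of n] by (simp add: s_eq)

lemma a_le_A: "a n \<le> A n"
  unfolding a_eq using A_pos[of n] m_le_1[of n] m_pos[of n] by (intro mult_left_le) auto

lemma A_le: "a n \<le> 1 \<Longrightarrow> A n \<le> a n + s n / a n" "a n \<le> 1 \<Longrightarrow> A n \<le> 1 + s n"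
proof -
  assume a: "a n \<le> 1"
  have "(A n)\<^sup>2 \<le> (a n + s n / a n)\<^sup>2"
    using a_pos[of n] s_nonneg[of n] by (simp add: A_sq power2_sum)
  then show "A n \<le> a n + s n / a n" by (rule power2_le_imp_le) (use a_pos[of n] s_nonneg[of n] in auto)
  have "(a n)\<^sup>2 \<le> 1" using a a_pos[of n] by (simp add: abs_square_le_1)
  then have "(A n)\<^sup>2 \<le> (1 + s n)\<^sup>2"
    using s_nonneg[of n] zero_le_power2[of "s n"] unfolding A_sq power2_sum one_power2 mult_1_right by linarith
  then show "A n \<le> 1 + s n" by (rule power2_le_imp_le) (use s_nonneg[of n] in auto)
qed

lemma one_minus_m_le:
  assumes "0 < \<alpha>" "\<alpha> \<le> a n" shows "1 - m n \<le> s n / \<alpha>\<^sup>2"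
  unfolding one_minus_m using assms a_le_A[of n] s_nonneg[of n] by (intro divide_left_mono power_mono) auto

lemma se_N_eq: "se_N (A n) (m n) = (A n - 1)\<^sup>2 + 2 * A n * (1 - se_M (m n))"
  by (simp add: se_N_def power2_eq_square algebra_simps)

text \<open>The update of s contributes at most \<open>2 * lam * (1 - a)\<^sup>2\<close> to leading
  order; the weight 4 turns this into lam / 2 times the second term of V, the same rate as for
  s.\<close>

definition V :: "nat \<Rightarrow> real" where "V n = s n + 4 * (1 - a n)\<^sup>2"

lemma V_bounds:
  assumes "V n \<le> u\<^sup>2" "0 \<le> u"
  shows "s n \<le> u\<^sup>2" "1 - u \<le> a n"
proof -
  have sq: "0 \<le> (1 - a n)\<^sup>2" by simp
  show "s n \<le> u\<^sup>2" using assms sq unfolding V_def by linarith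
  have "(1 - a n)\<^sup>2 \<le> u\<^sup>2" using assms sq s_nonneg[of n] unfolding V_def by linarith
  then have "1 - a n \<le> u" using assms(2) by (rule power2_le_imp_le)
  then show "1 - u \<le> a n" by simp
qed

text \<open>The left side of \<open>phi\<close> collects the coefficients of s: lam / (2 (1 - u))
  from 1 - M, the second term from the square of A - a, the third from the next modulus through
  \<open>one_minus_F_sq_le\<close>. It tends to lam / 2 as u tends to 0.\<close>

lemma V_step:
  assumes an: "a n \<le> 1" and u: "0 < u" "u < 1" and Vn: "V n \<le> u\<^sup>2" and k: "lam / 2 \<le> k"
    and phi: "lam / (2 * (1 - u)) + 2 * lam * u\<^sup>2 / (1 - u)\<^sup>2 + 36 * u / (1 - u) ^ 3 \<le> k"
  shows "V (Suc n) \<le> k * V n + 4 * w"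
proof -
  define q where "q = 1 - u"
  have q: "0 < q" "q \<le> a n" "s n \<le> u\<^sup>2" using V_bounds[OF Vn] u by (auto simp: q_def)
  note s0 = s_nonneg[of n]
  define e where "e = 1 - m n"
  have e: "0 \<le> e" "e \<le> s n / q\<^sup>2" using one_minus_m_le[of q n] q m_le_1[of n] by (auto simp: e_def)
  have "A n - a n \<le> s n / a n" using A_le(1)[OF an] by simp
  also have "\<dots> \<le> s n / q" using q s0 by (intro divide_left_mono) auto
  finally have "(A n - a n)\<^sup>2 \<le> (s n / q)\<^sup>2" using a_le_A[of n] by (intro power_mono) auto
  moreover have "(A n - 1)\<^sup>2 \<le> 2 * (1 - a n)\<^sup>2 + 2 * (A n - a n)\<^sup>2"
    using zero_le_power2[of "(A n - a n) + (1 - a n)"] by (simp add: power2_eq_square algebra_simps)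
  moreover have "(s n / q)\<^sup>2 \<le> s n * (u\<^sup>2 / q\<^sup>2)"
    using q s0 mult_left_mono[of "s n" "u\<^sup>2" "s n"] by (simp add: power2_eq_square divide_right_mono)
  ultimately have A1: "(A n - 1)\<^sup>2 \<le> 2 * (1 - a n)\<^sup>2 + 2 * (s n * (u\<^sup>2 / q\<^sup>2))" by linarith
  have "1 - se_M (m n) \<le> e / 4" unfolding e_def using se_M_ge m_pos[of n] m_le_1[of n] by simp
  then have "2 * A n * (1 - se_M (m n)) \<le> 2 * A n * (e / 4)" using A_pos[of n] by (intro mult_left_mono) auto
  also have "\<dots> = s n / (2 * A n)" using A_pos[of n] by (simp add: e_def one_minus_m power2_eq_square)
  also have "\<dots> \<le> s n / (2 * q)" using q s0 a_le_A[of n] by (intro divide_left_mono) auto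
  finally have "se_N (A n) (m n) \<le> 2 * (1 - a n)\<^sup>2 + 2 * (s n * (u\<^sup>2 / q\<^sup>2)) + s n / (2 * q)"
    unfolding se_N_eq using A1 by linarith
  then have "lam * se_N (A n) (m n) \<le> lam * (2 * (1 - a n)\<^sup>2 + 2 * (s n * (u\<^sup>2 / q\<^sup>2)) + s n / (2 * q))"
    using lam by (intro mult_left_mono) auto
  then have S: "s (Suc n) \<le> lam * (2 * (1 - a n)\<^sup>2 + 2 * (s n * (u\<^sup>2 / q\<^sup>2)) + s n / (2 * q)) + 4 * w"
    unfolding s_Suc by simp
  have "sqrt e \<le> sqrt (u\<^sup>2 / q\<^sup>2)"
    using e q s0 by (intro real_sqrt_le_mono) (meson divide_right_mono order_trans zero_le_power2)
  also have "\<dots> = u / q" using u q by (simp add: real_sqrt_divide)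
  finally have se: "sqrt e \<le> u / q" .
  have "(1 - a (Suc n))\<^sup>2 \<le> 9 * (e * sqrt e)"
    unfolding a_Suc e_def using m_pos[of n] m_le_1[of n] by (intro one_minus_F_sq_le) auto
  also have "\<dots> \<le> 9 * ((s n / q\<^sup>2) * (u / q))" using e se u q by (intro mult_left_mono mult_mono) auto
  also have "\<dots> = s n * (9 * u / q ^ 3)" by (simp add: power2_eq_square power3_eq_cube)
  finally have "4 * (1 - a (Suc n))\<^sup>2 \<le> 4 * (s n * (9 * u / q ^ 3))" by (rule mult_left_mono) simp
  also have "\<dots> = s n * (36 * u / q ^ 3)" by simp
  finally have B: "4 * (1 - a (Suc n))\<^sup>2 \<le> s n * (36 * u / q ^ 3)" .
  have "V (Suc n) \<le> 2 * lam * (1 - a n)\<^sup>2 +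
      s n * (lam / (2 * q) + 2 * lam * u\<^sup>2 / q\<^sup>2 + 36 * u / q ^ 3) + 4 * w"
    using S B unfolding V_def by (simp add: algebra_simps)
  also have "\<dots> \<le> 4 * k * (1 - a n)\<^sup>2 + s n * k + 4 * w"
    using k phi s0 by (intro add_mono mult_right_mono mult_left_mono) (auto simp: q_def)
  finally show ?thesis unfolding V_def by (simp add: algebra_simps)
qed

text \<open>Only 2 A (1 - M) is kept from the update. By 1 - M \<ge> X (1 - m) / 4 it is at least X
  s / (2 A), and X / A is close to 1.\<close>

lemma s_step_ge:
  assumes an: "a n \<le> 1" and u: "0 < u" "u < 1" and Vn: "V n \<le> u\<^sup>2"
    and phi: "k \<le> lam * (1 - 2 * u / (1 - u)) / (2 * (1 + u\<^sup>2))" and pos: "2 * u \<le> 1 - u"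
  shows "k * s n + 4 * w \<le> s (Suc n)"
proof -
  define q where "q = 1 - u"
  have q: "0 < q" "q \<le> a n" "s n \<le> u\<^sup>2" using V_bounds[OF Vn] u by (auto simp: q_def)
  note s0 = s_nonneg[of n]
  define e where "e = 1 - m n"
  have e: "0 \<le> e" "e \<le> s n / q\<^sup>2" using one_minus_m_le[of q n] q m_le_1[of n] by (auto simp: e_def)
  have "sqrt e \<le> sqrt (u\<^sup>2 / q\<^sup>2)"
    using e q s0 by (intro real_sqrt_le_mono) (meson divide_right_mono order_trans zero_le_power2)
  also have "\<dots> = u / q" using u q by (simp add: real_sqrt_divide)
  finally have se: "2 * sqrt e \<le> 2 * u / q" by simp
  have X1: "1 - se_X (m n) \<le> 2 * sqrt e"
  proof (cases "m n = 1")
    case False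
    then have "\<bar>se_X (m n) - 1\<bar> \<le> pi/2 * sqrt e"
      using se_X_M_near_1(1)[of "m n"] m_pos[of n] m_le_1[of n] by (simp add: e_def)
    moreover have "pi/2 * sqrt e \<le> 2 * sqrt e" using pi_less_4 e by (intro mult_right_mono) auto
    ultimately show ?thesis by linarith
  qed (simp add: se_X_1 e_def)
  then have X2: "1 - 2 * u / q \<le> se_X (m n)" using se by linarith
  have c0: "0 \<le> 1 - 2 * u / q" using pos q by (simp add: q_def field_simps)
  have Ae: "A n * e = s n / A n" using A_pos[of n] by (simp add: e_def one_minus_m power2_eq_square)
  have "se_X (m n) * e / 4 \<le> 1 - se_M (m n)" unfolding e_def using se_M_le[of "m n"] m_pos[of n] m_le_1[of n] by simp
  then have "2 * A n * (se_X (m n) * e / 4) \<le> 2 * A n * (1 - se_M (m n))" using A_pos[of n] by (intro mult_left_mono) auto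
  moreover have "2 * A n * (se_X (m n) * e / 4) = se_X (m n) / 2 * (A n * e)" by simp
  then have "2 * A n * (se_X (m n) * e / 4) = se_X (m n) / (2 * A n) * s n" unfolding Ae by simp
  moreover have "(1 - 2 * u / q) / (2 * (1 + u\<^sup>2)) \<le> se_X (m n) / (2 * A n)"
    using X2 c0 A_le(2)[OF an] A_pos[of n] q(3) by (intro frac_le mult_left_mono) linarith+
  then have "(1 - 2 * u / q) / (2 * (1 + u\<^sup>2)) * s n \<le> se_X (m n) / (2 * A n) * s n" using s0 by (intro mult_right_mono)
  ultimately have "(1 - 2 * u / q) / (2 * (1 + u\<^sup>2)) * s n \<le> se_N (A n) (m n)"
    unfolding se_N_eq by (smt (verit) zero_le_power2)
  then have "lam * ((1 - 2 * u / q) / (2 * (1 + u\<^sup>2)) * s n) \<le> lam * se_N (A n) (m n)"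
    using lam by (intro mult_left_mono) auto
  moreover have "k * s n \<le> lam * (1 - 2 * u / (1 - u)) / (2 * (1 + u\<^sup>2)) * s n" using phi s0 by (rule mult_right_mono)
  ultimately show ?thesis unfolding s_Suc by (simp add: q_def)
qed

text \<open>A change of a carries the small factor \<sigma>, since m is constantly 1 along s =
  0.\<close>

lemma m_diff_le:
  assumes al: "0 < \<alpha>" "\<alpha> \<le> a n" "\<alpha> \<le> a k" "a n \<le> 1" "a k \<le> 1" and sg: "s n \<le> \<sigma>"
  shows "\<bar>m k - m n\<bar> \<le> (2 * \<sigma> * \<bar>a k - a n\<bar> + \<bar>s k - s n\<bar>) / \<alpha> ^ 4"
proof -
  have P: "\<alpha> ^ 4 \<le> (A n)\<^sup>2 * (A k)\<^sup>2"
  proof -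
    have "\<alpha>\<^sup>2 * \<alpha>\<^sup>2 \<le> (A n)\<^sup>2 * (A k)\<^sup>2" using al a_le_A[of n] a_le_A[of k] by (intro mult_mono power_mono) auto
    then show ?thesis by (simp add: power4_eq_xxxx power2_eq_square mult.assoc)
  qed
  have "m k - m n = (s n * ((a k)\<^sup>2 - (a n)\<^sup>2) + (a n)\<^sup>2 * (s n - s k)) / ((A n)\<^sup>2 * (A k)\<^sup>2)"
    using A_pos[of n] A_pos[of k] unfolding m_def A_sq[symmetric]
    by (simp add: field_simps) (simp add: A_sq algebra_simps)
  then have "\<bar>m k - m n\<bar> = \<bar>s n * ((a k)\<^sup>2 - (a n)\<^sup>2) + (a n)\<^sup>2 * (s n - s k)\<bar> / ((A n)\<^sup>2 * (A k)\<^sup>2)"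
    by (simp add: abs_mult)
  also have "\<dots> \<le> (2 * \<sigma> * \<bar>a k - a n\<bar> + \<bar>s k - s n\<bar>) / \<alpha> ^ 4"
  proof (rule frac_le)
    have "\<bar>s n * ((a k)\<^sup>2 - (a n)\<^sup>2) + (a n)\<^sup>2 * (s n - s k)\<bar> \<le> \<bar>s n * ((a k)\<^sup>2 - (a n)\<^sup>2)\<bar> + \<bar>(a n)\<^sup>2 * (s n - s k)\<bar>"
      by (rule abs_triangle_ineq)
    also have "\<bar>s n * ((a k)\<^sup>2 - (a n)\<^sup>2)\<bar> = s n * ((a k + a n) * \<bar>a k - a n\<bar>)"
    proof -
      have "(a k)\<^sup>2 - (a n)\<^sup>2 = (a k + a n) * (a k - a n)" by (simp add: power2_eq_square algebra_simps)
      then show ?thesis using s_nonneg[of n] a_pos[of n] a_pos[of k] by (simp add: abs_mult)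
    qed
    also have "\<dots> \<le> \<sigma> * (2 * \<bar>a k - a n\<bar>)" using s_nonneg[of n] sg al a_pos[of n] a_pos[of k]
      by (intro mult_mono mult_right_mono) auto
    also have "\<bar>(a n)\<^sup>2 * (s n - s k)\<bar> = (a n)\<^sup>2 * \<bar>s k - s n\<bar>" by (simp add: abs_mult abs_minus_commute)
    also have "\<dots> \<le> \<bar>s k - s n\<bar>" using al a_pos[of n] by (intro mult_left_le_one_le) (auto simp: abs_square_le_1)
    finally show "\<bar>s n * ((a k)\<^sup>2 - (a n)\<^sup>2) + (a n)\<^sup>2 * (s n - s k)\<bar> \<le> 2 * \<sigma> * \<bar>a k - a n\<bar> + \<bar>s k - s n\<bar>" by simp
    show "0 \<le> 2 * \<sigma> * \<bar>a k - a n\<bar> + \<bar>s k - s n\<bar>" using sg s_nonneg[of n] by (intro add_nonneg_nonneg mult_nonneg_nonneg) auto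
  qed (use P al in auto)
  finally show ?thesis .
qed

lemma A_diff_le:
  assumes al: "0 < \<alpha>" "\<alpha> \<le> a n" "\<alpha> \<le> a k" "a n \<le> 1" "a k \<le> 1"
  shows "\<bar>A k - A n\<bar> \<le> (\<bar>a k - a n\<bar> + \<bar>s k - s n\<bar>) / \<alpha>"
proof -
  have "(A k + A n) * (A k - A n) = (a k + a n) * (a k - a n) + (s k - s n)"
    using A_sq[of k] A_sq[of n] by (simp add: power2_eq_square algebra_simps)
  then have "(A k + A n) * \<bar>A k - A n\<bar> = \<bar>(a k + a n) * (a k - a n) + (s k - s n)\<bar>"
    using A_pos[of k] A_pos[of n] by (metis abs_mult abs_of_pos add_pos_pos)
  also have "\<dots> \<le> (a k + a n) * \<bar>a k - a n\<bar> + \<bar>s k - s n\<bar>"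
    using abs_triangle_ineq[of "(a k + a n) * (a k - a n)" "s k - s n"] a_pos[of n] a_pos[of k] by (simp add: abs_mult)
  also have "\<dots> \<le> 2 * \<bar>a k - a n\<bar> + 2 * \<bar>s k - s n\<bar>"
    using al by (intro add_mono mult_right_mono) auto
  finally have "(A k + A n) * \<bar>A k - A n\<bar> \<le> 2 * (\<bar>a k - a n\<bar> + \<bar>s k - s n\<bar>)" by simp
  moreover have "(2 * \<alpha>) * \<bar>A k - A n\<bar> \<le> (A k + A n) * \<bar>A k - A n\<bar>"
    using al a_le_A[of n] a_le_A[of k] by (intro mult_right_mono) auto
  ultimately have "\<alpha> * \<bar>A k - A n\<bar> \<le> \<bar>a k - a n\<bar> + \<bar>s k - s n\<bar>" by simp
  then show ?thesis using al by (simp add: field_simps)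
qed

text \<open>Near (1, 0) the dependence on A has a small coefficient because A is close to the
  minimiser M; the dependence through M has slope about 1/2 in s.\<close>

lemma N_diff_le:
  assumes al: "0 < \<alpha>" "\<alpha> \<le> 1" "\<alpha> \<le> a n" "\<alpha> \<le> a k" "a n \<le> 1" "a k \<le> 1" and sg: "s n \<le> \<sigma>" "s k \<le> \<sigma>"
  defines "E \<equiv> \<bar>a k - a n\<bar>" and "D \<equiv> \<bar>s k - s n\<bar>"
  shows "\<bar>se_N (A k) (m k) - se_N (A n) (m n)\<bar>
    \<le> (E + D) / \<alpha> * (2 * (1 - \<alpha> + \<sigma>) + \<sigma> / (2 * \<alpha>\<^sup>2)) + (1 + \<sigma>) / 2 * ((2 * \<sigma> * E + D) / \<alpha> ^ 4)"
proof -
  have s0: "0 \<le> \<sigma>" using sg s_nonneg[of n] by simp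
  have A1: "\<bar>A n - 1\<bar> \<le> 1 - \<alpha> + \<sigma>" "\<bar>A k - 1\<bar> \<le> 1 - \<alpha> + \<sigma>"
    using a_le_A[of n] A_le(2)[of n] a_le_A[of k] A_le(2)[of k] al sg s0 unfolding abs_le_iff by auto
  have dA: "\<bar>A k - A n\<bar> \<le> (E + D) / \<alpha>" unfolding E_def D_def using al by (intro A_diff_le) auto
  have "\<bar>se_M (m k) - se_M (m n)\<bar> \<le> \<bar>m k - m n\<bar> / 4"
    using m_pos m_le_1 less_imp_le by (intro se_M_lipschitz) auto
  also have "\<dots> \<le> (2 * \<sigma> * E + D) / \<alpha> ^ 4 / 4" unfolding E_def D_def
    using al sg by (intro divide_right_mono m_diff_le) auto
  finally have dM: "\<bar>se_M (m k) - se_M (m n)\<bar> \<le> (2 * \<sigma> * E + D) / \<alpha> ^ 4 / 4" .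
  have M0: "0 \<le> 1 - se_M (m n)" using se_M_le_1[of "m n"] m_pos[of n] m_le_1[of n] by simp
  have "1 - se_M (m n) \<le> (1 - m n) / 4" using se_M_ge m_pos[of n] m_le_1[of n] by simp
  also have "\<dots> \<le> \<sigma> / \<alpha>\<^sup>2 / 4"
    using order_trans[OF one_minus_m_le[of \<alpha> n] divide_right_mono[OF sg(1)]] al by (intro divide_right_mono) auto
  finally have M1: "1 - se_M (m n) \<le> \<sigma> / \<alpha>\<^sup>2 / 4" .
  have half: "2 * (c * (x / y / 4)) = c * (x / (2 * y))" for c x y :: real by simp
  have quarter: "2 * c * (x / 4) = c / 2 * x" for c x :: real by simp
  have "se_N (A k) (m k) - se_N (A n) (m n)
     = (A k - A n) * ((A k - 1) + (A n - 1)) + 2 * (A k - A n) * (1 - se_M (m n)) - 2 * A k * (se_M (m k) - se_M (m n))"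
    unfolding se_N_eq by (simp add: power2_eq_square algebra_simps)
  also have "\<bar>\<dots>\<bar> \<le> \<bar>(A k - A n) * ((A k - 1) + (A n - 1))\<bar> + \<bar>2 * (A k - A n) * (1 - se_M (m n))\<bar>
     + \<bar>2 * A k * (se_M (m k) - se_M (m n))\<bar>" by linarith
  also have "\<bar>(A k - A n) * ((A k - 1) + (A n - 1))\<bar> \<le> (E + D) / \<alpha> * (2 * (1 - \<alpha> + \<sigma>))"
    unfolding abs_mult using A1 dA by (intro mult_mono) auto
  also have "\<bar>2 * (A k - A n) * (1 - se_M (m n))\<bar> = 2 * (\<bar>A k - A n\<bar> * (1 - se_M (m n)))"
    by (simp only: abs_mult abs_numeral abs_of_nonneg[OF M0] mult.assoc)
  also have "\<dots> \<le> 2 * ((E + D) / \<alpha> * (\<sigma> / \<alpha>\<^sup>2 / 4))"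
    using dA M0 M1 al by (intro mult_left_mono mult_mono) (auto simp: E_def D_def)
  also have "\<dots> = (E + D) / \<alpha> * (\<sigma> / (2 * \<alpha>\<^sup>2))" by (rule half)
  also have "\<bar>2 * A k * (se_M (m k) - se_M (m n))\<bar> = 2 * A k * \<bar>se_M (m k) - se_M (m n)\<bar>"
    using A_pos[of k] by (simp add: abs_mult)
  also have "\<dots> \<le> 2 * (1 + \<sigma>) * ((2 * \<sigma> * E + D) / \<alpha> ^ 4 / 4)"
    using A_le(2)[of k] al sg dM s0 A_pos[of k] by (intro mult_mono mult_left_mono) auto
  also have "\<dots> = (1 + \<sigma>) / 2 * ((2 * \<sigma> * E + D) / \<alpha> ^ 4)" by (rule quarter)
  finally show ?thesis by (simp add: distrib_left)
qed

text \<open>The factor 2 in the lower bound on s absorbs \<open>A\<^sup>2\<close> \<le> 2, so that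
  both ratios keep the distance \<open>r ^ 4\<close> from 1 required by
  \<open>se_F_lipschitz\<close>.\<close>

lemma F_diff_le:
  assumes r: "0 < r" and al: "3/4 \<le> \<alpha>" "\<alpha> \<le> a n" "\<alpha> \<le> a k" "a n \<le> 1" "a k \<le> 1"
    and sg: "s n \<le> \<sigma>" "s k \<le> \<sigma>" "\<sigma> \<le> 1" and sl: "2 * r ^ 4 \<le> s n" "2 * r ^ 4 \<le> s k"
  shows "\<bar>se_F (m k) - se_F (m n)\<bar> \<le> (1 + 1 / r) * ((2 * \<sigma> * \<bar>a k - a n\<bar> + \<bar>s k - s n\<bar>) / \<alpha> ^ 4)"
proof -
  have m: "1/4 \<le> m j \<and> r ^ 4 \<le> 1 - m j" if "\<alpha> \<le> a j" "a j \<le> 1" "s j \<le> \<sigma>" "2 * r ^ 4 \<le> s j" for j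
  proof
    have a2: "(a j)\<^sup>2 \<le> 1" using that a_pos[of j] by (simp add: abs_square_le_1)
    have "(3/4)\<^sup>2 \<le> (a j)\<^sup>2" using that al by (intro power_mono) auto
    then have a3: "9/16 \<le> (a j)\<^sup>2" by (simp add: power2_eq_square)
    have A2: "(A j)\<^sup>2 \<le> 2" using a2 that sg by (simp add: A_sq)
    show "1/4 \<le> m j" unfolding m_def A_sq[symmetric] using A2 a3 A_pos[of j] by (simp add: field_simps)
    have "r ^ 4 * (A j)\<^sup>2 \<le> r ^ 4 * 2" using A2 by (intro mult_left_mono) auto
    then show "r ^ 4 \<le> 1 - m j" unfolding one_minus_m using that A_pos[of j] by (simp add: field_simps)
  qed
  have "\<bar>se_F (m k) - se_F (m n)\<bar> \<le> (1 + 1 / r) * \<bar>m k - m n\<bar>"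
    using m[of n] m[of k] assms by (intro se_F_lipschitz) auto
  also have "\<dots> \<le> (1 + 1 / r) * ((2 * \<sigma> * \<bar>a k - a n\<bar> + \<bar>s k - s n\<bar>) / \<alpha> ^ 4)"
    using assms by (intro mult_left_mono m_diff_le) auto
  finally show ?thesis .
qed

end

section \<open>Convergence in the presence of noise\<close>

lemma convergent_of_geometric_increments:
  fixes f :: "nat \<Rightarrow> real"
  assumes inc: "\<And>n. N \<le> n \<Longrightarrow> \<bar>f (Suc n) - f n\<bar> \<le> c * W n" and W: "\<And>n. 0 \<le> W n"
    and step: "\<And>n. N \<le> n \<Longrightarrow> W (Suc n) \<le> \<rho> * W n" and \<rho>: "\<rho> < 1"
  shows "convergent f"
proof -
  have "summable W" by (rule summable_ratio_test[OF \<rho>, of N]) (use W step in auto)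
  then have "summable (\<lambda>n. c * W n)" by (rule summable_mult)
  then have "summable (\<lambda>n. f (Suc n) - f n)"
    by (rule summable_comparison_test[rotated]) (use inc in auto)
  then have "convergent (\<lambda>n. \<Sum>i<n. f (Suc i) - f i)" by (simp add: summable_iff_convergent)
  then have "convergent (\<lambda>n. f n - f 0)" by (simp add: sum_lessThan_telescope)
  then have "convergent (\<lambda>n. (f n - f 0) + f 0)" by (intro convergent_add convergent_const)
  then show ?thesis by simp
qed

text \<open>At u = 0 both bounding expressions equal lam / 2, so continuity suffices.\<close>

lemma exists_trapping_radius:
  fixes lam :: real
  assumes "lam / 2 < \<kappa>" "\<kappa>' < lam / 2"
  shows "\<exists>u>0. u < 1 \<and> 2 * u \<le> 1 - u \<and>
    lam / (2 * (1 - u)) + 2 * lam * u\<^sup>2 / (1 - u)\<^sup>2 + 36 * u / (1 - u) ^ 3 \<le> \<kappa> \<and>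
    \<kappa>' \<le> lam * (1 - 2 * u / (1 - u)) / (2 * (1 + u\<^sup>2))"
proof -
  have "((\<lambda>u. lam / (2 * (1 - u)) + 2 * lam * u\<^sup>2 / (1 - u)\<^sup>2 + 36 * u / (1 - u) ^ 3)
      \<longlongrightarrow> lam / (2 * (1 - 0)) + 2 * lam * 0\<^sup>2 / (1 - 0)\<^sup>2 + 36 * 0 / (1 - 0) ^ 3) (at_right 0)"
    by (intro tendsto_intros) auto
  then have 1: "\<forall>\<^sub>F u in at_right 0. lam / (2 * (1 - u)) + 2 * lam * u\<^sup>2 / (1 - u)\<^sup>2 + 36 * u / (1 - u) ^ 3 < \<kappa>"
    by (rule order_tendstoD) (use assms in simp)
  have "((\<lambda>u. lam * (1 - 2 * u / (1 - u)) / (2 * (1 + u\<^sup>2)))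
      \<longlongrightarrow> lam * (1 - 2 * 0 / (1 - 0)) / (2 * (1 + 0\<^sup>2))) (at_right 0)"
    by (intro tendsto_intros) auto
  then have 2: "\<forall>\<^sub>F u in at_right 0. \<kappa>' < lam * (1 - 2 * u / (1 - u)) / (2 * (1 + u\<^sup>2))"
    by (rule order_tendstoD) (use assms in simp)
  have 3: "\<forall>\<^sub>F u :: real in at_right 0. u \<in> {0<..<1/3}" by (rule eventually_at_right_real) simp
  have "\<forall>\<^sub>F u in at_right 0. 0 < u \<and> u < 1 \<and> 2 * u \<le> 1 - u \<and>
    lam / (2 * (1 - u)) + 2 * lam * u\<^sup>2 / (1 - u)\<^sup>2 + 36 * u / (1 - u) ^ 3 \<le> \<kappa> \<and>
    \<kappa>' \<le> lam * (1 - 2 * u / (1 - u)) / (2 * (1 + u\<^sup>2))"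
    using 1 2 3 by eventually_elim auto
  then show ?thesis by (rule eventually_happens'[OF trivial_limit_at_right_real])
qed

text \<open>The region is 1 - a \<le> \<open>C * r ^ 3\<close>, s \<le> \<open>K * r ^ 4\<close>.
  The first coefficient tends to lam / 2; the second is of order \<open>r ^ 3\<close> and hence
  negligible against \<open>r\<^sup>2\<close>.\<close>

lemma contraction_coefficients_small:
  fixes lam C K \<rho> :: real
  assumes lam: "lam / 2 < \<rho>" "0 < \<rho>"
  shows "\<forall>\<^sub>F r in at_right 0. 3/4 \<le> 1 - C * r ^ 3 \<and> K * r ^ 4 \<le> 1 \<and>
    lam * (1 / (1 - C * r ^ 3) * (2 * (C * r ^ 3 + K * r ^ 4) + K * r ^ 4 / (2 * (1 - C * r ^ 3)\<^sup>2))
       + (1 + K * r ^ 4) / 2 * (1 / (1 - C * r ^ 3) ^ 4)) + (r\<^sup>2 + r) * (1 / (1 - C * r ^ 3) ^ 4) \<le> \<rho> \<and>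
    lam * (1 / (1 - C * r ^ 3) * (2 * (C * r ^ 3 + K * r ^ 4) + K * r ^ 4 / (2 * (1 - C * r ^ 3)\<^sup>2))
       + (1 + K * r ^ 4) / 2 * (2 * (K * r ^ 4) / (1 - C * r ^ 3) ^ 4))
       + (r\<^sup>2 + r) * (2 * (K * r ^ 4) / (1 - C * r ^ 3) ^ 4) \<le> \<rho> * r\<^sup>2"
proof -
  define al where "al r = 1 - C * r ^ 3" for r
  define c1 where "c1 r = lam * (1 / al r * (2 * (C * r ^ 3 + K * r ^ 4) + K * r ^ 4 / (2 * (al r)\<^sup>2))
       + (1 + K * r ^ 4) / 2 * (1 / al r ^ 4)) + (r\<^sup>2 + r) * (1 / al r ^ 4)" for r
  \<comment> \<open>The second coefficient divided by \<open>r\<^sup>2\<close>, written so that its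
    limit at 0 is visible.\<close>
  define c2 where "c2 r = lam * (1 / al r * (2 * (C * r + K * r\<^sup>2) + K * r\<^sup>2 / (2 * (al r)\<^sup>2))
       + (1 + K * r ^ 4) / 2 * (2 * (K * r\<^sup>2) / al r ^ 4)) + (r\<^sup>2 + r) * (2 * (K * r\<^sup>2) / al r ^ 4)" for r
  have al: "(al \<longlongrightarrow> 1 - C * 0 ^ 3) (at_right 0)" unfolding al_def[abs_def] by (intro tendsto_intros)
  then have al: "(al \<longlongrightarrow> 1) (at_right 0)" by simp
  have "(c1 \<longlongrightarrow> lam * (1 / 1 * (2 * (C * 0 ^ 3 + K * 0 ^ 4) + K * 0 ^ 4 / (2 * 1\<^sup>2))
       + (1 + K * 0 ^ 4) / 2 * (1 / 1 ^ 4)) + (0\<^sup>2 + 0) * (1 / 1 ^ 4)) (at_right 0)"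
    unfolding c1_def[abs_def] by (intro tendsto_intros al) auto
  then have 1: "\<forall>\<^sub>F r in at_right 0. c1 r < \<rho>" by (rule order_tendstoD) (use lam in simp)
  have "(c2 \<longlongrightarrow> lam * (1 / 1 * (2 * (C * 0 + K * 0\<^sup>2) + K * 0\<^sup>2 / (2 * 1\<^sup>2))
       + (1 + K * 0 ^ 4) / 2 * (2 * (K * 0\<^sup>2) / 1 ^ 4)) + (0\<^sup>2 + 0) * (2 * (K * 0\<^sup>2) / 1 ^ 4)) (at_right 0)"
    unfolding c2_def[abs_def] by (intro tendsto_intros al) auto
  then have 2: "\<forall>\<^sub>F r in at_right 0. c2 r < \<rho>" by (rule order_tendstoD) (use lam in simp)
  have 3: "\<forall>\<^sub>F r in at_right 0. 3/4 < al r" by (rule order_tendstoD[OF al]) simp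
  have "((\<lambda>r. K * r ^ 4) \<longlongrightarrow> K * 0 ^ 4) (at_right 0)" by (intro tendsto_intros)
  then have 4: "\<forall>\<^sub>F r in at_right 0. K * r ^ 4 < 1" by (rule order_tendstoD) simp
  show ?thesis using 1 2 3 4
  proof eventually_elim
    case (elim r)
    have "lam * (1 / al r * (2 * (C * r ^ 3 + K * r ^ 4) + K * r ^ 4 / (2 * (al r)\<^sup>2))
       + (1 + K * r ^ 4) / 2 * (2 * (K * r ^ 4) / al r ^ 4))
       + (r\<^sup>2 + r) * (2 * (K * r ^ 4) / al r ^ 4) = c2 r * r\<^sup>2"
    proof -
      have r3: "C * r ^ 3 = (C * r) * r\<^sup>2" "K * r ^ 4 = (K * r\<^sup>2) * r\<^sup>2"
        by (simp_all add: power2_eq_square power3_eq_cube power4_eq_xxxx)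
      have "lam * (i * (2 * (x * z + y * z) + y * z / j) + l * (2 * (y * z) / k)) + p * (2 * (y * z) / k)
        = (lam * (i * (2 * (x + y) + y / j) + l * (2 * y / k)) + p * (2 * y / k)) * z"
        for i j k l x y z p :: real
        by (simp add: distrib_left distrib_right mult_ac)
      from this[of "1 / al r" "C * r" "r\<^sup>2" "K * r\<^sup>2" "2 * (al r)\<^sup>2" "(1 + K * r ^ 4) / 2" "al r ^ 4" "r\<^sup>2 + r"]
      show ?thesis unfolding c2_def r3(1) by (simp only: r3(2)[symmetric])
    qed
    moreover have "c2 r * r\<^sup>2 \<le> \<rho> * r\<^sup>2" using elim by (intro mult_right_mono) auto
    ultimately show ?case using elim unfolding c1_def al_def[symmetric] by simp
  qed
qed

context real_se
begin

text \<open>The increments are measured by \<open>W = D + r\<^sup>2 * E\<close>, where E belongs to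
  a and D to s. The slope of \<open>se_F\<close> may be as large as 1 + 1 / r, so the weight of E
  has to vanish faster than r; the influence of E on the next D is of order \<open>r ^ 3\<close>, so
  it has to vanish more slowly than that. The exponent 2 lies in between.\<close>

lemma converges_if_contracting:
  assumes r: "0 < r" and al: "3/4 \<le> \<alpha>" and sg: "\<sigma> \<le> 1" and \<rho>: "\<rho> < 1"
    and reg: "\<And>n. N \<le> n \<Longrightarrow> \<alpha> \<le> a n \<and> a n \<le> 1 \<and> 2 * r ^ 4 \<le> s n \<and> s n \<le> \<sigma>"
    and c1: "lam * (1 / \<alpha> * (2 * (1 - \<alpha> + \<sigma>) + \<sigma> / (2 * \<alpha>\<^sup>2)) + (1 + \<sigma>) / 2 * (1 / \<alpha> ^ 4))
      + (r\<^sup>2 + r) * (1 / \<alpha> ^ 4) \<le> \<rho>"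
    and c2: "lam * (1 / \<alpha> * (2 * (1 - \<alpha> + \<sigma>) + \<sigma> / (2 * \<alpha>\<^sup>2)) + (1 + \<sigma>) / 2 * (2 * \<sigma> / \<alpha> ^ 4))
      + (r\<^sup>2 + r) * (2 * \<sigma> / \<alpha> ^ 4) \<le> \<rho> * r\<^sup>2"
  shows "convergent a" "convergent s"
proof -
  define E where "E n = \<bar>a (Suc n) - a n\<bar>" for n
  define D where "D n = \<bar>s (Suc n) - s n\<bar>" for n
  define W where "W n = D n + r\<^sup>2 * E n" for n
  have nn: "0 \<le> E n" "0 \<le> D n" for n by (auto simp: E_def D_def)
  have step: "W (Suc n) \<le> \<rho> * W n" if n: "N \<le> n" for n
  proof -
    have R: "\<alpha> \<le> a n" "a n \<le> 1" "2 * r ^ 4 \<le> s n" "s n \<le> \<sigma>"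
      "\<alpha> \<le> a (Suc n)" "a (Suc n) \<le> 1" "2 * r ^ 4 \<le> s (Suc n)" "s (Suc n) \<le> \<sigma>"
      using reg[OF n] reg[of "Suc n"] n by auto
    have "D (Suc n) = lam * \<bar>se_N (A (Suc n)) (m (Suc n)) - se_N (A n) (m n)\<bar>"
      unfolding D_def s_Suc using lam by (simp add: abs_mult flip: right_diff_distrib)
    also have "\<dots> \<le> lam * ((E n + D n) / \<alpha> * (2 * (1 - \<alpha> + \<sigma>) + \<sigma> / (2 * \<alpha>\<^sup>2))
       + (1 + \<sigma>) / 2 * ((2 * \<sigma> * E n + D n) / \<alpha> ^ 4))"
      unfolding E_def D_def using R al lam by (intro mult_left_mono N_diff_le) auto
    finally have 1: "D (Suc n) \<le> lam * ((E n + D n) / \<alpha> * (2 * (1 - \<alpha> + \<sigma>) + \<sigma> / (2 * \<alpha>\<^sup>2))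
       + (1 + \<sigma>) / 2 * ((2 * \<sigma> * E n + D n) / \<alpha> ^ 4))" .
    have "E (Suc n) = \<bar>se_F (m (Suc n)) - se_F (m n)\<bar>" by (simp only: E_def a_Suc)
    also have "\<dots> \<le> (1 + 1 / r) * ((2 * \<sigma> * E n + D n) / \<alpha> ^ 4)"
      unfolding E_def D_def using R al r sg by (intro F_diff_le) auto
    finally have "E (Suc n) \<le> (1 + 1 / r) * ((2 * \<sigma> * E n + D n) / \<alpha> ^ 4)" .
    then have "r\<^sup>2 * E (Suc n) \<le> r\<^sup>2 * ((1 + 1 / r) * ((2 * \<sigma> * E n + D n) / \<alpha> ^ 4))"
      by (intro mult_left_mono) auto
    also have "\<dots> = (r\<^sup>2 + r) * ((2 * \<sigma> * E n + D n) / \<alpha> ^ 4)"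
    proof -
      have "r\<^sup>2 * (1 + 1 / r) = r\<^sup>2 + r" using r by (simp add: power2_eq_square field_simps)
      then show ?thesis by (simp only: mult.assoc[symmetric])
    qed
    finally have 2: "r\<^sup>2 * E (Suc n) \<le> (r\<^sup>2 + r) * ((2 * \<sigma> * E n + D n) / \<alpha> ^ 4)" .
    have "lam * ((e + d) / \<alpha> * p + q * ((2 * \<sigma> * e + d) / k)) + l * ((2 * \<sigma> * e + d) / k)
      = (lam * (1 / \<alpha> * p + q * (1 / k)) + l * (1 / k)) * d
        + (lam * (1 / \<alpha> * p + q * (2 * \<sigma> / k)) + l * (2 * \<sigma> / k)) * e" for e d p q k l
      by (simp add: distrib_left distrib_right add_divide_distrib mult_ac)
    from this[of "E n" "D n" "2 * (1 - \<alpha> + \<sigma>) + \<sigma> / (2 * \<alpha>\<^sup>2)" "(1 + \<sigma>) / 2" "\<alpha> ^ 4" "r\<^sup>2 + r"]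
    have "W (Suc n) \<le> (lam * (1 / \<alpha> * (2 * (1 - \<alpha> + \<sigma>) + \<sigma> / (2 * \<alpha>\<^sup>2)) + (1 + \<sigma>) / 2 * (1 / \<alpha> ^ 4))
      + (r\<^sup>2 + r) * (1 / \<alpha> ^ 4)) * D n
      + (lam * (1 / \<alpha> * (2 * (1 - \<alpha> + \<sigma>) + \<sigma> / (2 * \<alpha>\<^sup>2)) + (1 + \<sigma>) / 2 * (2 * \<sigma> / \<alpha> ^ 4))
      + (r\<^sup>2 + r) * (2 * \<sigma> / \<alpha> ^ 4)) * E n"
      using 1 2 unfolding W_def by linarith
    also have "\<dots> \<le> \<rho> * D n + (\<rho> * r\<^sup>2) * E n" using c1 c2 nn by (intro add_mono mult_right_mono)
    finally show ?thesis by (simp add: W_def algebra_simps)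
  qed
  have W0: "0 \<le> W n" for n using nn by (simp add: W_def)
  show "convergent s"
    by (rule convergent_of_geometric_increments[of N s 1 W \<rho>]) (use nn W0 step \<rho> in \<open>auto simp: W_def D_def\<close>)
  show "convergent a"
  proof (rule convergent_of_geometric_increments[of N a "1 / r\<^sup>2" W \<rho>])
    show "\<bar>a (Suc n) - a n\<bar> \<le> 1 / r\<^sup>2 * W n" for n
      using r nn(2)[of n] by (simp add: W_def E_def[symmetric] field_simps)
  qed (use W0 step \<rho> in auto)
qed

text \<open>The bound on w is exactly what makes the level \<open>u\<^sup>2\<close> invariant under
  V' = k V + 4 w.\<close>

lemma V_trapped:
  assumes T: "a T \<le> 1" "V T \<le> u\<^sup>2" and u: "0 < u" "u < 1" and k: "lam / 2 \<le> k" "k < 1"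
    and phi: "lam / (2 * (1 - u)) + 2 * lam * u\<^sup>2 / (1 - u)\<^sup>2 + 36 * u / (1 - u) ^ 3 \<le> k"
    and wu: "4 * w \<le> (1 - k) * u\<^sup>2"
  shows "a (n + T) \<le> 1 \<and> V (n + T) \<le> u\<^sup>2 \<and> V (n + T) \<le> k ^ n * u\<^sup>2 + 4 * w / (1 - k)"
proof (induction n)
  case 0
  have "0 \<le> 4 * w / (1 - k)" using w k by simp
  then show ?case using T by simp
next
  case (Suc n)
  have k0: "0 \<le> k" using lam k by simp
  have V: "V (Suc (n + T)) \<le> k * V (n + T) + 4 * w" using Suc u k phi by (intro V_step) auto
  have "k * V (n + T) \<le> k * u\<^sup>2" using Suc k0 by (intro mult_left_mono) auto
  then have 1: "V (Suc (n + T)) \<le> u\<^sup>2" using V wu by (simp add: algebra_simps)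
  have "k * V (n + T) \<le> k * (k ^ n * u\<^sup>2 + 4 * w / (1 - k))" using Suc k0 by (intro mult_left_mono) auto
  moreover have "k * (4 * w / (1 - k)) + 4 * w = 4 * w / (1 - k)" using k by (simp add: field_simps)
  ultimately have "V (Suc (n + T)) \<le> k ^ Suc n * u\<^sup>2 + 4 * w / (1 - k)" using V by (simp add: distrib_left mult.assoc)
  then show ?case using 1 a_Suc_le_1 by simp
qed

lemma s_lower:
  assumes step: "\<And>n. k' * s (n + T) + 4 * w \<le> s (Suc (n + T))" and k': "0 \<le> k'" "k' < 1"
  shows "(1 - k' ^ n) * (4 * w / (1 - k')) \<le> s (n + T)"
proof (induction n)
  case 0
  then show ?case using s_nonneg by simp
next
  case (Suc n)
  define c where "c = 4 * w / (1 - k')"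
  have "(1 - k') * c = 4 * w" using k' by (simp add: c_def)
  then have c: "4 * w = c - k' * c" by (simp add: left_diff_distrib)
  have "k' * ((1 - k' ^ n) * c) \<le> k' * s (n + T)" using Suc k' unfolding c_def by (intro mult_left_mono)
  moreover have "k' * ((1 - k' ^ n) * c) + (c - k' * c) = (1 - k' ^ Suc n) * c" by (simp add: algebra_simps)
  moreover have "k' * s (n + T) + (c - k' * c) \<le> s (Suc n + T)" using step[of n] c by simp
  ultimately have "(1 - k' ^ Suc n) * c \<le> s (Suc n + T)" by linarith
  then show ?case unfolding c_def .
qed

text \<open>V is eventually below K w, because K = 5 / (1 - k) exceeds the asymptotic level 4 / (1 -
  k). With \<open>w = r ^ 4\<close> this puts s between \<open>4 * r ^ 4\<close> and
  \<open>K * r ^ 4\<close>. Since a \<ge> 1/2, the ratio satisfies 1 - m \<le> 4 K w, and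
  \<open>one_minus_F_le\<close> gives 1 - a \<le> \<open>C * r ^ 3\<close> one step later.\<close>

lemma trapped_converges:
  assumes w0: "0 < w" and T: "1 \<le> T" "V T \<le> u\<^sup>2" and u: "0 < u" "u < 1" "2 * u \<le> 1 - u" and k: "lam / 2 \<le> k" "k < 1"
    and phi: "lam / (2 * (1 - u)) + 2 * lam * u\<^sup>2 / (1 - u)\<^sup>2 + 36 * u / (1 - u) ^ 3 \<le> k"
    and wu: "4 * w \<le> (1 - k) * u\<^sup>2"
    and K: "K = 5 / (1 - k)" and C: "C = 3 * (4 * K) powr (3/4)"
    and r: "0 < r" "w = r ^ 4"
    and co: "3/4 \<le> 1 - C * r ^ 3" "K * r ^ 4 \<le> 1"
    "lam * (1 / (1 - C * r ^ 3) * (2 * (C * r ^ 3 + K * r ^ 4) + K * r ^ 4 / (2 * (1 - C * r ^ 3)\<^sup>2))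
       + (1 + K * r ^ 4) / 2 * (1 / (1 - C * r ^ 3) ^ 4)) + (r\<^sup>2 + r) * (1 / (1 - C * r ^ 3) ^ 4) \<le> k"
    "lam * (1 / (1 - C * r ^ 3) * (2 * (C * r ^ 3 + K * r ^ 4) + K * r ^ 4 / (2 * (1 - C * r ^ 3)\<^sup>2))
       + (1 + K * r ^ 4) / 2 * (2 * (K * r ^ 4) / (1 - C * r ^ 3) ^ 4))
       + (r\<^sup>2 + r) * (2 * (K * r ^ 4) / (1 - C * r ^ 3) ^ 4) \<le> k * r\<^sup>2"
  shows "convergent a" "convergent s"
proof -
  have "a T \<le> 1" using T a_Suc_le_1[of "T - 1"] by simp
  note tr = V_trapped[OF this T(2) u(1,2) k phi wu]
  have k0: "0 \<le> k" using lam k by simp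
  have K0: "0 < K" using k K by simp
  have "(\<lambda>n. k ^ n * u\<^sup>2 + 4 * w / (1 - k)) \<longlonglongrightarrow> 0 * u\<^sup>2 + 4 * w / (1 - k)"
    by (intro tendsto_intros LIMSEQ_power_zero) (use k k0 in auto)
  moreover have "0 * u\<^sup>2 + 4 * w / (1 - k) < K * w" using w0 k unfolding K by (simp add: divide_strict_right_mono)
  ultimately have "\<forall>\<^sub>F n in sequentially. k ^ n * u\<^sup>2 + 4 * w / (1 - k) < K * w" by (rule order_tendstoD)
  then obtain N where N: "\<And>n. N \<le> n \<Longrightarrow> k ^ n * u\<^sup>2 + 4 * w / (1 - k) < K * w"
    unfolding eventually_sequentially by blast
  \<comment> \<open>The additional \<open>Suc\<close> provides the predecessor from which the bounds
    on a and on s from below are read off.\<close>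
  have reg: "1 - C * r ^ 3 \<le> a n \<and> a n \<le> 1 \<and> 2 * r ^ 4 \<le> s n \<and> s n \<le> K * r ^ 4" if n: "Suc N + T \<le> n" for n
  proof -
    obtain j where j: "n = Suc (j + T)" "N \<le> j" using n by (intro that[of "n - Suc T"]) auto
    have sK: "s i \<le> K * w" if "i = l + T" "N \<le> l" for i l
    proof -
      have "s i \<le> V i" unfolding V_def by simp
      then show ?thesis using tr[of l] N[of l] that by simp
    qed
    have s4: "4 * w \<le> s n" unfolding j(1) s_Suc using lam se_N_nonneg[of "m (j + T)"] m_pos[of "j + T"] m_le_1[of "j + T"] by simp
    have "1 - u \<le> a (j + T)" using V_bounds(2)[of "j + T" u] tr[of j] u by simp
    then have "1/2 \<le> a (j + T)" using u by simp
    then have "1 - m (j + T) \<le> s (j + T) / (1/2)\<^sup>2" by (intro one_minus_m_le) auto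
    also have "\<dots> \<le> 4 * K * w" using sK[of "j + T" j] j by (simp add: power2_eq_square)
    finally have "(1 - m (j + T)) powr (3/4) \<le> (4 * K * r ^ 4) powr (3/4)"
      using m_le_1[of "j + T"] r by (intro powr_mono2) auto
    also have "\<dots> = (4 * K) powr (3/4) * (r ^ 4) powr (3/4)" by (rule powr_mult)
    also have "(r ^ 4) powr (3/4) = r ^ 3"
    proof -
      have "(r ^ 4) powr (3/4) = (r powr 4) powr (3/4)" using r by (simp add: powr_numeral)
      also have "\<dots> = r ^ 3" using r by (simp only: powr_powr) (simp add: powr_numeral)
      finally show ?thesis .
    qed
    finally have "3 * (1 - m (j + T)) powr (3/4) \<le> C * r ^ 3" unfolding C by simp
    then have "1 - a n \<le> C * r ^ 3"
      unfolding j(1) a_Suc using one_minus_F_le[of "m (j + T)"] m_pos[of "j + T"] m_le_1[of "j + T"] by simp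
    moreover have "0 < r ^ 4" using r by simp
    then have "2 * r ^ 4 \<le> s n" using s4 unfolding r(2) by linarith
    ultimately show ?thesis using sK[of n "Suc j"] j a_Suc_le_1 unfolding r(2) by simp
  qed
  have e: "1 - (1 - C * r ^ 3) + K * r ^ 4 = C * r ^ 3 + K * r ^ 4" by simp
  show "convergent a"
    by (rule converges_if_contracting(1)[OF r(1) co(1,2) k(2) reg, unfolded e, OF _ co(3,4)])
  show "convergent s"
    by (rule converges_if_contracting(2)[OF r(1) co(1,2) k(2) reg, unfolded e, OF _ co(3,4)])
qed

end

section \<open>Small noise as a perturbation of the noiseless orbit\<close>

fun rse :: "real \<Rightarrow> real \<Rightarrow> real \<Rightarrow> real \<Rightarrow> nat \<Rightarrow> real \<times> real" where
  "rse lam w a0 s0 0 = (a0, s0)"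
| "rse lam w a0 s0 (Suc n) = (let (a, s) = rse lam w a0 s0 n in
     (se_F (a\<^sup>2 / (a\<^sup>2 + s)), lam * se_N (sqrt (a\<^sup>2 + s)) (a\<^sup>2 / (a\<^sup>2 + s)) + 4 * w))"

abbreviation rse_a where "rse_a lam w a0 s0 n \<equiv> fst (rse lam w a0 s0 n)"
abbreviation rse_s where "rse_s lam w a0 s0 n \<equiv> snd (rse lam w a0 s0 n)"
abbreviation rse_m where "rse_m lam w a0 s0 n \<equiv>
  (rse_a lam w a0 s0 n)\<^sup>2 / ((rse_a lam w a0 s0 n)\<^sup>2 + rse_s lam w a0 s0 n)"
abbreviation rse_A where "rse_A lam w a0 s0 n \<equiv>
  sqrt ((rse_a lam w a0 s0 n)\<^sup>2 + rse_s lam w a0 s0 n)"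

lemma real_se_rse:
  assumes "0 < lam" "0 \<le> w" "0 < a0" "0 \<le> s0"
  shows "real_se lam w (rse_a lam w a0 s0) (rse_s lam w a0 s0) (rse_m lam w a0 s0) (rse_A lam w a0 s0)"
  using assms by unfold_locales (auto simp: Let_def split: prod.splits)

text \<open>Continuity in the noise level at 0 for a fixed number n of steps, with no uniformity in
  n; later n will be an entry time that does not depend on w.\<close>

lemma rse_tendsto:
  assumes "0 < lam" "0 < a0" "0 \<le> s0"
  shows "((\<lambda>w. rse_a lam w a0 s0 n) \<longlongrightarrow> rse_a lam 0 a0 s0 n) (at_right 0) \<and>
    ((\<lambda>w. rse_s lam w a0 s0 n) \<longlongrightarrow> rse_s lam 0 a0 s0 n) (at_right 0)"
proof (induction n)
  case (Suc n)
  interpret z: real_se lam 0 "rse_a lam 0 a0 s0" "rse_s lam 0 a0 s0" "rse_m lam 0 a0 s0" "rse_A lam 0 a0 s0"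
    by (rule real_se_rse) (use assms in auto)
  have p: "(rse_a lam 0 a0 s0 n)\<^sup>2 + rse_s lam 0 a0 s0 n \<noteq> 0"
    using z.A_sq[of n] z.A_pos[of n] by (metis less_irrefl power_eq_0_iff)
  have A: "((\<lambda>w. rse_A lam w a0 s0 n) \<longlongrightarrow> rse_A lam 0 a0 s0 n) (at_right 0)"
    using Suc by (intro tendsto_real_sqrt tendsto_add tendsto_power) auto
  have m: "((\<lambda>w. rse_m lam w a0 s0 n) \<longlongrightarrow> rse_m lam 0 a0 s0 n) (at_right 0)"
    using Suc p by (intro tendsto_divide tendsto_add tendsto_power) auto
  \<comment> \<open>\<open>se_F\<close> and \<open>se_M\<close> are known to be continuous only on
    [0, 1].\<close>
  have in01: "\<forall>\<^sub>F w in at_right 0. rse_m lam w a0 s0 n \<in> {0..1}"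
    unfolding eventually_at_filter
  proof (rule always_eventually, intro allI impI)
    fix w :: real assume "w \<in> {0<..}"
    then interpret y: real_se lam w "rse_a lam w a0 s0" "rse_s lam w a0 s0" "rse_m lam w a0 s0" "rse_A lam w a0 s0"
      by (intro real_se_rse) (use assms in auto)
    show "rse_m lam w a0 s0 n \<in> {0..1}" using y.m_pos[of n] y.m_le_1[of n] by simp
  qed
  have in0: "rse_m lam 0 a0 s0 n \<in> {0..1}" using z.m_pos[of n] z.m_le_1[of n] by simp
  have F: "((\<lambda>w. se_F (rse_m lam w a0 s0 n)) \<longlongrightarrow> se_F (rse_m lam 0 a0 s0 n)) (at_right 0)"
    by (rule continuous_on_tendsto_compose[OF continuous_se_F m in0 in01])
  have M: "((\<lambda>w. se_M (rse_m lam w a0 s0 n)) \<longlongrightarrow> se_M (rse_m lam 0 a0 s0 n)) (at_right 0)"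
    by (rule continuous_on_tendsto_compose[OF continuous_se_M m in0 in01])
  have "((\<lambda>w. lam * se_N (rse_A lam w a0 s0 n) (rse_m lam w a0 s0 n) + 4 * w)
    \<longlongrightarrow> lam * se_N (rse_A lam 0 a0 s0 n) (rse_m lam 0 a0 s0 n) + 4 * 0) (at_right 0)"
    unfolding se_N_def by (intro tendsto_intros A M)
  with F show ?case by (simp add: Let_def split_beta)
qed (auto intro: tendsto_const)

text \<open>The limit of the error is at most the asymptotic level 4 w / (1 - k) of V and at least
  the asymptotic level 4 w / (1 - k') of s. The rates k and k' stay free so that both can later tend
  to lam / 2.\<close>

lemma amse_bounds:
  assumes lam: "0 < lam" "lam < lam_crit" and init: "0 < a0" "a0 \<le> 1" "0 \<le> s0" "s0 < 1"
    and k: "lam / 2 < k" "k < 1" and k': "0 \<le> k'" "k' < lam / 2"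
  shows "\<forall>\<^sub>F w in at_right 0. \<exists>L. (\<lambda>n. (1 - rse_a lam w a0 s0 n)\<^sup>2 + rse_s lam w a0 s0 n) \<longlonglongrightarrow> L \<and>
    4 / (1 - k') \<le> L / w \<and> L / w \<le> 4 / (1 - k)"
proof -
  obtain u where u: "0 < u" "u < 1" "2 * u \<le> 1 - u"
    "lam / (2 * (1 - u)) + 2 * lam * u\<^sup>2 / (1 - u)\<^sup>2 + 36 * u / (1 - u) ^ 3 \<le> k"
    "k' \<le> lam * (1 - 2 * u / (1 - u)) / (2 * (1 + u\<^sup>2))"
    using exists_trapping_radius[OF k(1) k'(2)] by blast
  interpret z: noiseless_se lam "rse_a lam 0 a0 s0" "rse_s lam 0 a0 s0" "rse_m lam 0 a0 s0" "rse_A lam 0 a0 s0"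
    using real_se_rse[of lam 0 a0 s0] lam init unfolding noiseless_se_def noiseless_se_axioms_def by simp
  have "(\<lambda>n. rse_s lam 0 a0 s0 n + 4 * (1 - rse_a lam 0 a0 s0 n)\<^sup>2) \<longlonglongrightarrow> 0 + 4 * (1 - 1)\<^sup>2"
    by (intro tendsto_intros z.converges)
  then have "\<forall>\<^sub>F n in sequentially. rse_s lam 0 a0 s0 n + 4 * (1 - rse_a lam 0 a0 s0 n)\<^sup>2 < u\<^sup>2"
    by (rule order_tendstoD) (use u in simp)
  \<comment> \<open>The entry time is taken from the noiseless orbit, before w is chosen.\<close>
  then obtain T where T: "1 \<le> T" "rse_s lam 0 a0 s0 T + 4 * (1 - rse_a lam 0 a0 s0 T)\<^sup>2 < u\<^sup>2"
    unfolding eventually_sequentially by (metis nat_le_linear)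
  have "((\<lambda>w. rse_s lam w a0 s0 T + 4 * (1 - rse_a lam w a0 s0 T)\<^sup>2) \<longlongrightarrow>
      rse_s lam 0 a0 s0 T + 4 * (1 - rse_a lam 0 a0 s0 T)\<^sup>2) (at_right 0)"
    using rse_tendsto[of lam a0 s0 T] lam init
    by (intro tendsto_add tendsto_mult tendsto_power tendsto_diff tendsto_const) auto
  then have e1: "\<forall>\<^sub>F w in at_right 0. rse_s lam w a0 s0 T + 4 * (1 - rse_a lam w a0 s0 T)\<^sup>2 < u\<^sup>2"
    by (rule order_tendstoD) (use T in simp)
  have e2: "\<forall>\<^sub>F w in at_right 0. w \<in> {0<..<(1 - k) * u\<^sup>2 / 4}"
    by (rule eventually_at_right_real) (use k u in simp)
  define K where "K = 5 / (1 - k)"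
  define C where "C = 3 * (4 * K) powr (3/4)"
  \<comment> \<open>The contraction estimates are stated in terms of r with
    \<open>w = r ^ 4\<close>; this carries them over to small w.\<close>
  have "filterlim (\<lambda>w :: real. root 4 w) (at_right 0) (at_right 0)"
    unfolding filterlim_at
  proof
    have "((\<lambda>w :: real. root 4 w) \<longlongrightarrow> root 4 0) (at_right 0)" by (intro tendsto_intros)
    then show "((\<lambda>w :: real. root 4 w) \<longlongrightarrow> 0) (at_right 0)" by simp
    show "\<forall>\<^sub>F x :: real in at_right 0. root 4 x \<in> {0<..} \<and> root 4 x \<noteq> 0"
      unfolding eventually_at_filter by (rule always_eventually) auto
  qed
  note e3 = eventually_compose_filterlim[OF contraction_coefficients_small[of lam k C K, OF k(1)] this]
  have k0: "0 < k" using lam k by simp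
  show ?thesis using e1 e2 e3[OF k0]
  proof eventually_elim
    case (elim w)
    then have w: "0 < w" "4 * w \<le> (1 - k) * u\<^sup>2" by auto
    interpret y: real_se lam w "rse_a lam w a0 s0" "rse_s lam w a0 s0" "rse_m lam w a0 s0" "rse_A lam w a0 s0"
      by (rule real_se_rse) (use lam init w in auto)
    have VT: "y.V T \<le> u\<^sup>2" using elim by (simp add: y.V_def)
    have r: "0 < root 4 w" "w = root 4 w ^ 4" using w by auto
    have cv: "convergent (rse_a lam w a0 s0)" "convergent (rse_s lam w a0 s0)"
      by (rule y.trapped_converges[where k = k and u = u and T = T and r = "root 4 w" and C = C and K = K];
          use w T(1) VT u k r K_def C_def elim(3) in simp)+
    then obtain al sl where lim: "rse_a lam w a0 s0 \<longlonglongrightarrow> al" "rse_s lam w a0 s0 \<longlonglongrightarrow> sl"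
      by (auto simp: convergent_def)
    define L where "L = (1 - al)\<^sup>2 + sl"
    have L: "(\<lambda>n. (1 - rse_a lam w a0 s0 n)\<^sup>2 + rse_s lam w a0 s0 n) \<longlonglongrightarrow> L"
      unfolding L_def by (intro tendsto_intros lim)
    have aT: "rse_a lam w a0 s0 T \<le> 1" using T y.a_Suc_le_1[of "T - 1"] by simp
    have tr: "rse_a lam w a0 s0 (n + T) \<le> 1 \<and> y.V (n + T) \<le> u\<^sup>2 \<and> y.V (n + T) \<le> k ^ n * u\<^sup>2 + 4 * w / (1 - k)" for n
      by (rule y.V_trapped) (use aT VT u k w in auto)
    have "L \<le> 4 * w / (1 - k)"
    proof (rule LIMSEQ_le)
      show "(\<lambda>n. (1 - rse_a lam w a0 s0 (n + T))\<^sup>2 + rse_s lam w a0 s0 (n + T)) \<longlonglongrightarrow> L"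
        by (rule LIMSEQ_ignore_initial_segment[OF L])
      have "(\<lambda>n. k ^ n * u\<^sup>2 + 4 * w / (1 - k)) \<longlonglongrightarrow> 0 * u\<^sup>2 + 4 * w / (1 - k)"
        by (intro tendsto_intros LIMSEQ_power_zero) (use k k0 in auto)
      then show "(\<lambda>n. k ^ n * u\<^sup>2 + 4 * w / (1 - k)) \<longlonglongrightarrow> 4 * w / (1 - k)" by simp
      have "(1 - rse_a lam w a0 s0 (n + T))\<^sup>2 + rse_s lam w a0 s0 (n + T) \<le> y.V (n + T)" for n
        by (simp add: y.V_def)
      then show "\<exists>N. \<forall>n\<ge>N. (1 - rse_a lam w a0 s0 (n + T))\<^sup>2 + rse_s lam w a0 s0 (n + T) \<le> k ^ n * u\<^sup>2 + 4 * w / (1 - k)"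
        using tr order_trans by blast
    qed
    moreover have "4 * w / (1 - k') \<le> L"
    proof -
      have k'1: "k' < 1" using k k' by simp
      have low: "(1 - k' ^ n) * (4 * w / (1 - k')) \<le> rse_s lam w a0 s0 (n + T)" for n
        by (rule y.s_lower[OF y.s_step_ge[OF _ u(1,2) _ u(5,3)] k'(1) k'1]) (use tr in auto)
      have "(\<lambda>n. (1 - k' ^ n) * (4 * w / (1 - k'))) \<longlonglongrightarrow> (1 - 0) * (4 * w / (1 - k'))"
        by (intro tendsto_intros LIMSEQ_power_zero) (use k'(1) k'1 in auto)
      then have "(1 - 0) * (4 * w / (1 - k')) \<le> sl"
        using LIMSEQ_ignore_initial_segment[OF lim(2), of T] by (rule LIMSEQ_le) (use low in auto)
      then show ?thesis unfolding L_def by (simp add: add_increasing)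
    qed
    ultimately show ?case using L w(1) by (intro exI[of _ L]) (auto simp: field_simps)
  qed
qed

section \<open>Transfer to the complex recursion\<close>

lemma sqrt_wgt_scale:
  assumes "0 < \<rho>" "c\<^sup>2 = m * \<rho>\<^sup>2" "s = \<rho>\<^sup>2 * (1 - m)"
  shows "sqrt (c\<^sup>2 * (sin \<theta>)\<^sup>2 + s) = \<rho> * sqrt (wgt m \<theta>)"
proof -
  have "c\<^sup>2 * (sin \<theta>)\<^sup>2 + s = \<rho>\<^sup>2 * wgt m \<theta>"
    unfolding assms(2,3) wgt_alt by (simp add: algebra_simps)
  then show ?thesis using assms(1) by (simp add: real_sqrt_mult)
qed

text \<open>The phase factor has modulus 1 and the integral is nonnegative; scaling out the radius
  turns it into \<open>sqrt m * se_X m\<close>.\<close>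

lemma cmod_psi1:
  assumes "a \<noteq> 0" "0 \<le> s"
  shows "cmod (psi1 a s) = se_F ((cmod a)\<^sup>2 / ((cmod a)\<^sup>2 + s))"
proof -
  define c \<rho> m where "c = cmod a" and "\<rho> = sqrt (c\<^sup>2 + s)" and "m = c\<^sup>2 / (c\<^sup>2 + s)"
  have c: "0 < c" using assms by (simp add: c_def)
  then have p: "0 < c\<^sup>2 + s" using assms by (simp add: add_pos_nonneg)
  have \<rho>: "0 < \<rho>" "\<rho>\<^sup>2 = c\<^sup>2 + s" using p by (auto simp: \<rho>_def)
  have m: "0 \<le> m" "m \<le> 1" using p assms by (auto simp: m_def)
  have e: "c\<^sup>2 = m * \<rho>\<^sup>2" "s = \<rho>\<^sup>2 * (1 - m)" using p unfolding \<rho>(2) m_def by (simp_all add: field_simps)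
  have cm: "c = sqrt m * \<rho>" using arg_cong[OF e(1), of sqrt] c \<rho>(1) by (simp add: real_sqrt_mult)
  have "(\<lambda>\<theta>. c * (sin \<theta>)\<^sup>2 / sqrt (c\<^sup>2 * (sin \<theta>)\<^sup>2 + s)) = (\<lambda>\<theta>. sqrt m * ((sin \<theta>)\<^sup>2 / sqrt (wgt m \<theta>)))"
    unfolding sqrt_wgt_scale[OF \<rho>(1) e] using \<rho>(1) by (simp add: cm)
  then have "integral {0..pi/2} (\<lambda>\<theta>. c * (sin \<theta>)\<^sup>2 / sqrt (c\<^sup>2 * (sin \<theta>)\<^sup>2 + s)) = se_F m"
    by (simp only: integral_mult_right se_F_def se_X_def)
  moreover have "0 \<le> se_F m" using m se_X_pos[OF m] by (simp add: se_F_def)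
  ultimately show ?thesis unfolding psi1_def c_def[symmetric] m_def by (simp add: norm_mult)
qed

lemma psi2_eq:
  assumes "a \<noteq> 0" "0 \<le> s"
  shows "psi2 a s \<delta> w = 4 / \<delta> * se_N (sqrt ((cmod a)\<^sup>2 + s)) ((cmod a)\<^sup>2 / ((cmod a)\<^sup>2 + s)) + 4 * w"
proof -
  define c \<rho> m where "c = cmod a" and "\<rho> = sqrt (c\<^sup>2 + s)" and "m = c\<^sup>2 / (c\<^sup>2 + s)"
  have c: "0 < c" using assms by (simp add: c_def)
  then have p: "0 < c\<^sup>2 + s" using assms by (simp add: add_pos_nonneg)
  have \<rho>: "0 < \<rho>" "\<rho>\<^sup>2 = c\<^sup>2 + s" using p by (auto simp: \<rho>_def)
  have e: "c\<^sup>2 = m * \<rho>\<^sup>2" "s = \<rho>\<^sup>2 * (1 - m)" using p unfolding \<rho>(2) m_def by (simp_all add: field_simps)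
  have "(2 * c\<^sup>2 * (sin \<theta>)\<^sup>2 + s) / (\<rho> * sqrt (wgt m \<theta>))
    = 2 * \<rho> * ((m * (sin \<theta>)\<^sup>2 + (1 - m) / 2) / sqrt (wgt m \<theta>))" for \<theta>
  proof -
    have "2 * c\<^sup>2 * (sin \<theta>)\<^sup>2 + s = \<rho> * (2 * \<rho> * (m * (sin \<theta>)\<^sup>2 + (1 - m) / 2))"
      unfolding e by (simp add: power2_eq_square algebra_simps diff_divide_distrib)
    then show ?thesis using \<rho>(1) by simp
  qed
  then have "integral {0..pi/2} (\<lambda>\<theta>. (2 * c\<^sup>2 * (sin \<theta>)\<^sup>2 + s) / sqrt (c\<^sup>2 * (sin \<theta>)\<^sup>2 + s)) = 2 * \<rho> * se_M m"
    unfolding sqrt_wgt_scale[OF \<rho>(1) e] by (simp only: integral_mult_right se_M_def)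
  then show ?thesis
    unfolding psi2_def c_def[symmetric] se_N_def \<rho>_def[symmetric] m_def[symmetric] by (simp add: \<rho>(2))
qed

lemma se_eq_rse:
  assumes "0 < \<delta>" "0 \<le> w" "a0 \<noteq> 0" "0 \<le> s0"
  shows "cmod (fst (se \<delta> w a0 s0 n)) = rse_a (4 / \<delta>) w (cmod a0) s0 n
    \<and> snd (se \<delta> w a0 s0 n) = rse_s (4 / \<delta>) w (cmod a0) s0 n"
proof (induction n)
  case (Suc n)
  interpret real_se "4 / \<delta>" w "rse_a (4 / \<delta>) w (cmod a0) s0" "rse_s (4 / \<delta>) w (cmod a0) s0"
    "rse_m (4 / \<delta>) w (cmod a0) s0" "rse_A (4 / \<delta>) w (cmod a0) s0"
    by (rule real_se_rse) (use assms in auto)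
  obtain a s where as: "se \<delta> w a0 s0 n = (a, s)" by force
  with Suc have eq: "cmod a = rse_a (4 / \<delta>) w (cmod a0) s0 n" "s = rse_s (4 / \<delta>) w (cmod a0) s0 n" by auto
  have "a \<noteq> 0" "0 \<le> s" using a_pos[of n] s_nonneg[of n] by (auto simp flip: eq)
  then show ?case
    unfolding a_Suc s_Suc by (simp add: as cmod_psi1 psi2_eq flip: eq)
qed simp

theorem mainTheorem3:
  fixes \<delta> s0 :: real and a0 :: complex
  assumes "\<delta> > 64 / pi\<^sup>2 - 4"
    and "0 < cmod a0" and "cmod a0 \<le> 1"
    and "0 \<le> s0" and "s0 < 1"
  shows "(\<exists>\<epsilon>>0. \<forall>sw2. 0 < sw2 \<and> sw2 < \<epsilon> \<longrightarrow> convergent (amse_seq \<delta> sw2 a0 s0))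
     \<and> ((\<lambda>sw2. AMSE sw2 \<delta> a0 s0 / sw2) \<longlongrightarrow> 4 / (1 - 2 / \<delta>)) (at_right 0)"
proof -
  define lam where "lam = 4 / \<delta>"
  have crit: "64 / pi\<^sup>2 - 4 = 4 / lam_crit"
  proof -
    have "64 / P - 4 = 4 / (P / (16 - P))" if "P \<noteq> 0" for P :: real using that by (simp add: field_simps)
    from this[of "pi\<^sup>2"] show ?thesis by (simp add: lam_crit_def)
  qed
  have crit0: "0 < lam_crit" using lam_crit_bounds by simp
  have "0 < 4 / lam_crit" using crit0 by simp
  then have \<delta>: "0 < \<delta>" using assms(1) unfolding crit by linarith
  have lam: "0 < lam" "lam < lam_crit"
    using \<delta> crit0 assms(1) unfolding crit lam_def by (simp_all add: field_simps)
  then have lam1: "lam / 2 < 1" using lam_crit_bounds by simp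
  have bounds: "\<forall>\<^sub>F w in at_right 0. convergent (amse_seq \<delta> w a0 s0)
      \<and> 4 / (1 - k') \<le> AMSE w \<delta> a0 s0 / w \<and> AMSE w \<delta> a0 s0 / w \<le> 4 / (1 - k)"
    if k: "lam / 2 < k" "k < 1" "0 \<le> k'" "k' < lam / 2" for k k'
    using amse_bounds[of lam "cmod a0" s0, OF lam assms(2-5) k] eventually_at_right_less[of "0 :: real"]
  proof eventually_elim
    case (elim w)
    then obtain L where L: "(\<lambda>n. (1 - rse_a lam w (cmod a0) s0 n)\<^sup>2 + rse_s lam w (cmod a0) s0 n) \<longlonglongrightarrow> L"
      "4 / (1 - k') \<le> L / w" "L / w \<le> 4 / (1 - k)" by blast
    have "amse_seq \<delta> w a0 s0 = (\<lambda>n. (1 - rse_a lam w (cmod a0) s0 n)\<^sup>2 + rse_s lam w (cmod a0) s0 n)"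
    proof
      fix n
      show "amse_seq \<delta> w a0 s0 n = (1 - rse_a lam w (cmod a0) s0 n)\<^sup>2 + rse_s lam w (cmod a0) s0 n"
        using se_eq_rse[of \<delta> w a0 s0 n] \<delta> elim(2) assms by (auto simp: amse_seq_def lam_def)
    qed
    then have "amse_seq \<delta> w a0 s0 \<longlonglongrightarrow> L" using L(1) by simp
    then show ?case using L(2,3) unfolding AMSE_def by (auto simp: convergent_def limI)
  qed
  have "\<forall>\<^sub>F w in at_right 0. convergent (amse_seq \<delta> w a0 s0)"
    \<comment> \<open>Any admissible pair of rates proves convergence; the midpoint of lam / 2 and 1
      is one choice.\<close>
    using bounds[of "(lam / 2 + 1) / 2" 0] lam lam1 by (auto elim: eventually_mono)
  then obtain b where b: "0 < b" "\<And>w. 0 < w \<Longrightarrow> w < b \<Longrightarrow> convergent (amse_seq \<delta> w a0 s0)"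
    unfolding eventually_at_right_field by blast
  have lim: "4 / (1 - 2 / \<delta>) = 4 / (1 - lam / 2)" by (simp add: lam_def)
  have cont: "((\<lambda>k. 4 / (1 - k)) \<longlongrightarrow> 4 / (1 - lam / 2)) (at (lam / 2) within S)" for S
    using lam1 by (intro tendsto_intros) auto
  \<comment> \<open>The lower estimate uses rates k' increasing to lam / 2, the upper one rates k
    decreasing to it; in each case the other rate is fixed.\<close>
  have "((\<lambda>w. AMSE w \<delta> a0 s0 / w) \<longlongrightarrow> 4 / (1 - lam / 2)) (at_right 0)"
  proof (rule order_tendstoI)
    fix y assume "y < 4 / (1 - lam / 2)"
    from order_tendstoD(1)[OF cont this] have "\<forall>\<^sub>F k in at_left (lam / 2). y < 4 / (1 - k)" .
    moreover have "\<forall>\<^sub>F k in at_left (lam / 2). k \<in> {0<..<lam / 2}" by (rule eventually_at_left_real) (use lam in simp)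
    ultimately have "\<forall>\<^sub>F k in at_left (lam / 2). y < 4 / (1 - k) \<and> 0 < k \<and> k < lam / 2" by eventually_elim auto
    then obtain k' where "y < 4 / (1 - k')" "0 < k'" "k' < lam / 2"
      using eventually_happens'[OF trivial_limit_at_left_real] by blast
    then show "\<forall>\<^sub>F w in at_right 0. y < AMSE w \<delta> a0 s0 / w"
      using bounds[of "(lam / 2 + 1) / 2" k'] lam1 by (auto elim!: eventually_mono)
  next
    fix y assume "4 / (1 - lam / 2) < y"
    from order_tendstoD(2)[OF cont this] have "\<forall>\<^sub>F k in at_right (lam / 2). 4 / (1 - k) < y" .
    moreover have "\<forall>\<^sub>F k in at_right (lam / 2). k \<in> {lam / 2<..<1}" by (rule eventually_at_right_real) (use lam1 in simp)
    ultimately have "\<forall>\<^sub>F k in at_right (lam / 2). 4 / (1 - k) < y \<and> lam / 2 < k \<and> k < 1" by eventually_elim auto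
    then obtain k where "4 / (1 - k) < y" "lam / 2 < k" "k < 1"
      using eventually_happens'[OF trivial_limit_at_right_real] by blast
    then show "\<forall>\<^sub>F w in at_right 0. AMSE w \<delta> a0 s0 / w < y"
      using bounds[of k 0] lam by (auto elim!: eventually_mono)
  qed
  then show ?thesis unfolding lim using b by blast
qed

end
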